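(* For all integers $k\ge 1$ and $n\ge 2$, $$\frac{(k!)^2}{4^{2k}(2k)!\sqrt{24}}\cdot\frac{n^{k/2}}{(n/2+2k)^{k}} \;\leq\; \left(\frac{\mathrm{Vol}\, \widetilde{Sq}}{\mathrm{Vol}\, B_M}\right)^{1/D_M} \;\leq\; \frac{4^{2k}(2k)!\sqrt{24}}{k!}\, n^{-k/2},$$ where $\widetilde{Sq}=\widetilde{Sq}_{n,2k}$ is the translated section of the cone of sums of squares of degree $2k$ in $n$ variables, and $B_M$, $D_M$ are the $L^2$ unit ball and the dimension of the space $M_{n,2k}$ of forms of integral zero on the sphere.
   Context: $P_{n,m}$ is the real vector space of real homogeneous polynomials (forms) of degree $m$ in $n$ variables. $S^{n-1}$ is the unit sphere in $\mathbb{R}^n$ and $\sigma$ is the rotation invariant probability measure on it. $P_{n,2k}$ carries the inner product $\langle f,g\rangle=\int_{S^{n-1}} fg\,d\sigma$. $M=M_{n,2k}=\{f\in P_{n,2k} : \int_{S^{n-1}} f\,d\sigma=0\}$, $D_M=\dim M_{n,2k}$, and $B_M$ is the unit ball of $M_{n,2k}$ in the inner product $\langle\,,\rangle$; $\mathrm{Vol}$ is Lebesgue measure on $M_{n,2k}$ for this inner product. Let $r^{2k}=(x_1^2+\dots+x_n^2)^k$. The cone of sums of squares is $Sq=\{f\in P_{n,2k} : f=\sum_i f_i^2 \text{ for some (finitely many) } f_i\in P_{n,k}\}$, and $\widetilde{Sq}=\{f\in M_{n,2k} : f+r^{2k}\in Sq\}$. *)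

theory Defs
  imports "HOL-Analysis.Analysis" "HOL-Library.Function_Algebras"
begin

text \<open>
  The number n of variables is the cardinality of the finite index type \<open>'n\<close>.  Real forms are
  identified with the polynomial functions on \<open>real ^ 'n\<close> that they induce, which is harmless
  because the field is infinite.
\<close>

global_interpretation real_fun: vector_space "\<lambda>(a::real) (f::'a \<Rightarrow> real) x. a * f x"
  by unfold_locales (auto simp: fun_eq_iff algebra_simps)

definition exponents :: "nat \<Rightarrow> ('n::finite \<Rightarrow> nat) set" where
  "exponents m = {\<alpha>. (\<Sum>i\<in>UNIV. \<alpha> i) = m}"

lemma finite_exponents: "finite (exponents m :: ('n::finite \<Rightarrow> nat) set)"
proof (rule finite_subset)
  show "exponents m \<subseteq> (UNIV :: 'n set) \<rightarrow>\<^sub>E {..m}"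
    by (auto simp: exponents_def member_le_sum)
qed (auto intro: finite_PiE)

definition forms :: "nat \<Rightarrow> (real ^ 'n \<Rightarrow> real) set" where
  "forms m = {f. \<exists>c :: ('n \<Rightarrow> nat) \<Rightarrow> real.
     f = (\<lambda>x. \<Sum>\<alpha>\<in>exponents m. c \<alpha> * (\<Prod>i\<in>UNIV. (x $ i) ^ \<alpha> i))}"

text \<open>
  For n at least 2 there is exactly one such measure; \<open>rotation_matrix\<close> means orthogonal with
  determinant 1.
\<close>

definition rotation_invariant_prob :: "(real ^ 'n) measure \<Rightarrow> bool" where
  "rotation_invariant_prob \<sigma> \<longleftrightarrow>
     sets \<sigma> = sets (restrict_space borel (sphere 0 1)) \<and>
     emeasure \<sigma> (sphere 0 1) = 1 \<and>
     (\<forall>Q :: real ^ 'n ^ 'n. rotation_matrix Q \<longrightarrow> distr \<sigma> \<sigma> (\<lambda>x. Q *v x) = \<sigma>)"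

definition form_inner :: "(real ^ 'n) measure \<Rightarrow> (real ^ 'n \<Rightarrow> real) \<Rightarrow> (real ^ 'n \<Rightarrow> real) \<Rightarrow> real" where
  "form_inner \<sigma> f g = (\<integral>x. f x * g x \<partial>\<sigma>)"

definition M_forms :: "(real ^ 'n) measure \<Rightarrow> nat \<Rightarrow> (real ^ 'n \<Rightarrow> real) set" where
  "M_forms \<sigma> k = {f \<in> forms (2 * k). (\<integral>x. f x \<partial>\<sigma>) = 0}"

definition M_unit_ball :: "(real ^ 'n) measure \<Rightarrow> nat \<Rightarrow> (real ^ 'n \<Rightarrow> real) set" where
  "M_unit_ball \<sigma> k = {f \<in> M_forms \<sigma> k. form_inner \<sigma> f f \<le> 1}"

definition r_pow :: "nat \<Rightarrow> real ^ 'n \<Rightarrow> real" where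
  "r_pow k = (\<lambda>x. (\<Sum>i\<in>UNIV. (x $ i)\<^sup>2) ^ k)"

definition sos_cone :: "nat \<Rightarrow> (real ^ 'n \<Rightarrow> real) set" where
  "sos_cone k = {f \<in> forms (2 * k). \<exists>(m::nat) g. (\<forall>j<m. g j \<in> forms k) \<and>
     f = (\<lambda>x. \<Sum>j<m. (g j x)\<^sup>2)}"

definition sos_section :: "(real ^ 'n) measure \<Rightarrow> nat \<Rightarrow> (real ^ 'n \<Rightarrow> real) set" where
  "sos_section \<sigma> k = {f \<in> M_forms \<sigma> k. (\<lambda>x. f x + r_pow k x) \<in> sos_cone k}"

definition orthonormal_basis ::
    "(real ^ 'n) measure \<Rightarrow> (real ^ 'n \<Rightarrow> real) set \<Rightarrow> (real ^ 'n \<Rightarrow> real) set \<Rightarrow> bool" where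
  "orthonormal_basis \<sigma> V B \<longleftrightarrow>
     finite B \<and> real_fun.span B = V \<and>
     (\<forall>b\<in>B. \<forall>b'\<in>B. form_inner \<sigma> b b' = (if b = b' then 1 else 0))"

text \<open>
  Lebesgue measure on a finite-dimensional inner product space of functions, carried over from
  coordinate space by an orthonormal basis \<open>B\<close>; the coordinates are indexed by \<open>B\<close> itself.
  It does not depend on the choice of \<open>B\<close>.
\<close>

definition vol :: "(real ^ 'n \<Rightarrow> real) set \<Rightarrow> (real ^ 'n \<Rightarrow> real) set \<Rightarrow> real" where
  "vol B S = measure (completion (\<Pi>\<^sub>M b\<in>B. lborel))
     {c \<in> B \<rightarrow>\<^sub>E (UNIV :: real set). (\<lambda>x. \<Sum>b\<in>B. c b * b x) \<in> S}"

end

theory Submission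
  imports Defs
begin

text \<open>
  Normalise the coefficients of a form by multinomial coefficients and let \<open>bom\<close> be the Bombieri
  inner product, for which \<open>(x \<bullet> y) ^ m\<close> is a reproducing kernel.  Three facts link it to the sphere:
  \<open>bom\<close> and the \<open>L\<^sup>2\<close> product both make \<open>r_pow k\<close> orthogonal to \<open>M\<close>; the square of a form has Bombieri
  norm at most the square of its norm; and the Bombieri norm is at most an explicit constant \<open>\<Lambda>\<close> times the \<open>L\<^sup>2\<close> norm,
  by expanding in Hermite polynomials.  If \<open>f + r_pow k = (\<Sum>g\<^sub>j\<^sup>2)\<close>, the pairing of \<open>f\<close> with a
  combination of a Bombieri-orthonormal basis with random signs is bounded by \<open>\<Lambda>\<close> times the norm of
  a random quadratic form in \<open>N = dim P\<^bsub>n,k\<^esub>\<close> variables, which is of order \<open>sqrt N\<close> by a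
  net argument; averaging the exponential over signs turns this into an upper bound for the volume.
  Conversely, \<open>f + r_pow k\<close> is a sum of squares as soon as its catalecticant is positive
  semidefinite, which by the same net argument holds on at least half of a cube.  Passing between
  Bombieri and \<open>L\<^sup>2\<close> volume is Gram-Schmidt, controlled by AM-GM with \<open>\<Sum>(e x)\<^sup>2 \<le> 1\<close> from above
  and by \<open>\<Lambda>\<close> from below.
\<close>

section \<open>Forms and the Bombieri inner product\<close>

text \<open>Orders of magnitude decide the theorem. For fixed k, \<open>N\<close> and
  \<open>\<Lambda> k\<close> grow like n^k / k!, while \<open>card B\<close> and
  \<open>\<Lambda> (2 * k)\<close> grow like n^(2k) / (2k)!. The upper bound is a multiple of
  \<open>sqrt N * \<Lambda> k / card B\<close> and the lower one of
  \<open>sqrt (card B) / sqrt (N * \<Lambda> (2 * k))\<close>, so both are of order n^(-k/2). The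
  obstacle is that the Bombieri and L2 norms are not proportional on M: sign vectors and cubes live
  in Bombieri coordinates, the ball in L2 coordinates. Only the determinant of the change of
  coordinates matters. Its root of order \<open>card B\<close> lies between 1 / sqrt
  (\<open>\<Lambda> (2 * k)\<close>) and 1 / sqrt (\<open>card B\<close>), and comparing the factors
  n + 2 i of \<open>\<Lambda> (2 * k)\<close> with the factors n + i of the dimension produces the
  denominator (n/2 + 2k)^k. Averages run over sign vectors and cubes instead of rotations because
  they then factor into one-dimensional integrals. The numerical constants are far from sharp; they
  only have to fit under 16^k * sqrt 24 with k \<ge> 1.\<close>

lemma sum_fun_apply: "(\<Sum>i\<in>A. f i) x = (\<Sum>i\<in>A. f i x)" for f :: "'a \<Rightarrow> 'b \<Rightarrow> 'c::comm_monoid_add"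
  by (induction A rule: infinite_finite_induct) auto

section \<open>Exponent vectors and their number\<close>

lemma exponents_upd_Suc: "\<beta> \<in> exponents m \<Longrightarrow> \<beta>(i := Suc (\<beta> i)) \<in> exponents (Suc m)"
  by (simp add: exponents_def sum.remove[of UNIV i])

lemma exponents_upd_pred:
  "\<alpha> \<in> exponents (Suc m) \<Longrightarrow> \<alpha> i > 0 \<Longrightarrow> \<alpha>(i := \<alpha> i - 1) \<in> exponents m"
  by (simp add: exponents_def sum.remove[of UNIV i])

lemma exponents_add: "\<alpha> \<in> exponents j \<Longrightarrow> \<beta> \<in> exponents k \<Longrightarrow> \<alpha> + \<beta> \<in> exponents (j + k)"
  by (simp add: exponents_def sum.distrib)

lemma exponents_le: "\<alpha> \<in> exponents m \<Longrightarrow> \<alpha> i \<le> m"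
  by (auto simp: exponents_def intro: member_le_sum)

text \<open>Raising the i-th entry is a bijection from pairs (\<beta>, i) to pairs (\<alpha>, i)
  with \<alpha> i > 0. The dimension count and the multinomial theorem are this exchange with
  different weights.\<close>

lemma sum_exponents_Suc:
  fixes \<phi> :: "('n::finite \<Rightarrow> nat) \<Rightarrow> 'n \<Rightarrow> 'b::comm_monoid_add"
  shows "(\<Sum>\<beta>\<in>exponents m. \<Sum>i\<in>UNIV. \<phi> (\<beta>(i := Suc (\<beta> i))) i) =
         (\<Sum>\<alpha>\<in>exponents (Suc m). \<Sum>i\<in>{i. \<alpha> i > 0}. \<phi> \<alpha> i)"
proof -
  have "(\<Sum>(\<beta>, i)\<in>exponents m \<times> UNIV. \<phi> (\<beta>(i := Suc (\<beta> i))) i) =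
        (\<Sum>(\<alpha>, i)\<in>(SIGMA \<alpha>:exponents (Suc m). {i. \<alpha> i > 0}). \<phi> \<alpha> i)"
    by (rule sum.reindex_bij_witness[where j="\<lambda>(\<beta>, i). (\<beta>(i := Suc (\<beta> i)), i)"
          and i="\<lambda>(\<alpha>, i). (\<alpha>(i := \<alpha> i - 1), i)"])
       (auto simp: exponents_upd_Suc exponents_upd_pred[simplified])
  then show ?thesis
    by (simp add: sum.Sigma finite_exponents sum.cartesian_product)
qed

lemma exponents_0: "exponents 0 = {\<lambda>i. 0}"
  by (auto simp: exponents_def)

text \<open>Give each pair (\<alpha>, i) the weight \<alpha> i. Every \<alpha> of degree m + 1 then
  counts m + 1 times, and after the exchange every \<beta> of degree m counts n + m times.\<close>

lemma card_exponents:
  "real (card (exponents m :: ('n::finite \<Rightarrow> nat) set)) * fact m = (\<Prod>i<m. real (CARD('n) + i))"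
proof (induction m)
  case (Suc m)
  have "real (Suc m) * card (exponents (Suc m) :: ('n \<Rightarrow> nat) set) =
        (\<Sum>\<alpha>\<in>(exponents (Suc m) :: ('n \<Rightarrow> nat) set). \<Sum>i\<in>{i. \<alpha> i > 0}. real (\<alpha> i))"
  proof -
    have "(\<Sum>i\<in>{i. \<alpha> i > 0}. real (\<alpha> i)) = Suc m" if "\<alpha> \<in> exponents (Suc m)" for \<alpha> :: "'n \<Rightarrow> nat"
    proof -
      have "(\<Sum>i\<in>{i. \<alpha> i > 0}. \<alpha> i) = (\<Sum>i\<in>UNIV. \<alpha> i)"
        by (rule sum.mono_neutral_left) auto
      then show ?thesis
        using that by (simp add: exponents_def flip: of_nat_sum)
    qed
    then show ?thesis by simp
  qed
  also have "\<dots> = (\<Sum>\<beta>\<in>(exponents m :: ('n \<Rightarrow> nat) set). \<Sum>i\<in>UNIV. real ((\<beta>(i := Suc (\<beta> i))) i))"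
    by (rule sum_exponents_Suc[symmetric])
  also have "\<dots> = real (CARD('n) + m) * card (exponents m :: ('n \<Rightarrow> nat) set)"
  proof -
    have "(\<Sum>i\<in>UNIV. real ((\<beta>(i := Suc (\<beta> i))) i)) = CARD('n) + m" if "\<beta> \<in> exponents m" for \<beta> :: "'n \<Rightarrow> nat"
      using that by (simp add: exponents_def sum.distrib flip: of_nat_sum)
    then show ?thesis by simp
  qed
  finally have "real (Suc m) * card (exponents (Suc m) :: ('n \<Rightarrow> nat) set) =
     real (CARD('n) + m) * card (exponents m :: ('n \<Rightarrow> nat) set)" .
  then have "real (card (exponents (Suc m) :: ('n \<Rightarrow> nat) set)) * fact (Suc m) =
      real (CARD('n) + m) * (real (card (exponents m :: ('n \<Rightarrow> nat) set)) * fact m)"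
    by (simp only: fact_Suc ac_simps of_nat_mult)
  then show ?case
    unfolding Suc by simp
qed (simp add: exponents_0)

section \<open>Monomials and the multinomial theorem\<close>

definition xpow :: "real ^ 'n \<Rightarrow> ('n \<Rightarrow> nat) \<Rightarrow> real" where
  "xpow x \<alpha> = (\<Prod>i\<in>UNIV. (x $ i) ^ \<alpha> i)"

definition multinom :: "('n::finite \<Rightarrow> nat) \<Rightarrow> real" where
  "multinom \<alpha> = fact (\<Sum>i\<in>UNIV. \<alpha> i) / (\<Prod>i\<in>UNIV. fact (\<alpha> i))"

lemma multinom_pos: "multinom \<alpha> > 0"
  by (auto simp: multinom_def intro!: divide_pos_pos prod_pos)

lemma multinom_nonzero [simp]: "multinom \<alpha> \<noteq> 0"
  using multinom_pos[of \<alpha>] by simp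

lemma multinom_pred:
  assumes "\<alpha> \<in> exponents (Suc m)" "\<alpha> i > 0"
  shows "multinom (\<alpha>(i := \<alpha> i - 1)) = multinom \<alpha> * \<alpha> i / Suc m"
proof -
  have 1: "(\<Sum>j\<in>UNIV. (\<alpha>(i := \<alpha> i - 1)) j) = m" "(\<Sum>j\<in>UNIV. \<alpha> j) = Suc m"
    using assms exponents_upd_pred[OF assms] by (auto simp: exponents_def)
  have 2: "fact (\<alpha> i) = real (\<alpha> i) * fact (\<alpha> i - 1)"
    using assms(2) by (simp add: fact_reduce)
  have "(\<Prod>j\<in>UNIV. fact (\<alpha> j) :: real) = \<alpha> i * (\<Prod>j\<in>UNIV. fact ((\<alpha>(i := \<alpha> i - 1)) j))"
    by (simp add: prod.remove[of UNIV i] 2)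
  moreover have "(\<Prod>j\<in>UNIV. fact ((\<alpha>(i := \<alpha> i - 1)) j) :: real) > 0"
    by (rule prod_pos) auto
  ultimately show ?thesis
    unfolding multinom_def 1 using assms(2) by (simp add: divide_simps del: fun_upd_apply)
qed

text \<open>Multiplication by the sum of the z i sends \<beta> to its raised vectors. So \<alpha>
  collects the coefficients of its predecessors, which are the fractions \<alpha> i / (m + 1) of
  \<open>multinom \<alpha>\<close> and add up to it.\<close>

theorem multinomial:
  fixes z :: "'n::finite \<Rightarrow> real"
  shows "(\<Sum>i\<in>UNIV. z i) ^ m = (\<Sum>\<alpha>\<in>exponents m. multinom \<alpha> * (\<Prod>i\<in>UNIV. z i ^ \<alpha> i))"
proof (induction m)
  case (Suc m)
  let ?P = "\<lambda>\<alpha>. \<Prod>i\<in>UNIV. z i ^ \<alpha> i"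
  have P: "?P (\<beta>(i := Suc (\<beta> i))) = ?P \<beta> * z i" for \<beta> i
    by (simp add: prod.remove[of UNIV i])
  have "(\<Sum>i\<in>UNIV. z i) ^ Suc m = (\<Sum>\<beta>\<in>exponents m. \<Sum>i\<in>UNIV. multinom \<beta> * (?P \<beta> * z i))"
    by (simp add: Suc sum_distrib_left sum_distrib_right mult_ac sum.swap[of _ UNIV])
  also have "\<dots> = (\<Sum>\<beta>\<in>exponents m. \<Sum>i\<in>UNIV.
      (\<lambda>\<alpha> i. multinom (\<alpha>(i := \<alpha> i - 1)) * ?P \<alpha>) (\<beta>(i := Suc (\<beta> i))) i)"
    by (simp only: P) simp
  also have "\<dots> = (\<Sum>\<alpha>\<in>exponents (Suc m). \<Sum>i\<in>{i. \<alpha> i > 0}. multinom (\<alpha>(i := \<alpha> i - 1)) * ?P \<alpha>)"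
    by (subst sum_exponents_Suc) simp
  also have "\<dots> = (\<Sum>\<alpha>\<in>exponents (Suc m). multinom \<alpha> * ?P \<alpha>)"
  proof (rule sum.cong[OF refl])
    fix \<alpha> :: "'n \<Rightarrow> nat" assume \<alpha>: "\<alpha> \<in> exponents (Suc m)"
    have "(\<Sum>i\<in>{i. \<alpha> i > 0}. \<alpha> i) = (\<Sum>i\<in>UNIV. \<alpha> i)"
      by (rule sum.mono_neutral_left) auto
    then have s: "(\<Sum>i\<in>{i. \<alpha> i > 0}. real (\<alpha> i)) = Suc m"
      using \<alpha> by (simp add: exponents_def flip: of_nat_sum)
    have "(\<Sum>i\<in>{i. \<alpha> i > 0}. multinom (\<alpha>(i := \<alpha> i - 1)) * ?P \<alpha>) =
          (\<Sum>i\<in>{i. \<alpha> i > 0}. (multinom \<alpha> * ?P \<alpha> / Suc m) * \<alpha> i)"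
      by (rule sum.cong[OF refl]) (simp add: multinom_pred[OF \<alpha>, simplified])
    also have "\<dots> = multinom \<alpha> * ?P \<alpha>"
      unfolding sum_distrib_left[symmetric] s by simp
    finally show "(\<Sum>i\<in>{i. \<alpha> i > 0}. multinom (\<alpha>(i := \<alpha> i - 1)) * ?P \<alpha>) = multinom \<alpha> * ?P \<alpha>" .
  qed
  finally show ?case .
qed (simp add: exponents_0 multinom_def)

lemma inner_power: "(x \<bullet> y) ^ m = (\<Sum>\<alpha>\<in>exponents m. multinom \<alpha> * xpow x \<alpha> * xpow y \<alpha>)"
  by (simp add: inner_vec_def multinomial xpow_def power_mult_distrib prod.distrib mult_ac)

lemma digits_less:
  fixes B :: nat assumes "\<And>i. i < n \<Longrightarrow> a i < B"
  shows "(\<Sum>i<n. a i * B ^ i) < B ^ n"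
  using assms
proof (induction n)
  case (Suc n)
  have "(\<Sum>i<n. a i * B ^ i) < B ^ n" "a n + 1 \<le> B"
    using Suc.IH Suc.prems[of n] Suc.prems by (auto simp: Suc_le_eq)
  then have "(\<Sum>i<n. a i * B ^ i) + a n * B ^ n < (a n + 1) * B ^ n" "(a n + 1) * B ^ n \<le> B * B ^ n"
    using mult_le_mono1[of "a n + 1" B "B ^ n"] by auto
  then show ?case by simp
qed auto

lemma digits_inj:
  fixes B :: nat
  assumes "\<And>i. i < n \<Longrightarrow> a i < B" "\<And>i. i < n \<Longrightarrow> b i < B"
    and "(\<Sum>i<n. a i * B ^ i) = (\<Sum>i<n. b i * B ^ i)" "i < n"
  shows "a i = b i"
  using assms
proof (induction n)
  case (Suc n)
  have l: "(\<Sum>i<n. a i * B ^ i) < B ^ n" "(\<Sum>i<n. b i * B ^ i) < B ^ n"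
    using Suc.prems by (auto intro!: digits_less)
  then have "(a n * B ^ n + (\<Sum>i<n. a i * B ^ i)) div B ^ n = a n"
    "(b n * B ^ n + (\<Sum>i<n. b i * B ^ i)) div B ^ n = b n"
    by (cases "B ^ n = 0"; simp add: div_add1_eq)+
  then have n: "a n = b n"
    using Suc.prems(3) by (simp add: add.commute)
  then have "(\<Sum>i<n. a i * B ^ i) = (\<Sum>i<n. b i * B ^ i)"
    using Suc.prems(3) by simp
  then show ?case
    using Suc n less_Suc_eq by auto
qed auto

text \<open>Kronecker substitution: the monomials of bounded degree become distinct powers of one variable.\<close>
lemma monomials_independent:
  fixes a :: "('n::finite \<Rightarrow> nat) \<Rightarrow> real"
  assumes "\<And>x. (\<Sum>\<alpha>\<in>exponents m. a \<alpha> * xpow x \<alpha>) = 0" "\<alpha> \<in> exponents m"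
  shows "a \<alpha> = 0"
proof -
  obtain e :: "'n \<Rightarrow> nat" where e: "bij_betw e UNIV {..<CARD('n)}"
    using ex_bij_betw_finite_nat[of "UNIV :: 'n set"] by (auto simp: lessThan_atLeast0)
  \<comment> \<open>The exponent of t when t ^ (\<open>Suc m ^ e i\<close>) is substituted for the
    i-th variable. Entries of \<alpha> are at most m, hence digits in base m + 1, so
    \<open>w\<close> separates exponent vectors.\<close>
  define w where "w = (\<lambda>\<alpha>::'n \<Rightarrow> nat. \<Sum>i\<in>UNIV. \<alpha> i * Suc m ^ e i)"
  have inj: "\<alpha> = \<beta>" if "\<alpha> \<in> exponents m" "\<beta> \<in> exponents m" "w \<alpha> = w \<beta>" for \<alpha> \<beta>
  proof -
    define e' where "e' = the_inv_into UNIV e"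
    have e': "e' (e i) = i" for i
      unfolding e'_def using e by (auto simp: bij_betw_def intro!: the_inv_into_f_f)
    have w: "w \<gamma> = (\<Sum>j<CARD('n). \<gamma> (e' j) * Suc m ^ j)" for \<gamma>
      unfolding w_def using sum.reindex_bij_betw[OF e, of "\<lambda>j. \<gamma> (e' j) * Suc m ^ j"] by (simp add: e')
    have "\<alpha> (e' j) = \<beta> (e' j)" if "j < CARD('n)" for j
      using digits_inj[of "CARD('n)" "\<lambda>j. \<alpha> (e' j)" "Suc m" "\<lambda>j. \<beta> (e' j)" j] that \<open>w \<alpha> = w \<beta>\<close>
        exponents_le \<open>\<alpha> \<in> exponents m\<close> \<open>\<beta> \<in> exponents m\<close>
      by (metis (no_types, lifting) le_imp_less_Suc w sum.cong)
    then have "\<alpha> i = \<beta> i" for i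
      using e' e by (metis UNIV_I bij_betwE lessThan_iff)
    then show ?thesis by auto
  qed
  define p where "p = (\<Sum>\<alpha>\<in>exponents m. Polynomial.monom (a \<alpha>) (w \<alpha>))"
  have "poly p t = 0" for t
  proof -
    have "xpow (\<chi> i. t ^ (Suc m ^ e i)) \<alpha> = t ^ w \<alpha>" for \<alpha>
      by (simp add: xpow_def w_def power_sum mult.commute flip: power_mult)
    then show ?thesis
      using assms(1)[of "\<chi> i. t ^ (Suc m ^ e i)"] by (simp add: p_def poly_sum poly_monom)
  qed
  then have "p = 0"
    using poly_all_0_iff_0 by blast
  then have "0 = Polynomial.coeff p (w \<alpha>)"
    by simp
  also have "\<dots> = (\<Sum>\<beta>\<in>exponents m. if \<beta> = \<alpha> then a \<beta> else 0)"
    unfolding p_def coeff_sum by (rule sum.cong) (auto simp: dest: inj[OF assms(2)] inj[OF _ assms(2)])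
  also have "\<dots> = a \<alpha>"
    using assms(2) by (simp add: finite_exponents)
  finally show ?thesis by simp
qed

section \<open>Forms through normalised coefficients\<close>

definition form_of :: "nat \<Rightarrow> (('n \<Rightarrow> nat) \<Rightarrow> real) \<Rightarrow> real ^ 'n \<Rightarrow> real" where
  "form_of m a = (\<lambda>x. \<Sum>\<alpha>\<in>exponents m. multinom \<alpha> * a \<alpha> * xpow x \<alpha>)"

lemma form_of_in_forms: "form_of m a \<in> forms m"
  by (auto simp: forms_def form_of_def xpow_def)

lemma forms_eq: "forms m = range (form_of m)"
proof -
  have "f \<in> range (form_of m)" if "f \<in> forms m" for f :: "real ^ 'n \<Rightarrow> real"
  proof -
    from that obtain c where "f = (\<lambda>x. \<Sum>\<alpha>\<in>exponents m. c \<alpha> * (\<Prod>i\<in>UNIV. (x $ i) ^ \<alpha> i))"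
      by (auto simp: forms_def)
    moreover have "multinom \<alpha> * (c \<alpha> / multinom \<alpha>) = c \<alpha>" for \<alpha>
      using multinom_pos[of \<alpha>] by simp
    ultimately have "f = form_of m (\<lambda>\<alpha>. c \<alpha> / multinom \<alpha>)"
      unfolding form_of_def xpow_def by presburger
    then show ?thesis by blast
  qed
  then show ?thesis using form_of_in_forms by blast
qed

lemma form_of_inject:
  assumes "form_of m a = form_of m b" "\<alpha> \<in> exponents m"
  shows "a \<alpha> = b \<alpha>"
proof -
  have "(\<Sum>\<alpha>\<in>exponents m. (multinom \<alpha> * a \<alpha> - multinom \<alpha> * b \<alpha>) * xpow x \<alpha>) = 0" for x
    using fun_cong[OF assms(1), of x] by (simp add: form_of_def algebra_simps sum_subtractf)
  from monomials_independent[OF this assms(2)] show ?thesis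
    using multinom_pos[of \<alpha>] by simp
qed

text \<open>Coefficients are normalised by the multinomial coefficients: the power \<open>(x \<bullet> y) ^ m\<close> of a
  linear form has the coefficients \<open>xpow y \<alpha>\<close>.\<close>
definition ncoef :: "nat \<Rightarrow> (real ^ 'n \<Rightarrow> real) \<Rightarrow> ('n \<Rightarrow> nat) \<Rightarrow> real" where
  "ncoef m f = (SOME a. f = form_of m a)"

lemma form_of_ncoef: "f \<in> forms m \<Longrightarrow> form_of m (ncoef m f) = f"
  unfolding ncoef_def forms_eq by (metis (mono_tags, lifting) rangeE someI)

lemma ncoef_form_of: "\<alpha> \<in> exponents m \<Longrightarrow> ncoef m (form_of m a) \<alpha> = a \<alpha>"
  by (rule form_of_inject[OF form_of_ncoef[OF form_of_in_forms]])

lemma form_eval: "f \<in> forms m \<Longrightarrow> f x = (\<Sum>\<alpha>\<in>exponents m. multinom \<alpha> * ncoef m f \<alpha> * xpow x \<alpha>)"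
  by (metis form_of_ncoef form_of_def)

lemma form_of_add: "form_of m a + form_of m b = form_of m (a + b)"
  by (auto simp: form_of_def sum.distrib algebra_simps)

lemma form_of_scale: "(\<lambda>x. c * form_of m a x) = form_of m (\<lambda>\<alpha>. c * a \<alpha>)"
  by (auto simp: form_of_def sum_distrib_left algebra_simps)

lemma subspace_forms: "real_fun.subspace (forms m)"
proof -
  have "(0 :: real ^ 'n \<Rightarrow> real) = form_of m 0"
    by (auto simp: form_of_def)
  then show ?thesis
    unfolding real_fun.subspace_def forms_eq
    by (auto simp: form_of_add form_of_scale)
qed

lemma ncoef_add:
  assumes "f \<in> forms m" "g \<in> forms m" "\<alpha> \<in> exponents m"
  shows "ncoef m (\<lambda>x. f x + g x) \<alpha> = ncoef m f \<alpha> + ncoef m g \<alpha>"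
  using ncoef_form_of[OF assms(3), of "ncoef m f + ncoef m g"] form_of_add[of m "ncoef m f" "ncoef m g"]
  by (simp add: form_of_ncoef assms plus_fun_def)

lemma ncoef_scale:
  assumes "f \<in> forms m" "\<alpha> \<in> exponents m"
  shows "ncoef m (\<lambda>x. c * f x) \<alpha> = c * ncoef m f \<alpha>"
  using ncoef_form_of[OF assms(2), of "\<lambda>\<alpha>. c * ncoef m f \<alpha>"] form_of_scale[of c m "ncoef m f"]
  by (simp add: form_of_ncoef assms)

text \<open>The Bombieri inner product: its reproducing kernel is \<open>(x \<bullet> y) ^ m\<close>.\<close>
definition bom :: "nat \<Rightarrow> (real ^ 'n \<Rightarrow> real) \<Rightarrow> (real ^ 'n \<Rightarrow> real) \<Rightarrow> real" where
  "bom m f g = (\<Sum>\<alpha>\<in>exponents m. multinom \<alpha> * ncoef m f \<alpha> * ncoef m g \<alpha>)"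

lemma bom_commute: "bom m f g = bom m g f"
  by (simp add: bom_def mult_ac)

lemma bom_add_left:
  "f \<in> forms m \<Longrightarrow> g \<in> forms m \<Longrightarrow> bom m (\<lambda>x. f x + g x) h = bom m f h + bom m g h"
  by (simp add: bom_def ncoef_add algebra_simps sum.distrib)

lemma bom_scale_left: "f \<in> forms m \<Longrightarrow> bom m (\<lambda>x. c * f x) h = c * bom m f h"
  by (simp add: bom_def ncoef_scale algebra_simps sum_distrib_left)

lemma bom_nonneg: "bom m f f \<ge> 0"
  unfolding bom_def by (intro sum_nonneg) (simp add: mult.assoc multinom_pos less_imp_le)

lemma bom_eq_0D:
  assumes "f \<in> forms m" "bom m f f = 0" shows "f = (\<lambda>x. 0)"
proof -
  have "multinom \<alpha> * ncoef m f \<alpha> * ncoef m f \<alpha> = 0" if "\<alpha> \<in> exponents m" for \<alpha>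
    using assms(2) that unfolding bom_def
    by (subst (asm) sum_nonneg_eq_0_iff)
       (auto simp: finite_exponents mult.assoc multinom_pos less_imp_le)
  then have "ncoef m f \<alpha> = 0" if "\<alpha> \<in> exponents m" for \<alpha>
    using that multinom_pos[of \<alpha>] by force
  then show ?thesis
    using form_eval[OF assms(1)] by (simp add: fun_eq_iff)
qed

lemma power_form: "(\<lambda>x. (x \<bullet> y) ^ m) = form_of m (xpow y)"
  by (auto simp: form_of_def inner_power mult_ac)

lemma bom_reproducing: "f \<in> forms m \<Longrightarrow> bom m f (\<lambda>x. (x \<bullet> y) ^ m) = f y"
  by (simp add: bom_def power_form ncoef_form_of form_eval mult_ac)

lemma xpow_add: "xpow x (\<alpha> + \<beta>) = xpow x \<alpha> * xpow x \<beta>"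
  by (simp add: xpow_def power_add prod.distrib)

text \<open>The third argument of \<phi> lets a summand depend on \<alpha> + \<beta> in a way that
  becomes a constant \<gamma> in the regrouped inner sum.\<close>

lemma sum_exponents_add:
  "(\<Sum>\<alpha>\<in>exponents j. \<Sum>\<beta>\<in>exponents k. \<phi> \<alpha> \<beta> (\<alpha> + \<beta>)) =
   (\<Sum>\<gamma>\<in>exponents (j + k). \<Sum>(\<alpha>, \<beta>) | (\<alpha>, \<beta>) \<in> exponents j \<times> exponents k \<and> \<alpha> + \<beta> = \<gamma>. \<phi> \<alpha> \<beta> \<gamma>)"
  for \<phi> :: "('n::finite \<Rightarrow> nat) \<Rightarrow> ('n \<Rightarrow> nat) \<Rightarrow> ('n \<Rightarrow> nat) \<Rightarrow> real"
proof -
  let ?g = "\<lambda>(\<alpha>, \<beta>). \<alpha> + \<beta> :: 'n \<Rightarrow> nat" and ?S = "exponents j \<times> exponents k :: (('n \<Rightarrow> nat) \<times> ('n \<Rightarrow> nat)) set"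
  have "(\<Sum>\<alpha>\<in>exponents j. \<Sum>\<beta>\<in>exponents k. \<phi> \<alpha> \<beta> (\<alpha> + \<beta>)) = (\<Sum>(\<alpha>, \<beta>)\<in>?S. \<phi> \<alpha> \<beta> (\<alpha> + \<beta>))"
    by (simp add: sum.cartesian_product)
  also have "\<dots> = (\<Sum>\<gamma>\<in>exponents (j + k). \<Sum>p\<in>{p. p \<in> ?S \<and> ?g p = \<gamma>}. case p of (\<alpha>, \<beta>) \<Rightarrow> \<phi> \<alpha> \<beta> (\<alpha> + \<beta>))"
    by (rule sum.group[symmetric]) (auto simp: finite_exponents exponents_add)
  also have "\<dots> = (\<Sum>\<gamma>\<in>exponents (j + k). \<Sum>(\<alpha>, \<beta>) | (\<alpha>, \<beta>) \<in> ?S \<and> \<alpha> + \<beta> = \<gamma>. \<phi> \<alpha> \<beta> \<gamma>)"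
    by (auto intro!: sum.cong)
  finally show ?thesis .
qed

section \<open>Integration of forms over the sphere\<close>

text \<open>\<open>herm i r\<close> is the coefficient of the Hermite polynomial \<open>He\<^sub>r\<close> in \<open>x ^ i\<close>, and \<open>herm i 0\<close> the
  \<open>i\<close>-th moment of the standard Gaussian.\<close>
fun herm :: "nat \<Rightarrow> nat \<Rightarrow> real" where
  "herm 0 r = (if r = 0 then 1 else 0)"
| "herm (Suc i) 0 = herm i 1"
| "herm (Suc i) (Suc r) = herm i r + real (r + 2) * herm i (r + 2)"

lemma herm_above: "r > i \<Longrightarrow> herm i r = 0"
  by (induction i r rule: herm.induct) auto

lemma herm_diag: "herm i i = 1"
  by (induction i) (auto simp: herm_above)

text \<open>This is multiplication by x, which moves Hermite degrees up and down by one. The point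
  is that the right-hand side is symmetric in i and j, so the factor x can be moved from one power
  to the other.\<close>

lemma herm_orthogonality_step:
  assumes "i \<le> R" "j \<le> R"
  shows "(\<Sum>r\<le>R. fact r * herm (Suc i) r * herm j r) =
         (\<Sum>r<R. fact (Suc r) * (herm i r * herm j (Suc r) + herm i (Suc r) * herm j r))"
proof -
  have "(\<Sum>r\<le>R. fact r * herm (Suc i) r * herm j r) =
      herm i 1 * herm j 0 + (\<Sum>r<R. fact (Suc r) * herm (Suc i) (Suc r) * herm j (Suc r))"
    by (subst sum.atMost_shift) simp
  also have "\<dots> = (\<Sum>r<R. fact (Suc r) * herm i r * herm j (Suc r)) +
      (herm i 1 * herm j 0 + (\<Sum>r<R. fact (Suc (Suc r)) * herm i (Suc (Suc r)) * herm j (Suc r)))"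
    by (simp add: algebra_simps sum.distrib)
  also have "herm i 1 * herm j 0 + (\<Sum>r<R. fact (Suc (Suc r)) * herm i (Suc (Suc r)) * herm j (Suc r)) =
      (\<Sum>r\<le>R. fact (Suc r) * herm i (Suc r) * herm j r)"
    by (subst sum.atMost_shift) simp
  also have "\<dots> = (\<Sum>r<R. fact (Suc r) * herm i (Suc r) * herm j r)"
    using assms by (simp add: herm_above flip: lessThan_Suc_atMost)
  finally show ?thesis
    by (simp only: distrib_left sum.distrib mult.assoc)
qed

text \<open>Since E (He_r He_s) is r! for r = s and 0 otherwise, the left side is the Gaussian
  expectation of x^i x^j. The proof stays with coefficients: it shifts factors x from i to j until i
  = 0. The bound R is large enough that truncation loses nothing.\<close>

lemma herm_orthogonality:
  "i + j \<le> R \<Longrightarrow> (\<Sum>r\<le>R. fact r * herm i r * herm j r) = herm (i + j) 0"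
proof (induction i arbitrary: j)
  case 0
  have "(\<Sum>r\<le>R. fact r * herm 0 r * herm j r) = (\<Sum>r\<in>{0}. fact r * herm 0 r * herm j r)"
    by (rule sum.mono_neutral_right) auto
  then show ?case by simp
next
  case (Suc i)
  have "(\<Sum>r\<le>R. fact r * herm (Suc i) r * herm j r) =
      (\<Sum>r<R. fact (Suc r) * (herm i r * herm j (Suc r) + herm i (Suc r) * herm j r))"
    using Suc.prems by (intro herm_orthogonality_step) auto
  also have "\<dots> = (\<Sum>r<R. fact (Suc r) * (herm j r * herm i (Suc r) + herm j (Suc r) * herm i r))"
    by (simp only: add.commute mult.commute)
  also have "\<dots> = (\<Sum>r\<le>R. fact r * herm (Suc j) r * herm i r)"
    using Suc.prems by (intro herm_orthogonality_step[symmetric]) auto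
  also have "\<dots> = (\<Sum>r\<le>R. fact r * herm i r * herm (Suc j) r)"
    by (simp only: mult_ac)
  finally show ?case
    using Suc by (simp del: herm.simps)
qed

text \<open>Differentiate the Hermite expansion of x^(i+1), using He_(r+1)' = (r + 1) He_r, and
  compare coefficients. The case r = 0 yields the moment recursion.\<close>

lemma herm_derivative: "real (Suc r) * herm (Suc i) (Suc r) = real (Suc i) * herm i r"
proof (induction i arbitrary: r)
  case (Suc i)
  have a: "real (r + 2) * herm (Suc i) (r + 2) = real (Suc i) * herm i (Suc r)"
    using Suc.IH[of "Suc r"] by (simp del: herm.simps)
  have "real (Suc r) * herm (Suc (Suc i)) (Suc r) =
      real (Suc r) * herm (Suc i) r + real (Suc r) * (real (r + 2) * herm (Suc i) (r + 2))"
    by (simp only: herm.simps distrib_left)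
  also have "\<dots> = real (Suc r) * herm (Suc i) r + real (Suc r) * (real (Suc i) * herm i (Suc r))"
    by (simp only: a)
  also have "\<dots> = real (Suc (Suc i)) * herm (Suc i) r"
  proof (cases r)
    case (Suc s)
    have "real (Suc r) * herm (Suc i) r = herm (Suc i) r + real (Suc i) * herm i s"
      using Suc.IH[of s] Suc by (simp del: herm.simps add: algebra_simps)
    moreover have "herm (Suc i) r = herm i s + real (Suc r) * herm i (Suc r)"
      using Suc by simp
    ultimately show ?thesis
      by (simp del: herm.simps add: algebra_simps)
  qed (simp add: algebra_simps)
  finally show ?case .
qed auto

lemma herm_moment_rec: "herm (Suc (Suc i)) 0 = real (Suc i) * herm i 0"
  using herm_derivative[of 0 i] by simp

lemma herm_moment_even: "herm (2 * b) 0 = fact (2 * b) / (2 ^ b * fact b)"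
proof (induction b)
  case (Suc b)
  have "herm (2 * Suc b) 0 = real (2 * b + 1) * herm (2 * b) 0"
    using herm_moment_rec[of "2 * b"] by (simp del: herm.simps)
  moreover have "(fact (2 * Suc b) :: real) = 2 * real (Suc b) * real (2 * b + 1) * fact (2 * b)"
    by (simp add: algebra_simps)
  ultimately show ?case
    by (simp add: Suc del: herm.simps of_nat_Suc)
qed simp

lemma herm_moment_odd: "odd i \<Longrightarrow> herm i 0 = 0"
proof (induction i rule: less_induct)
  case (less i)
  show ?case
  proof (cases "i = 1")
    case False
    then obtain j where "i = Suc (Suc j)"
      using less.prems by (metis One_nat_def even_zero not0_implies_Suc)
    then show ?thesis
      using less by (simp add: herm_moment_rec del: herm.simps)
  qed simp
qed

lemma continuous_xpow [continuous_intros]: "continuous_on A (\<lambda>x. xpow x \<alpha>)"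
  unfolding xpow_def by (intro continuous_intros)

lemma continuous_form: "f \<in> forms m \<Longrightarrow> continuous_on A f"
  unfolding forms_eq form_of_def by (auto intro!: continuous_intros)

lemma r_pow_eq: "r_pow k x = (x \<bullet> x) ^ k"
  by (simp add: r_pow_def inner_vec_def power2_eq_square)

text \<open>The product is E |G|^(2m) for a standard Gaussian G in dimension n, so
  \<open>kap n m\<close> converts Gaussian moments of degree 2m into spherical ones.\<close>

definition kap :: "nat \<Rightarrow> nat \<Rightarrow> real" where
  "kap n m = 1 / (\<Prod>i<m. real (n + 2 * i))"

text \<open>The 2m-th moment of one coordinate on the sphere: (2m - 1)!! times
  \<open>kap\<close>.\<close>

definition ckap :: "nat \<Rightarrow> nat \<Rightarrow> real" where
  "ckap n m = fact (2 * m) / (2 ^ m * fact m) * kap n m"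

section \<open>Moments of the rotation invariant measure\<close>

locale sphere_prob =
  fixes \<sigma> :: "(real ^ 'n) measure"
  assumes rot: "rotation_invariant_prob \<sigma>" and n2: "CARD('n) \<ge> 2"
begin

lemma kap_pos: "kap CARD('n) m > 0"
  using n2 by (auto simp: kap_def intro!: prod_pos)

lemma ckap_pos: "ckap CARD('n) m > 0"
  using kap_pos by (auto simp: ckap_def)

lemma sets_\<sigma>: "sets \<sigma> = sets (restrict_space borel (sphere 0 1))"
  using rot by (simp add: rotation_invariant_prob_def)

lemma space_\<sigma>: "space \<sigma> = sphere 0 1"
  using sets_eq_imp_space_eq[OF sets_\<sigma>] by (simp add: space_restrict_space)

lemma emeasure_\<sigma>: "emeasure \<sigma> (space \<sigma>) = 1"
  using rot by (simp add: rotation_invariant_prob_def space_\<sigma>)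

lemma finite_\<sigma>: "finite_measure \<sigma>"
  by (rule finite_measureI) (simp add: emeasure_\<sigma>)

lemma measure_\<sigma>: "measure \<sigma> (space \<sigma>) = 1"
  by (simp add: measure_def emeasure_\<sigma>)

lemma measurable_\<sigma>: "continuous_on UNIV f \<Longrightarrow> f \<in> borel_measurable \<sigma>"
  for f :: "real ^ 'n \<Rightarrow> 'b::topological_space"
  by (simp add: measurable_cong_sets[OF sets_\<sigma> refl] borel_measurable_continuous_onI measurable_restrict_space1)

lemma integrable_\<sigma>:
  fixes f :: "real ^ 'n \<Rightarrow> real"
  assumes "continuous_on UNIV f" shows "integrable \<sigma> f"
proof -
  have "compact (f ` sphere 0 1)"
    using assms by (intro compact_continuous_image continuous_on_subset[OF assms]) auto
  then obtain C where "\<And>x. x \<in> sphere 0 1 \<Longrightarrow> norm (f x) \<le> C"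
    by (meson bounded_iff compact_imp_bounded image_eqI)
  then show ?thesis
    by (intro finite_measure.integrable_const_bound[OF finite_\<sigma>, of _ C] AE_I2 measurable_\<sigma> assms)
       (simp_all add: space_\<sigma>)
qed

lemma integral_rotation:
  fixes f :: "real ^ 'n \<Rightarrow> real"
  assumes Q: "rotation_matrix Q" and f: "continuous_on UNIV f"
  shows "(\<integral>x. f (Q *v x) \<partial>\<sigma>) = (\<integral>x. f x \<partial>\<sigma>)"
proof -
  have iso: "orthogonal_transformation ((*v) Q)"
    using Q by (simp add: rotation_matrix_def orthogonal_transformation_matrix)
  have c: "continuous_on UNIV ((*v) Q)"
    by (simp add: linear_continuous_on matrix_vector_mul_bounded_linear)
  have "(\<lambda>x. Q *v x) \<in> measurable \<sigma> (restrict_space borel (sphere 0 1))"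
    by (rule measurable_restrict_space2)
       (use iso in \<open>auto simp: space_\<sigma> orthogonal_transformation intro!: measurable_\<sigma>[OF c]\<close>)
  then have meas: "(\<lambda>x. Q *v x) \<in> measurable \<sigma> \<sigma>"
    by (simp add: measurable_cong_sets[OF refl sets_\<sigma>])
  have "(\<integral>x. f x \<partial>\<sigma>) = (\<integral>x. f x \<partial>distr \<sigma> \<sigma> (\<lambda>x. Q *v x))"
    using rot Q by (simp add: rotation_invariant_prob_def)
  also have "\<dots> = (\<integral>x. f (Q *v x) \<partial>\<sigma>)"
    by (rule integral_distr[OF meas measurable_\<sigma>[OF f]])
  finally show ?thesis by simp
qed

text \<open>A rotation carries the axis to y / |y|, and homogeneity supplies the power of |y|.
  Dimension at least 2 is what makes a rotation of determinant 1 available.\<close>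

lemma integral_inner_power:
  "(\<integral>x. (x \<bullet> y) ^ (2 * m) \<partial>\<sigma>) = (\<integral>x. (x \<bullet> axis i 1) ^ (2 * m) \<partial>\<sigma>) * (y \<bullet> y) ^ m"
proof (cases "y = 0")
  case False
  define a where "a = y /\<^sub>R norm y"
  have "norm a = 1" using False by (simp add: a_def)
  then obtain Q where Q: "rotation_matrix Q" "Q *v axis i 1 = a"
    using rotation_matrix_exists_basis[OF n2] by metis
  have iso: "orthogonal_transformation ((*v) Q)"
    using Q by (simp add: rotation_matrix_def orthogonal_transformation_matrix)
  have "(\<integral>x. (x \<bullet> a) ^ (2 * m) \<partial>\<sigma>) = (\<integral>x. ((Q *v x) \<bullet> (Q *v axis i 1)) ^ (2 * m) \<partial>\<sigma>)"
    unfolding Q(2) by (rule integral_rotation[OF Q(1), symmetric]) (intro continuous_intros)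
  also have "\<dots> = (\<integral>x. (x \<bullet> axis i 1) ^ (2 * m) \<partial>\<sigma>)"
    using iso by (simp add: orthogonal_transformation_def)
  finally have a: "(\<integral>x. (x \<bullet> a) ^ (2 * m) \<partial>\<sigma>) = (\<integral>x. (x \<bullet> axis i 1) ^ (2 * m) \<partial>\<sigma>)" .
  have "(x \<bullet> y) ^ (2 * m) = (x \<bullet> a) ^ (2 * m) * (y \<bullet> y) ^ m" for x
  proof -
    have "x \<bullet> y = norm y * (x \<bullet> a)"
      using False by (simp add: a_def)
    then show ?thesis
      by (simp add: power_mult_distrib power_mult flip: power2_norm_eq_inner)
  qed
  then show ?thesis
    by (simp add: a)
qed (cases m; simp add: measure_\<sigma>)

text \<open>The coefficients of |y|^(2m) are proportional to Gaussian moments because E (G \<bullet>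
  y)^(2m) = (2m - 1)!! |y|^(2m). Here this is read off from the multinomial theorem in the squares:
  only exponents \<open>D \<beta>\<close> with all entries even occur, and the moments vanish at all
  others.\<close>

lemma r_pow_coefs:
  "(r_pow m :: real ^ 'n \<Rightarrow> real) = form_of (2 * m) (\<lambda>\<gamma>. fact m * 2 ^ m / fact (2 * m) * (\<Prod>i\<in>UNIV. herm (\<gamma> i) 0))"
  for m :: nat
proof
  fix y :: "real ^ 'n"
  define C where "C = (fact m * 2 ^ m / fact (2 * m) :: real)"
  let ?h = "\<lambda>\<gamma>::'n \<Rightarrow> nat. \<Prod>i\<in>UNIV. herm (\<gamma> i) 0"
  define D :: "('n \<Rightarrow> nat) \<Rightarrow> 'n \<Rightarrow> nat" where "D = (\<lambda>\<beta> i. 2 * \<beta> i)"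
  have inj: "inj_on D A" for A
    by (auto simp: inj_on_def D_def fun_eq_iff)
  have sub: "D ` exponents m \<subseteq> exponents (2 * m)"
    by (auto simp: D_def exponents_def simp flip: sum_distrib_left)
  have zero: "?h \<gamma> = 0" if "\<gamma> \<in> exponents (2 * m) - D ` exponents m" for \<gamma>
  proof (rule ccontr)
    assume "?h \<gamma> \<noteq> 0"
    then have "even (\<gamma> i)" for i
      using herm_moment_odd by (auto simp: prod_zero_iff)
    then have D: "\<gamma> = D (\<lambda>i. \<gamma> i div 2)"
      by (auto simp: D_def)
    then have "2 * (\<Sum>i\<in>UNIV. \<gamma> i div 2) = 2 * m"
      using that unfolding sum_distrib_left by (simp add: exponents_def D_def fun_eq_iff)
    then show False using D that by (auto simp: exponents_def)
  qed
  have coef: "multinom (D \<beta>) * (C * ?h (D \<beta>)) = multinom \<beta>" if "\<beta> \<in> exponents m" for \<beta>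
  proof -
    have s: "(\<Sum>i\<in>UNIV. D \<beta> i) = 2 * m" "(\<Sum>i\<in>UNIV. \<beta> i) = m"
      using that sub by (auto simp: exponents_def)
    have "?h (D \<beta>) = (\<Prod>i\<in>UNIV. fact (D \<beta> i)) / (2 ^ m * (\<Prod>i\<in>UNIV. fact (\<beta> i)))"
      by (simp add: D_def herm_moment_even prod_dividef prod.distrib s flip: power_sum)
    then show ?thesis
      by (simp add: multinom_def s C_def)
  qed
  have "r_pow m y = (\<Sum>\<beta>\<in>exponents m. multinom \<beta> * xpow y (D \<beta>))"
    by (simp add: r_pow_def multinomial D_def xpow_def flip: power_mult)
  also have "\<dots> = (\<Sum>\<beta>\<in>exponents m. multinom (D \<beta>) * (C * ?h (D \<beta>)) * xpow y (D \<beta>))"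
    by (simp only: coef cong: sum.cong)
  also have "\<dots> = (\<Sum>\<gamma>\<in>D ` exponents m. multinom \<gamma> * (C * ?h \<gamma>) * xpow y \<gamma>)"
    by (simp add: sum.reindex[OF inj])
  also have "\<dots> = form_of (2 * m) (\<lambda>\<gamma>. C * ?h \<gamma>) y"
    unfolding form_of_def by (rule sum.mono_neutral_left) (use sub zero finite_exponents in auto)
  finally show "r_pow m y = form_of (2 * m) (\<lambda>\<gamma>. fact m * 2 ^ m / fact (2 * m) * ?h \<gamma>) y"
    by (simp add: C_def)
qed

lemma r_pow_in_forms: "(r_pow m :: real ^ 'n \<Rightarrow> real) \<in> forms (2 * m)"
  unfolding r_pow_coefs by (rule form_of_in_forms)

text \<open>Integrated over x, the kernel (x \<bullet> y)^(2m) is a form in y whose normalised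
  coefficients are the moments. By rotation invariance it is also a multiple of |y|^(2m), and
  coefficients are unique.\<close>

lemma moment_aux:
  assumes "\<gamma> \<in> exponents (2 * m)"
  shows "(\<integral>x. xpow x \<gamma> \<partial>\<sigma>) =
    (\<integral>x. (x \<bullet> axis i 1) ^ (2 * m) \<partial>\<sigma>) * (fact m * 2 ^ m / fact (2 * m)) * (\<Prod>i\<in>UNIV. herm (\<gamma> i) 0)"
proof -
  let ?c = "\<integral>x. (x \<bullet> axis i 1) ^ (2 * m) \<partial>\<sigma>"
  have "form_of (2 * m) (\<lambda>\<gamma>. \<integral>x. xpow x \<gamma> \<partial>\<sigma>) y =
     form_of (2 * m) (\<lambda>\<gamma>. ?c * (fact m * 2 ^ m / fact (2 * m) * (\<Prod>i\<in>UNIV. herm (\<gamma> i) 0))) y" for y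
  proof -
    have "form_of (2 * m) (\<lambda>\<gamma>. \<integral>x. xpow x \<gamma> \<partial>\<sigma>) y =
      (\<Sum>\<gamma>\<in>exponents (2 * m). \<integral>x. multinom \<gamma> * xpow x \<gamma> * xpow y \<gamma> \<partial>\<sigma>)"
      by (simp add: form_of_def)
    also have "\<dots> = (\<integral>x. (x \<bullet> y) ^ (2 * m) \<partial>\<sigma>)"
      unfolding inner_power by (rule Bochner_Integration.integral_sum[symmetric])
        (intro integrable_\<sigma> continuous_intros)
    also have "\<dots> = ?c * r_pow m y"
      by (simp add: r_pow_eq integral_inner_power[of y m i])
    finally show ?thesis
      by (simp add: r_pow_coefs form_of_def sum_distrib_left mult_ac)
  qed
  from form_of_inject[OF ext[OF this] assms] show ?thesis by simp
qed

text \<open>On the sphere a monomial may be multiplied by the sum of the squares of the coordinates,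
  which equals 1. This links the unknown constants in degrees 2m and 2m + 2 by the factor n +
  2m.\<close>

lemma integral_axis_power:
  "(\<integral>x. (x \<bullet> axis i 1) ^ (2 * m) \<partial>\<sigma>) * (fact m * 2 ^ m / fact (2 * m)) = kap CARD('n) m"
proof (induction m)
  case 0
  then show ?case by (simp add: measure_\<sigma> kap_def)
next
  case (Suc m)
  define K where "K = (\<lambda>m. (\<integral>x. (x \<bullet> axis i 1) ^ (2 * m) \<partial>\<sigma>) * (fact m * 2 ^ m / fact (2 * m)))"
  \<comment> \<open>A test exponent with all entries even: its moment product \<open>P\<close> is
    positive and can be cancelled.\<close>
  define \<gamma> where "\<gamma> = (\<lambda>j. if j = i then 2 * m else 0)"
  define P where "P = (\<Prod>j\<in>UNIV. herm (\<gamma> j) 0)"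
  have \<gamma>: "\<gamma> \<in> exponents (2 * m)"
    by (simp add: exponents_def \<gamma>_def)
  have "P = herm (2 * m) 0 * (\<Prod>j\<in>UNIV - {i}. 1)"
    unfolding P_def by (subst prod.remove[of UNIV i]) (auto simp: \<gamma>_def intro!: prod.neutral)
  then have P: "P > 0"
    by (simp add: herm_moment_even)
  define \<delta> where "\<delta> = (\<lambda>j. \<gamma>(j := Suc (Suc (\<gamma> j))))"
  have \<delta>: "\<delta> j \<in> exponents (2 * Suc m)" for j
    using exponents_upd_Suc[OF exponents_upd_Suc[OF \<gamma>], of j j] by (simp add: \<delta>_def)
  have "K m * P = (\<integral>x. xpow x \<gamma> \<partial>\<sigma>)"
    unfolding K_def P_def by (rule moment_aux[OF \<gamma>, symmetric])
  also have "\<dots> = (\<integral>x. (\<Sum>j\<in>UNIV. xpow x (\<delta> j)) \<partial>\<sigma>)"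
  proof (rule Bochner_Integration.integral_cong[OF refl])
    fix x assume "x \<in> space \<sigma>"
    then have "(\<Sum>j\<in>UNIV. (x $ j)\<^sup>2) = 1"
      by (simp add: space_\<sigma> norm_eq_sqrt_inner inner_vec_def power2_eq_square)
    moreover have "xpow x (\<delta> j) = xpow x \<gamma> * (x $ j)\<^sup>2" for j
      by (simp add: xpow_def \<delta>_def prod.remove[of UNIV j] power2_eq_square)
    ultimately show "xpow x \<gamma> = (\<Sum>j\<in>UNIV. xpow x (\<delta> j))"
      by (simp flip: sum_distrib_left)
  qed
  also have "\<dots> = (\<Sum>j\<in>UNIV. \<integral>x. xpow x (\<delta> j) \<partial>\<sigma>)"
    by (intro Bochner_Integration.integral_sum integrable_\<sigma> continuous_intros)
  also have "\<dots> = (\<Sum>j\<in>UNIV. K (Suc m) * P * real (\<gamma> j + 1))"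
  proof (rule sum.cong[OF refl])
    fix j
    have "(\<Prod>l\<in>UNIV. herm (\<delta> j l) 0) = P * real (\<gamma> j + 1)"
      by (simp add: P_def \<delta>_def prod.remove[of UNIV j] herm_moment_rec del: herm.simps)
    then show "(\<integral>x. xpow x (\<delta> j) \<partial>\<sigma>) = K (Suc m) * P * real (\<gamma> j + 1)"
      using moment_aux[OF \<delta>, of j i] by (simp only: K_def mult.assoc)
  qed
  also have "\<dots> = K (Suc m) * P * real (CARD('n) + 2 * m)"
  proof -
    have "(\<Sum>j\<in>UNIV. real (\<gamma> j + 1)) = real (CARD('n) + 2 * m)"
      using \<gamma> unfolding of_nat_sum[symmetric] by (simp only: sum.distrib exponents_def) simp
    then show ?thesis
      by (simp only: sum_distrib_left[symmetric])
  qed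
  finally have "K m = K (Suc m) * real (CARD('n) + 2 * m)"
    using P by simp
  moreover have "K m = kap CARD('n) m" using Suc by (simp add: K_def)
  ultimately have "K (Suc m) = kap CARD('n) (Suc m)"
  proof -
    have "kap CARD('n) (Suc m) = kap CARD('n) m / real (CARD('n) + 2 * m)"
      by (simp add: kap_def)
    moreover have "real (CARD('n) + 2 * m) \<noteq> 0"
      using n2 by simp
    ultimately show ?thesis
      using \<open>K m = K (Suc m) * real (CARD('n) + 2 * m)\<close> \<open>K m = kap CARD('n) m\<close> by simp
  qed
  then show ?case by (simp add: K_def)
qed

lemma moments:
  "\<gamma> \<in> exponents (2 * m) \<Longrightarrow> (\<integral>x. xpow x \<gamma> \<partial>\<sigma>) = kap CARD('n) m * (\<Prod>i\<in>UNIV. herm (\<gamma> i) 0)"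
  using moment_aux[of \<gamma> m "undefined"] unfolding integral_axis_power .

text \<open>Moments and coefficients of \<open>r_pow m\<close> are proportional, so integration is
  Bombieri pairing with \<open>r_pow m\<close>. In particular M is the Bombieri-orthogonal
  complement of \<open>r_pow k\<close>.\<close>

lemma integral_form:
  assumes "f \<in> forms (2 * m)"
  shows "(\<integral>x. f x \<partial>\<sigma>) = ckap CARD('n) m * bom (2 * m) f (r_pow m)"
proof -
  have "(\<integral>x. f x \<partial>\<sigma>) = (\<integral>x. (\<Sum>\<gamma>\<in>exponents (2 * m). multinom \<gamma> * ncoef (2 * m) f \<gamma> * xpow x \<gamma>) \<partial>\<sigma>)"
    by (rule Bochner_Integration.integral_cong[OF refl]) (rule form_eval[OF assms])
  also have "\<dots> = (\<Sum>\<gamma>\<in>exponents (2 * m). \<integral>x. multinom \<gamma> * ncoef (2 * m) f \<gamma> * xpow x \<gamma> \<partial>\<sigma>)"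
    by (intro Bochner_Integration.integral_sum integrable_\<sigma> continuous_intros)
  also have "\<dots> = ckap CARD('n) m * bom (2 * m) f (r_pow m)"
    unfolding bom_def sum_distrib_left
  proof (rule sum.cong[OF refl])
    fix \<gamma> :: "'n \<Rightarrow> nat" assume \<gamma>: "\<gamma> \<in> exponents (2 * m)"
    show "(\<integral>x. multinom \<gamma> * ncoef (2 * m) f \<gamma> * xpow x \<gamma> \<partial>\<sigma>) =
      ckap CARD('n) m * (multinom \<gamma> * ncoef (2 * m) f \<gamma> * ncoef (2 * m) (r_pow m) \<gamma>)"
      by (simp add: moments[OF \<gamma>] r_pow_coefs ncoef_form_of[OF \<gamma>] ckap_def)
  qed
  finally show ?thesis .
qed

text \<open>Expanding in Hermite polynomials, the Gaussian (hence, by homogeneity, spherical) second moment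
  of a form dominates the contribution of its top degree Hermite part, which is the Bombieri norm.\<close>
theorem bom_le_integral:
  assumes "g \<in> forms m"
  shows "fact m * kap CARD('n) m * bom m g g \<le> (\<integral>x. (g x)\<^sup>2 \<partial>\<sigma>)"
proof -
  define c where "c = (\<lambda>\<alpha>. multinom \<alpha> * ncoef m g \<alpha>)"
  define H where "H = (\<lambda>(\<alpha>::'n \<Rightarrow> nat) \<rho>. \<Prod>i\<in>UNIV. herm (\<alpha> i) (\<rho> i))"
  define F where "F = (\<lambda>\<rho>::'n \<Rightarrow> nat. \<Prod>i\<in>UNIV. fact (\<rho> i) :: real)"
  \<comment> \<open>Each entry of \<alpha> + \<beta> is at most 2m, so this range suffices for
    \<open>herm_orthogonality\<close> in every coordinate.\<close>
  define R where "R = (UNIV :: 'n set) \<rightarrow>\<^sub>E {..2 * m}"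
  have finR: "finite R" unfolding R_def by (auto intro: finite_PiE)
  have FH: "(\<Prod>i\<in>UNIV. herm (\<alpha> i + \<beta> i) 0) = (\<Sum>\<rho>\<in>R. F \<rho> * H \<alpha> \<rho> * H \<beta> \<rho>)"
    if "\<alpha> \<in> exponents m" "\<beta> \<in> exponents m" for \<alpha> \<beta>
  proof -
    have "(\<Prod>i\<in>UNIV. herm (\<alpha> i + \<beta> i) 0) =
        (\<Prod>i\<in>UNIV. \<Sum>r\<le>2*m. fact r * herm (\<alpha> i) r * herm (\<beta> i) r)"
    proof (rule prod.cong[OF refl])
      fix i
      have "\<alpha> i + \<beta> i \<le> 2 * m"
        using exponents_le that add_mono by (metis mult_2)
      then show "herm (\<alpha> i + \<beta> i) 0 = (\<Sum>r\<le>2*m. fact r * herm (\<alpha> i) r * herm (\<beta> i) r)"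
        by (simp add: herm_orthogonality)
    qed
    also have "\<dots> = (\<Sum>\<rho>\<in>R. \<Prod>i\<in>UNIV. fact (\<rho> i) * herm (\<alpha> i) (\<rho> i) * herm (\<beta> i) (\<rho> i))"
      unfolding R_def by (rule prod_sum_PiE) auto
    finally show ?thesis
      by (simp add: F_def H_def prod.distrib)
  qed
  \<comment> \<open>\<open>H \<alpha> \<rho>\<close> vanishes unless \<rho> \<le> \<alpha>
    entrywise. For equal total degree m that forces \<rho> = \<alpha>, and the leading Hermite
    coefficient is 1.\<close>
  have Hdiag: "(\<Sum>\<alpha>\<in>exponents m. c \<alpha> * H \<alpha> \<rho>) = c \<rho>" if \<rho>: "\<rho> \<in> exponents m" for \<rho>
  proof -
    have "H \<alpha> \<rho> = (if \<alpha> = \<rho> then 1 else 0)" if \<alpha>: "\<alpha> \<in> exponents m" for \<alpha>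
    proof (cases "\<alpha> = \<rho>")
      case False
      have "\<exists>i. \<rho> i > \<alpha> i"
      proof (rule ccontr)
        assume "\<not> (\<exists>i. \<rho> i > \<alpha> i)"
        then have le: "\<rho> i \<le> \<alpha> i" for i by (simp add: not_less)
        obtain j where "\<rho> j < \<alpha> j"
          using False le by (metis ext le_neq_implies_less)
        then have "sum \<rho> UNIV < sum \<alpha> UNIV"
          using le by (intro sum_strict_mono_ex1) auto
        then show False using \<alpha> \<rho> by (simp add: exponents_def)
      qed
      then obtain i where "herm (\<alpha> i) (\<rho> i) = 0"
        using herm_above[of "\<alpha> _" "\<rho> _"] by metis
      then have "H \<alpha> \<rho> = 0"
        unfolding H_def by (intro prod_zero) auto
      then show ?thesis
        using False by simp
    qed (simp add: H_def herm_diag)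
    then have "(\<Sum>\<alpha>\<in>exponents m. c \<alpha> * H \<alpha> \<rho>) = (\<Sum>\<alpha>\<in>exponents m. if \<alpha> = \<rho> then c \<alpha> else 0)"
      by (intro sum.cong) auto
    then show ?thesis
      using \<rho> by (simp add: finite_exponents)
  qed
  have "(\<integral>x. (g x)\<^sup>2 \<partial>\<sigma>) = (\<integral>x. (\<Sum>\<alpha>\<in>exponents m. \<Sum>\<beta>\<in>exponents m. c \<alpha> * c \<beta> * xpow x (\<alpha> + \<beta>)) \<partial>\<sigma>)"
  proof (rule Bochner_Integration.integral_cong[OF refl])
    fix x
    have "g x = (\<Sum>\<alpha>\<in>exponents m. c \<alpha> * xpow x \<alpha>)"
      unfolding c_def by (rule form_eval[OF assms])
    then show "(g x)\<^sup>2 = (\<Sum>\<alpha>\<in>exponents m. \<Sum>\<beta>\<in>exponents m. c \<alpha> * c \<beta> * xpow x (\<alpha> + \<beta>))"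
      by (simp only: power2_eq_square sum_product xpow_add mult.assoc mult.left_commute)
  qed
  also have "\<dots> = (\<Sum>\<alpha>\<in>exponents m. \<Sum>\<beta>\<in>exponents m. \<integral>x. c \<alpha> * c \<beta> * xpow x (\<alpha> + \<beta>) \<partial>\<sigma>)"
  proof -
    have "integrable \<sigma> (\<lambda>x. c \<alpha> * c \<beta> * xpow x (\<alpha> + \<beta>))" for \<alpha> \<beta>
      by (intro integrable_\<sigma> continuous_intros)
    then show ?thesis
      by (subst Bochner_Integration.integral_sum)
         (auto intro!: Bochner_Integration.integrable_sum sum.cong Bochner_Integration.integral_sum
               simp del: integral_mult_right_zero)
  qed
  also have "\<dots> = (\<Sum>\<alpha>\<in>exponents m. \<Sum>\<beta>\<in>exponents m. \<Sum>\<rho>\<in>R. kap CARD('n) m * F \<rho> * (c \<alpha> * H \<alpha> \<rho>) * (c \<beta> * H \<beta> \<rho>))"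
  proof (intro sum.cong refl)
    fix \<alpha> \<beta> :: "'n \<Rightarrow> nat" assume e: "\<alpha> \<in> exponents m" "\<beta> \<in> exponents m"
    have ab: "\<alpha> + \<beta> \<in> exponents (2 * m)"
      using exponents_add[OF e] by (simp add: mult_2)
    show "(\<integral>x. c \<alpha> * c \<beta> * xpow x (\<alpha> + \<beta>) \<partial>\<sigma>) =
        (\<Sum>\<rho>\<in>R. kap CARD('n) m * F \<rho> * (c \<alpha> * H \<alpha> \<rho>) * (c \<beta> * H \<beta> \<rho>))"
    proof -
      have "(\<integral>x. c \<alpha> * c \<beta> * xpow x (\<alpha> + \<beta>) \<partial>\<sigma>) =
          c \<alpha> * c \<beta> * (kap CARD('n) m * (\<Sum>\<rho>\<in>R. F \<rho> * H \<alpha> \<rho> * H \<beta> \<rho>))"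
        using moments[OF ab] FH[OF e] by simp
      then show ?thesis
        unfolding sum_distrib_left by (simp only: mult.assoc mult.left_commute)
    qed
  qed
  also have "\<dots> = (\<Sum>\<rho>\<in>R. kap CARD('n) m * F \<rho> * (\<Sum>\<alpha>\<in>exponents m. c \<alpha> * H \<alpha> \<rho>)\<^sup>2)"
  proof -
    have "kap CARD('n) m * F \<rho> * (\<Sum>\<alpha>\<in>exponents m. c \<alpha> * H \<alpha> \<rho>)\<^sup>2 = (\<Sum>\<alpha>\<in>exponents m. \<Sum>\<beta>\<in>exponents m.
        kap CARD('n) m * F \<rho> * (c \<alpha> * H \<alpha> \<rho>) * (c \<beta> * H \<beta> \<rho>))" for \<rho>
      by (simp only: power2_eq_square sum_product) (simp only: sum_distrib_left mult.assoc)
    then show ?thesis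
      by (simp only:) (subst sum.swap, rule sum.cong[OF refl], rule sum.swap)
  qed
  also have "\<dots> \<ge> (\<Sum>\<rho>\<in>exponents m. kap CARD('n) m * F \<rho> * (\<Sum>\<alpha>\<in>exponents m. c \<alpha> * H \<alpha> \<rho>)\<^sup>2)"
  proof (rule sum_mono2[OF finR])
    show "exponents m \<subseteq> R"
    proof
      fix \<rho> :: "'n \<Rightarrow> nat" assume "\<rho> \<in> exponents m"
      then have "\<rho> i \<le> 2 * m" for i
        using exponents_le[of \<rho> m i] by linarith
      then show "\<rho> \<in> R" by (auto simp: R_def PiE_def)
    qed
    show "0 \<le> kap CARD('n) m * F \<rho> * (\<Sum>\<alpha>\<in>exponents m. c \<alpha> * H \<alpha> \<rho>)\<^sup>2" for \<rho>
      using kap_pos[of m] by (auto simp: F_def intro!: mult_nonneg_nonneg prod_nonneg)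
  qed
  also have "(\<Sum>\<rho>\<in>exponents m. kap CARD('n) m * F \<rho> * (\<Sum>\<alpha>\<in>exponents m. c \<alpha> * H \<alpha> \<rho>)\<^sup>2) =
     fact m * kap CARD('n) m * bom m g g"
    unfolding bom_def sum_distrib_left
  proof (rule sum.cong[OF refl])
    fix \<rho> :: "'n \<Rightarrow> nat" assume \<rho>: "\<rho> \<in> exponents m"
    have Fm: "F \<rho> * multinom \<rho> = fact m"
      using \<rho> by (simp add: F_def multinom_def exponents_def)
    have kF: "kap CARD('n) m * F \<rho> * (\<Sum>\<alpha>\<in>exponents m. c \<alpha> * H \<alpha> \<rho>)\<^sup>2 =
      kap CARD('n) m * (F \<rho> * multinom \<rho>) * (multinom \<rho> * ncoef m g \<rho> * ncoef m g \<rho>)"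
      unfolding Hdiag[OF \<rho>] by (simp add: c_def power2_eq_square)
    then show "kap CARD('n) m * F \<rho> * (\<Sum>\<alpha>\<in>exponents m. c \<alpha> * H \<alpha> \<rho>)\<^sup>2 =
      fact m * kap CARD('n) m * (multinom \<rho> * ncoef m g \<rho> * ncoef m g \<rho>)"
      by (simp only: Fm) (simp only: mult.commute mult.left_commute)
  qed
  finally show ?thesis .
qed

end

section \<open>Sums of squares and catalecticants\<close>

lemma square_coefs:
  assumes "g \<in> forms k"
  shows "(\<lambda>x. (g x)\<^sup>2) = form_of (2 * k) (\<lambda>\<gamma>. (\<Sum>(\<alpha>, \<beta>) | (\<alpha>, \<beta>) \<in> exponents k \<times> exponents k \<and> \<alpha> + \<beta> = \<gamma>.
      multinom \<alpha> * multinom \<beta> * (ncoef k g \<alpha> * ncoef k g \<beta>)) / multinom \<gamma>)"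
proof
  fix x
  have "(g x)\<^sup>2 = (\<Sum>\<alpha>\<in>exponents k. \<Sum>\<beta>\<in>exponents k.
      multinom \<alpha> * multinom \<beta> * (ncoef k g \<alpha> * ncoef k g \<beta>) * xpow x (\<alpha> + \<beta>))"
    by (simp add: form_eval[OF assms] power2_eq_square sum_product xpow_add mult_ac)
  also have "\<dots> = (\<Sum>\<gamma>\<in>exponents (2 * k). (\<Sum>(\<alpha>, \<beta>) | (\<alpha>, \<beta>) \<in> exponents k \<times> exponents k \<and> \<alpha> + \<beta> = \<gamma>.
      multinom \<alpha> * multinom \<beta> * (ncoef k g \<alpha> * ncoef k g \<beta>)) * xpow x \<gamma>)"
    by (subst sum_exponents_add) (simp add: mult_2 sum_distrib_right case_prod_unfold)
  finally show "(g x)\<^sup>2 = form_of (2 * k) (\<lambda>\<gamma>. (\<Sum>(\<alpha>, \<beta>) | (\<alpha>, \<beta>) \<in> exponents k \<times> exponents k \<and> \<alpha> + \<beta> = \<gamma>.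
      multinom \<alpha> * multinom \<beta> * (ncoef k g \<alpha> * ncoef k g \<beta>)) / multinom \<gamma>) x"
    by (simp add: form_of_def)
qed

lemma square_in_forms: "g \<in> forms k \<Longrightarrow> (\<lambda>x. (g x)\<^sup>2) \<in> forms (2 * k)"
  by (subst square_coefs) (auto intro: form_of_in_forms)

text \<open>The right-hand side is the catalecticant of \<phi>, a Hankel-type matrix in the
  coefficients of g. The division by \<open>multinom \<gamma>\<close> in \<open>square_coefs\<close>
  cancels the weight in \<open>bom\<close>.\<close>

lemma bom_square:
  assumes "g \<in> forms k"
  shows "bom (2 * k) \<phi> (\<lambda>x. (g x)\<^sup>2) = (\<Sum>\<alpha>\<in>exponents k. \<Sum>\<beta>\<in>exponents k.
      multinom \<alpha> * multinom \<beta> * ncoef (2 * k) \<phi> (\<alpha> + \<beta>) * ncoef k g \<alpha> * ncoef k g \<beta>)"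
proof -
  let ?P = "\<lambda>\<gamma>. {(\<alpha>, \<beta>). (\<alpha>, \<beta>) \<in> exponents k \<times> exponents k \<and> \<alpha> + \<beta> = \<gamma>}"
  have "bom (2 * k) \<phi> (\<lambda>x. (g x)\<^sup>2) = (\<Sum>\<gamma>\<in>exponents (2 * k). ncoef (2 * k) \<phi> \<gamma> *
     (\<Sum>(\<alpha>, \<beta>)\<in>?P \<gamma>. multinom \<alpha> * multinom \<beta> * (ncoef k g \<alpha> * ncoef k g \<beta>)))"
    unfolding bom_def
  proof (rule sum.cong[OF refl])
    fix \<gamma> :: "'a \<Rightarrow> nat" assume "\<gamma> \<in> exponents (2 * k)"
    then show "multinom \<gamma> * ncoef (2 * k) \<phi> \<gamma> * ncoef (2 * k) (\<lambda>x. (g x)\<^sup>2) \<gamma> = ncoef (2 * k) \<phi> \<gamma> *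
     (\<Sum>(\<alpha>, \<beta>)\<in>?P \<gamma>. multinom \<alpha> * multinom \<beta> * (ncoef k g \<alpha> * ncoef k g \<beta>))"
      using multinom_pos[of \<gamma>] by (simp add: square_coefs[OF assms] ncoef_form_of)
  qed
  also have "\<dots> = (\<Sum>\<gamma>\<in>exponents (k + k). \<Sum>(\<alpha>, \<beta>)\<in>?P \<gamma>.
      multinom \<alpha> * multinom \<beta> * ncoef (2 * k) \<phi> \<gamma> * ncoef k g \<alpha> * ncoef k g \<beta>)"
    unfolding mult_2 sum_distrib_left case_prod_unfold by (simp only: mult.assoc mult.left_commute)
  also have "\<dots> = (\<Sum>\<alpha>\<in>exponents k. \<Sum>\<beta>\<in>exponents k.
      multinom \<alpha> * multinom \<beta> * ncoef (2 * k) \<phi> (\<alpha> + \<beta>) * ncoef k g \<alpha> * ncoef k g \<beta>)"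
    by (rule sum_exponents_add[symmetric])
  finally show ?thesis .
qed

text \<open>Compare coefficients in two expansions of (x_1 + ... + x_n)^(2k): as a power, and as the
  square of the k-th power. Pairing with the all-ones vector makes every normalised coefficient
  1.\<close>

lemma vandermonde_multinom:
  assumes "\<gamma> \<in> exponents (2 * k)"
  shows "(\<Sum>(\<alpha>, \<beta>) | (\<alpha>, \<beta>) \<in> exponents k \<times> exponents k \<and> \<alpha> + \<beta> = \<gamma>. multinom \<alpha> * multinom \<beta>) = multinom \<gamma>"
proof -
  define e1 :: "real ^ 'a" where "e1 = (\<chi> i. 1)"
  have one: "xpow e1 \<alpha> = 1" for \<alpha>
    by (simp add: xpow_def e1_def)
  have g: "(\<lambda>x. (x \<bullet> e1) ^ k) \<in> forms k"
    by (simp add: power_form form_of_in_forms)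
  have "multinom \<gamma> * 1 = multinom \<gamma> * ncoef (2 * k) (\<lambda>x. (x \<bullet> e1) ^ (2 * k)) \<gamma>"
    using assms by (simp add: power_form ncoef_form_of one)
  also have "(\<lambda>x. (x \<bullet> e1) ^ (2 * k)) = (\<lambda>x. ((x \<bullet> e1) ^ k)\<^sup>2)"
    by (simp add: mult.commute flip: power_mult)
  also have "multinom \<gamma> * ncoef (2 * k) (\<lambda>x. ((x \<bullet> e1) ^ k)\<^sup>2) \<gamma> =
     (\<Sum>(\<alpha>, \<beta>) | (\<alpha>, \<beta>) \<in> exponents k \<times> exponents k \<and> \<alpha> + \<beta> = \<gamma>. multinom \<alpha> * multinom \<beta> *
       (ncoef k (\<lambda>x. (x \<bullet> e1) ^ k) \<alpha> * ncoef k (\<lambda>x. (x \<bullet> e1) ^ k) \<beta>))"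
    unfolding square_coefs[OF g] ncoef_form_of[OF assms] using multinom_pos[of \<gamma>] by simp
  also have "\<dots> = (\<Sum>(\<alpha>, \<beta>) | (\<alpha>, \<beta>) \<in> exponents k \<times> exponents k \<and> \<alpha> + \<beta> = \<gamma>. multinom \<alpha> * multinom \<beta>)"
    by (rule sum.cong) (auto simp: power_form ncoef_form_of one)
  finally show ?thesis by simp
qed

text \<open>By the Vandermonde identity each coefficient of \<open>g\<^sup>2\<close> is a weighted mean of products of
  coefficients of \<open>g\<close>, so Cauchy-Schwarz applies.\<close>
lemma bom_square_le:
  assumes g: "g \<in> forms k"
  shows "bom (2 * k) (\<lambda>x. (g x)\<^sup>2) (\<lambda>x. (g x)\<^sup>2) \<le> (bom k g g)\<^sup>2"
proof -
  let ?P = "\<lambda>\<gamma>. {(\<alpha>, \<beta>). (\<alpha>, \<beta>) \<in> exponents k \<times> exponents k \<and> \<alpha> + \<beta> = \<gamma>}"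
  let ?a = "ncoef k g"
  define w where "w = (\<lambda>p::('a \<Rightarrow> nat) \<times> ('a \<Rightarrow> nat). multinom (fst p) * multinom (snd p))"
  define b where "b = (\<lambda>p. ?a (fst p) * ?a (snd p))"
  have w: "w p > 0" for p by (simp add: w_def multinom_pos)
  have "bom (2 * k) (\<lambda>x. (g x)\<^sup>2) (\<lambda>x. (g x)\<^sup>2) \<le> (\<Sum>\<gamma>\<in>exponents (k + k). \<Sum>p\<in>?P \<gamma>. w p * (b p)\<^sup>2)"
    unfolding bom_def mult_2[symmetric]
  proof (rule sum_mono)
    fix \<gamma> :: "'a \<Rightarrow> nat" assume \<gamma>: "\<gamma> \<in> exponents (2 * k)"
    have m: "multinom \<gamma> = (\<Sum>p\<in>?P \<gamma>. w p)"
      using vandermonde_multinom[OF \<gamma>] by (simp add: w_def case_prod_unfold)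
    have c: "ncoef (2 * k) (\<lambda>x. (g x)\<^sup>2) \<gamma> = (\<Sum>p\<in>?P \<gamma>. w p * b p) / multinom \<gamma>"
      unfolding square_coefs[OF g] ncoef_form_of[OF \<gamma>] by (simp add: w_def b_def case_prod_unfold)
    have "(\<Sum>p\<in>?P \<gamma>. w p * b p)\<^sup>2 = (\<Sum>p\<in>?P \<gamma>. sqrt (w p) * (sqrt (w p) * b p))\<^sup>2"
      using w by (simp add: less_imp_le flip: mult.assoc)
    also have "\<dots> \<le> (\<Sum>p\<in>?P \<gamma>. (sqrt (w p))\<^sup>2) * (\<Sum>p\<in>?P \<gamma>. (sqrt (w p) * b p)\<^sup>2)"
      by (rule Cauchy_Schwarz_ineq_sum)
    also have "\<dots> = multinom \<gamma> * (\<Sum>p\<in>?P \<gamma>. w p * (b p)\<^sup>2)"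
      using w by (simp add: m power_mult_distrib less_imp_le)
    finally have "(\<Sum>p\<in>?P \<gamma>. w p * b p)\<^sup>2 \<le> multinom \<gamma> * (\<Sum>p\<in>?P \<gamma>. w p * (b p)\<^sup>2)" .
    then show "multinom \<gamma> * ncoef (2 * k) (\<lambda>x. (g x)\<^sup>2) \<gamma> * ncoef (2 * k) (\<lambda>x. (g x)\<^sup>2) \<gamma>
        \<le> (\<Sum>p\<in>?P \<gamma>. w p * (b p)\<^sup>2)"
      unfolding c using multinom_pos[of \<gamma>] by (simp add: field_simps power2_eq_square)
  qed
  also have "\<dots> = (\<Sum>\<alpha>\<in>exponents k. \<Sum>\<beta>\<in>exponents k. w (\<alpha>, \<beta>) * (b (\<alpha>, \<beta>))\<^sup>2)"
    by (subst sum_exponents_add) (simp add: case_prod_unfold)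
  also have "\<dots> = (bom k g g)\<^sup>2"
    by (simp add: bom_def power2_eq_square sum_product w_def b_def mult_ac)
  finally show ?thesis .
qed

text \<open>Lagrange reduction: complete the square in one variable and continue with the Schur
  complement, which stays positive semidefinite.\<close>

lemma psd_form_sum_of_squares:
  fixes H :: "'j \<Rightarrow> 'j \<Rightarrow> real"
  assumes "finite J" "\<And>i j. H i j = H j i"
    and "\<And>u. (\<Sum>i\<in>J. \<Sum>j\<in>J. H i j * u i * u j) \<ge> 0"
  shows "\<exists>(m::nat) l. \<forall>u. (\<Sum>i\<in>J. \<Sum>j\<in>J. H i j * u i * u j) = (\<Sum>t<m. (\<Sum>i\<in>J. l t i * u i)\<^sup>2)"
  using assms
proof (induction J arbitrary: H rule: finite_induct)
  case empty
  show ?case by (rule exI[of _ 0]) simp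
next
  case (insert a J)
  define d where "d = H a a"
  let ?L = "\<lambda>u. \<Sum>j\<in>J. H a j * u j" and ?Q = "\<lambda>u. \<Sum>i\<in>J. \<Sum>j\<in>J. H i j * u i * u j"
  have split: "(\<Sum>i\<in>insert a J. \<Sum>j\<in>insert a J. H i j * u i * u j) = d * (u a)\<^sup>2 + 2 * u a * ?L u + ?Q u" for u
  proof -
    have "(\<Sum>i\<in>J. H i a * u i * u a) = u a * ?L u"
      by (simp add: sum_distrib_left insert.prems(1)[of _ a] mult_ac)
    moreover have "(\<Sum>j\<in>J. H a j * u a * u j) = u a * ?L u"
      by (simp add: sum_distrib_left mult_ac)
    ultimately show ?thesis
      using insert(1,2) by (simp add: sum.distrib d_def power2_eq_square)
  qed
  have nonneg: "d * s\<^sup>2 + 2 * s * ?L u + ?Q u \<ge> 0" for s u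
  proof -
    have "?L (u(a := s)) = ?L u" "?Q (u(a := s)) = ?Q u"
      using insert(2) by (auto intro!: sum.cong)
    then show ?thesis
      using insert.prems(2)[of "u(a := s)"] unfolding split by simp
  qed
  have "d \<ge> 0" using nonneg[of 1 "\<lambda>_. 0"] by simp
  \<comment> \<open>Treats a zero and a positive pivot d together: the multiple e of the squared
    linear part is taken out of the remaining form and merged with the terms in \<open>u a\<close>
    into one square.\<close>
  have key: "\<exists>(m::nat) l. \<forall>u. (\<Sum>i\<in>insert a J. \<Sum>j\<in>insert a J. H i j * u i * u j) = (\<Sum>t<m. (\<Sum>i\<in>insert a J. l t i * u i)\<^sup>2)"
    if S: "\<And>u. ?Q u = e * (?L u)\<^sup>2 + (\<Sum>i\<in>J. \<Sum>j\<in>J. H' i j * u i * u j)" "\<And>i j. H' i j = H' j i"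
      "\<And>u. (\<Sum>i\<in>J. \<Sum>j\<in>J. H' i j * u i * u j) \<ge> 0"
      "\<And>u. d * (u a)\<^sup>2 + 2 * u a * ?L u + e * (?L u)\<^sup>2 = (r * u a + q * ?L u)\<^sup>2" for e r q :: real and H'
  proof -
    obtain m :: nat and l where l: "\<And>u. (\<Sum>i\<in>J. \<Sum>j\<in>J. H' i j * u i * u j) = (\<Sum>t<m. (\<Sum>i\<in>J. l t i * u i)\<^sup>2)"
      using insert.IH[OF S(2,3)] by blast
    define l' where "l' = (\<lambda>t i. if t = m then (if i = a then r else q * H a i) else (if i = a then 0 else l t i))"
    have "(\<Sum>i\<in>insert a J. l' m i * u i) = r * u a + q * ?L u" for u
      using insert(1,2) by (auto simp: l'_def sum_distrib_left mult.assoc intro!: sum.cong)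
    moreover have "(\<Sum>i\<in>insert a J. l' t i * u i) = (\<Sum>i\<in>J. l t i * u i)" if "t < m" for t u
      using insert(1,2) that by (auto simp: l'_def intro!: sum.cong)
    ultimately have "(\<Sum>i\<in>insert a J. \<Sum>j\<in>insert a J. H i j * u i * u j) =
       (\<Sum>t<Suc m. (\<Sum>i\<in>insert a J. l' t i * u i)\<^sup>2)" for u
      unfolding split by (simp add: S(4)[symmetric] S(1) flip: l)
    then show ?thesis by blast
  qed
  show ?case
  proof (cases "d = 0")
    case True
    have "?L u = 0" for u
    proof (rule ccontr)
      assume L: "?L u \<noteq> 0"
      \<comment> \<open>For d = 0 the quadratic is affine in s, and at this s it takes the value
        -1.\<close>
      show False
        using nonneg[of "- (?Q u + 1) / (2 * ?L u)" u] L True by (simp add: field_simps)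
    qed
    then show ?thesis
      using True nonneg[of 0] by (intro key[of 0 H 0 0]) (auto simp: insert.prems(1))
  next
    case False
    then have "d > 0" using \<open>d \<ge> 0\<close> by simp
    have Q: "?Q u = (1 / d) * (?L u)\<^sup>2 + (\<Sum>i\<in>J. \<Sum>j\<in>J. (H i j - H a i * H a j / d) * u i * u j)" for u
      by (simp add: power2_eq_square sum_product sum_divide_distrib algebra_simps sum_subtractf)
    show ?thesis
    proof (rule key[OF Q, of "sqrt d" "1 / sqrt d"])
      show "H i j - H a i * H a j / d = H j i - H a j * H a i / d" for i j
        using insert.prems(1)[of i j] by simp
      show "0 \<le> (\<Sum>i\<in>J. \<Sum>j\<in>J. (H i j - H a i * H a j / d) * u i * u j)" for u
      proof -
        \<comment> \<open>The minimiser over s; the minimum is the value of the Schur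
          complement.\<close>
        have "d * (- ?L u / d)\<^sup>2 + 2 * (- ?L u / d) * ?L u = - (1 / d) * (?L u)\<^sup>2"
          using \<open>d > 0\<close> by (simp add: power2_eq_square field_simps)
        then show ?thesis
          using nonneg[of "- ?L u / d" u] Q[of u] by linarith
      qed
      show "d * (u a)\<^sup>2 + 2 * u a * ?L u + 1 / d * (?L u)\<^sup>2 = (sqrt d * u a + 1 / sqrt d * ?L u)\<^sup>2" for u
        using \<open>d > 0\<close> by (simp add: power2_sum power_mult_distrib power_divide)
    qed
  qed
qed

text \<open>If the catalecticant form \<open>g \<mapsto> bom f (g\<^sup>2)\<close> is positive semidefinite, diagonalise it and evaluate
  at the powers \<open>(x \<bullet> y) ^ k\<close>, where it takes the value \<open>f y\<close>.\<close>
lemma sos_if_catalecticant_psd: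
  fixes f :: "real ^ 'n \<Rightarrow> real"
  assumes f: "f \<in> forms (2 * k)" and pos: "\<And>g. g \<in> forms k \<Longrightarrow> bom (2 * k) f (\<lambda>x. (g x)\<^sup>2) \<ge> 0"
  shows "f \<in> sos_cone k"
proof -
  define H where "H = (\<lambda>\<alpha> \<beta>. multinom \<alpha> * multinom \<beta> * ncoef (2 * k) f (\<alpha> + \<beta>))"
  have q: "bom (2 * k) f (\<lambda>x. (form_of k u x)\<^sup>2) = (\<Sum>\<alpha>\<in>exponents k. \<Sum>\<beta>\<in>exponents k. H \<alpha> \<beta> * u \<alpha> * u \<beta>)" for u
    unfolding bom_square[OF form_of_in_forms] H_def
    by (intro sum.cong refl) (simp add: ncoef_form_of)
  obtain m :: nat and l where l:
    "\<And>u. (\<Sum>\<alpha>\<in>exponents k. \<Sum>\<beta>\<in>exponents k. H \<alpha> \<beta> * u \<alpha> * u \<beta>) = (\<Sum>t<m. (\<Sum>\<alpha>\<in>exponents k. l t \<alpha> * u \<alpha>)\<^sup>2)"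
    using psd_form_sum_of_squares[OF finite_exponents, of H k] pos[OF form_of_in_forms]
    by (auto simp: q) (auto simp: H_def mult_ac add.commute)
  \<comment> \<open>Dividing by \<open>multinom \<alpha>\<close> undoes the weight in
    \<open>form_of\<close>, so \<open>g t y\<close> is the linear form \<open>l t\<close> at the
    monomials of y.\<close>
  define g where "g = (\<lambda>t. form_of k (\<lambda>\<alpha>. l t \<alpha> / multinom \<alpha>))"
  have "f y = (\<Sum>t<m. (g t y)\<^sup>2)" for y
  proof -
    have "f y = bom (2 * k) f (\<lambda>x. (form_of k (xpow y) x)\<^sup>2)"
      using bom_reproducing[OF f, of y] by (simp add: power_form[symmetric] mult.commute flip: power_mult)
    also have "\<dots> = (\<Sum>t<m. (\<Sum>\<alpha>\<in>exponents k. l t \<alpha> * xpow y \<alpha>)\<^sup>2)"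
      unfolding q by (rule l)
    also have "\<dots> = (\<Sum>t<m. (g t y)\<^sup>2)"
      by (simp add: g_def form_of_def less_imp_neq[THEN not_sym])
    finally show ?thesis .
  qed
  then have "f = (\<lambda>x. \<Sum>t<m. (g t x)\<^sup>2)" by auto
  moreover have "\<forall>t<m. g t \<in> forms k" by (simp add: g_def form_of_in_forms)
  ultimately show ?thesis using f by (auto simp: sos_cone_def)
qed

section \<open>Quadratic forms on nets and volume bounds from sign vectors\<close>

lemma sum_half_powers: "(\<Sum>z\<in>{- int R..int R}. (1 / 2 :: real) ^ nat \<bar>z\<bar>) = 3 - 2 * (1 / 2) ^ R"
proof (induction R)
  case (Suc R)
  have "{- int (Suc R)..int (Suc R)} = insert (- int (Suc R)) (insert (int (Suc R)) {- int R..int R})"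
    by auto
  then show ?case
    using Suc by (simp add: nat_add_distrib)
qed simp

text \<open>Points of a lattice of mesh \<open>1 / (4 * sqrt N)\<close> in the unit ball of \<open>\<real>\<^sup>N\<close>, where \<open>N = card J\<close>.\<close>
definition lattice_net :: "'j set \<Rightarrow> ('j \<Rightarrow> real) set" where
  "lattice_net J = (\<lambda>z i. real_of_int (z i) / (4 * sqrt (card J))) `
     {z \<in> J \<rightarrow>\<^sub>E {- int (16 * card J)..int (16 * card J)}. (\<Sum>i\<in>J. (z i)\<^sup>2) \<le> 16 * int (card J)}"

lemma finite_lattice_net: "finite J \<Longrightarrow> finite (lattice_net J)"
  by (auto simp: lattice_net_def intro!: finite_imageI finite_PiE)

lemma abs_le_square_int: "\<bar>z\<bar> \<le> z\<^sup>2" for z :: int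
proof (cases "z = 0")
  case False
  then have "\<bar>z\<bar> * 1 \<le> \<bar>z\<bar> * \<bar>z\<bar>"
    by (intro mult_left_mono) auto
  then show ?thesis by (simp add: power2_eq_square)
qed simp

text \<open>Integers satisfy |z| \<le> z^2, so every counted point has l1-norm at most R = 16 N and
  weight 2^R times the product of 2^(-|z i|) at least 1. Summed over the whole box these weights
  factor, and each coordinate contributes less than 3.\<close>

lemma card_lattice_net:
  assumes "finite J"
  shows "real (card (lattice_net J)) \<le> (3 * 2 ^ 16) ^ card J"
proof -
  define R where "R = 16 * card J"
  define P where "P = J \<rightarrow>\<^sub>E {- int R..int R}"
  define Z where "Z = {z \<in> P. (\<Sum>i\<in>J. (z i)\<^sup>2) \<le> 16 * int (card J)}"
  have fP: "finite P" unfolding P_def using assms by (auto intro: finite_PiE)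
  have Z1: "1 \<le> 2 ^ R * (\<Prod>i\<in>J. (1 / 2 :: real) ^ nat \<bar>z i\<bar>)" if "z \<in> Z" for z
  proof -
    have "int (\<Sum>i\<in>J. nat \<bar>z i\<bar>) \<le> (\<Sum>i\<in>J. (z i)\<^sup>2)"
      by (simp add: sum_mono abs_le_square_int)
    also have "\<dots> \<le> int R"
      using that by (simp add: Z_def R_def)
    finally have "(\<Sum>i\<in>J. nat \<bar>z i\<bar>) \<le> R" by (simp only: of_nat_le_iff)
    then have "(1 / 2 :: real) ^ R \<le> (1 / 2) ^ (\<Sum>i\<in>J. nat \<bar>z i\<bar>)"
      by (intro power_decreasing) auto
    then show ?thesis
      by (simp add: power_sum field_simps)
  qed
  have "real (card (lattice_net J)) \<le> real (card Z)"
  proof -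
    have "finite Z" using fP by (simp add: Z_def)
    moreover have "lattice_net J = (\<lambda>z i. real_of_int (z i) / (4 * sqrt (card J))) ` Z"
      by (simp add: lattice_net_def Z_def P_def R_def)
    ultimately show ?thesis by (simp add: card_image_le)
  qed
  also have "\<dots> = (\<Sum>z\<in>Z. 1)" by simp
  also have "\<dots> \<le> (\<Sum>z\<in>Z. 2 ^ R * (\<Prod>i\<in>J. (1 / 2 :: real) ^ nat \<bar>z i\<bar>))"
    by (rule sum_mono) (rule Z1)
  also have "\<dots> \<le> (\<Sum>z\<in>P. 2 ^ R * (\<Prod>i\<in>J. (1 / 2 :: real) ^ nat \<bar>z i\<bar>))"
    by (rule sum_mono2[OF fP]) (auto simp: Z_def intro!: mult_nonneg_nonneg prod_nonneg)
  also have "\<dots> = 2 ^ R * (\<Prod>i\<in>J. \<Sum>z\<in>{- int R..int R}. (1 / 2 :: real) ^ nat \<bar>z\<bar>)"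
    unfolding P_def sum_distrib_left[symmetric] using assms by (subst prod_sum_PiE) auto
  also have "\<dots> \<le> 2 ^ R * (\<Prod>i\<in>J. 3)"
  proof -
    have "(1 / 2 :: real) ^ R \<le> 1" by (simp add: power_le_one)
    then show ?thesis
      unfolding sum_half_powers by (intro mult_left_mono prod_mono) auto
  qed
  also have "\<dots> = (3 * 2 ^ 16) ^ card J"
    by (simp only: R_def power_mult power_mult_distrib prod_constant) (rule mult.commute)
  finally show ?thesis .
qed

lemma round_towards_zero: "\<exists>z::int. \<bar>real_of_int z\<bar> \<le> \<bar>r\<bar> \<and> \<bar>r - z\<bar> \<le> 1" for r :: real
proof (cases "r \<ge> 0")
  case True
  then have "real_of_int \<lfloor>r\<rfloor> \<ge> 0" by simp
  then show ?thesis by (intro exI[of _ "\<lfloor>r\<rfloor>"]) linarith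
next
  case False
  then have "real_of_int \<lceil>r\<rceil> \<le> 0" by simp
  then show ?thesis by (intro exI[of _ "\<lceil>r\<rceil>"]) linarith
qed

lemma lattice_net_norm:
  assumes "v \<in> lattice_net J" "finite J" "J \<noteq> {}"
  shows "(\<Sum>i\<in>J. (v i)\<^sup>2) \<le> 1"
proof -
  have c: "card J > 0" using assms by (simp add: card_gt_0_iff)
  from assms(1) obtain z where z: "v = (\<lambda>i. real_of_int (z i) / (4 * sqrt (card J)))"
      "(\<Sum>i\<in>J. (z i)\<^sup>2) \<le> 16 * int (card J)"
    by (auto simp: lattice_net_def)
  have "(\<Sum>i\<in>J. (v i)\<^sup>2) = real_of_int (\<Sum>i\<in>J. (z i)\<^sup>2) / (16 * card J)"
    by (simp add: z(1) power_divide power_mult_distrib sum_divide_distrib)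
  also have "\<dots> \<le> real_of_int (16 * int (card J)) / (16 * card J)"
    using z(2) by (intro divide_right_mono of_int_le_iff[THEN iffD2]) auto
  also have "\<dots> = 1" using c by simp
  finally show ?thesis .
qed

text \<open>Rounding towards zero does not increase any coordinate in absolute value, so the lattice
  point remains in the ball. Each coordinate moves by at most 1 / (4 sqrt N), which adds up to 1/16
  in the square.\<close>

lemma lattice_net_approx:
  assumes "finite J" "J \<noteq> {}" "(\<Sum>i\<in>J. (u i)\<^sup>2) \<le> 1"
  obtains v where "v \<in> lattice_net J" "(\<Sum>i\<in>J. (u i - v i)\<^sup>2) \<le> 1 / 16"
proof -
  define s where "s = 4 * sqrt (real (card J))"
  have c: "card J > 0" using assms by (simp add: card_gt_0_iff)
  then have s: "s > 0" "s\<^sup>2 = 16 * card J" by (auto simp: s_def power_mult_distrib)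
  obtain z :: "'a \<Rightarrow> int" where z: "\<And>i. \<bar>real_of_int (z i)\<bar> \<le> \<bar>s * u i\<bar>" "\<And>i. \<bar>s * u i - z i\<bar> \<le> 1"
    using choice[of "\<lambda>i z. \<bar>real_of_int z\<bar> \<le> \<bar>s * u i\<bar> \<and> \<bar>s * u i - real_of_int z\<bar> \<le> 1"]
      round_towards_zero by blast
  define z' where "z' = restrict z J"
  have "real_of_int (\<Sum>i\<in>J. (z i)\<^sup>2) = (\<Sum>i\<in>J. \<bar>real_of_int (z i)\<bar>\<^sup>2)"
    by simp
  also have "\<dots> \<le> (\<Sum>i\<in>J. \<bar>s * u i\<bar>\<^sup>2)"
    by (intro sum_mono power_mono z) auto
  also have "\<dots> = s\<^sup>2 * (\<Sum>i\<in>J. (u i)\<^sup>2)"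
    by (simp add: power_mult_distrib sum_distrib_left)
  also have "\<dots> \<le> s\<^sup>2 * 1"
    using assms by (intro mult_left_mono) auto
  also have "\<dots> = real_of_int (16 * int (card J))" by (simp add: s)
  finally have sq: "(\<Sum>i\<in>J. (z i)\<^sup>2) \<le> 16 * int (card J)"
    by (simp only: of_int_le_iff)
  have bnd: "- int (16 * card J) \<le> z i \<and> z i \<le> int (16 * card J)" if "i \<in> J" for i
  proof -
    have "(z i)\<^sup>2 \<le> (\<Sum>i\<in>J. (z i)\<^sup>2)"
      using assms(1) that by (intro member_le_sum) auto
    then show ?thesis using sq abs_le_square_int[of "z i"] by linarith
  qed
  then have "z' \<in> {z \<in> J \<rightarrow>\<^sub>E {- int (16 * card J)..int (16 * card J)}. (\<Sum>i\<in>J. (z i)\<^sup>2) \<le> 16 * int (card J)}"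
    using sq bnd by (auto simp: z'_def)
  then have "(\<lambda>i. real_of_int (z' i) / s) \<in> lattice_net J"
    unfolding lattice_net_def s_def by (rule imageI)
  moreover have "(\<Sum>i\<in>J. (u i - real_of_int (z' i) / s)\<^sup>2) \<le> (\<Sum>i\<in>J. (1 / s)\<^sup>2)"
  proof (rule sum_mono)
    fix i assume "i \<in> J"
    then have "u i - real_of_int (z' i) / s = (s * u i - z i) / s"
      using s by (simp add: z'_def diff_divide_distrib)
    then have "\<bar>u i - real_of_int (z' i) / s\<bar> \<le> 1 / s"
      using z(2)[of i] s by (simp add: abs_divide divide_right_mono)
    then show "(u i - real_of_int (z' i) / s)\<^sup>2 \<le> (1 / s)\<^sup>2"
      using power_mono[of "\<bar>u i - real_of_int (z' i) / s\<bar>" "1 / s" 2] by simp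
  qed
  moreover have "(\<Sum>i\<in>J. (1 / s)\<^sup>2) = 1 / 16"
    using c by (simp add: power_divide s)
  ultimately show ?thesis using that by metis
qed

text \<open>For \<open>\<bar>u - v\<bar> \<le> 1 / 4\<close> polarization bounds \<open>q u - q v\<close> by half of the norm of \<open>q\<close>.\<close>
lemma quadratic_form_le_net:
  fixes X :: "'j \<Rightarrow> 'j \<Rightarrow> real" and J :: "'j set"
  defines "q \<equiv> \<lambda>u. \<Sum>i\<in>J. \<Sum>j\<in>J. X i j * u i * u j"
  assumes J: "finite J" "J \<noteq> {}" and net: "\<And>v. v \<in> lattice_net J \<Longrightarrow> \<bar>q v\<bar> \<le> \<tau>"
  shows "\<bar>q u\<bar> \<le> 2 * \<tau> * (\<Sum>i\<in>J. (u i)\<^sup>2)"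
proof -
  define S where "S = {u :: 'j \<Rightarrow> real. (\<Sum>i\<in>J. (u i)\<^sup>2) \<le> 1}"
  define lam where "lam = (SUP u\<in>S. \<bar>q u\<bar>)"
  have qs: "q (\<lambda>i. c * u i) = c\<^sup>2 * q u" for c u
    by (simp add: q_def sum_distrib_left power2_eq_square mult_ac)
  have ns: "(\<Sum>i\<in>J. (c * u i)\<^sup>2) = c\<^sup>2 * (\<Sum>i\<in>J. (u i)\<^sup>2)" for c :: real and u
    by (simp add: sum_distrib_left power_mult_distrib)
  \<comment> \<open>Finiteness of the supremum \<open>lam\<close> is what later allows
    \<open>lam / 2\<close> to be absorbed.\<close>
  have bdd: "bdd_above ((\<lambda>u. \<bar>q u\<bar>) ` S)"
  proof (rule bdd_aboveI2)
    fix u assume u: "u \<in> S"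
    have 1: "\<bar>u i\<bar> \<le> 1" if "i \<in> J" for i
    proof -
      have "(u i)\<^sup>2 \<le> (\<Sum>i\<in>J. (u i)\<^sup>2)"
        using J(1) that by (intro member_le_sum) auto
      then show ?thesis using u by (simp add: S_def abs_square_le_1[symmetric])
    qed
    have "\<bar>q u\<bar> \<le> (\<Sum>i\<in>J. \<Sum>j\<in>J. \<bar>X i j * u i * u j\<bar>)"
      unfolding q_def by (intro order_trans[OF sum_abs] sum_mono sum_abs)
    also have "\<dots> \<le> (\<Sum>i\<in>J. \<Sum>j\<in>J. \<bar>X i j\<bar>)"
    proof (intro sum_mono)
      fix i j assume "i \<in> J" "j \<in> J"
      then have "\<bar>X i j\<bar> * (\<bar>u i\<bar> * \<bar>u j\<bar>) \<le> \<bar>X i j\<bar> * 1"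
        using 1 by (intro mult_left_mono) (auto simp: mult_le_one)
      then show "\<bar>X i j * u i * u j\<bar> \<le> \<bar>X i j\<bar>"
        by (simp add: abs_mult mult.assoc)
    qed
    finally show "\<bar>q u\<bar> \<le> (\<Sum>i\<in>J. \<Sum>j\<in>J. \<bar>X i j\<bar>)" .
  qed
  have le: "\<bar>q u\<bar> \<le> lam * (\<Sum>i\<in>J. (u i)\<^sup>2)" for u
  proof (cases "(\<Sum>i\<in>J. (u i)\<^sup>2) = 0")
    case True
    then have "u i = 0" if "i \<in> J" for i
      using J(1) that by (simp add: sum_nonneg_eq_0_iff)
    then have "q u = 0" by (simp add: q_def)
    then show ?thesis using True by simp
  next
    case False
    define c where "c = sqrt (\<Sum>i\<in>J. (u i)\<^sup>2)"
    have c: "c > 0" "c\<^sup>2 = (\<Sum>i\<in>J. (u i)\<^sup>2)"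
      using False by (auto simp: c_def sum_nonneg less_le)
    have "(\<lambda>i. 1 / c * u i) \<in> S"
      using c by (simp only: S_def mem_Collect_eq ns) (simp add: power_divide)
    then have "\<bar>q (\<lambda>i. 1 / c * u i)\<bar> \<le> lam"
      unfolding lam_def using bdd by (rule cSUP_upper)
    then have "\<bar>q u\<bar> / c\<^sup>2 \<le> lam"
      unfolding qs by (simp add: abs_mult power_divide)
    then show ?thesis
      unfolding c(2)[symmetric] using c(1) by (simp add: pos_divide_le_eq)
  qed
  have "\<bar>q u\<bar> \<le> \<tau> + lam / 2" if u: "u \<in> S" for u
  proof -
    from u obtain v where v: "v \<in> lattice_net J" "(\<Sum>i\<in>J. (u i - v i)\<^sup>2) \<le> 1 / 16"
      unfolding S_def using lattice_net_approx[OF J] by blast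
    \<comment> \<open>Balances the two parts: |u - v|^2 \<le> 1/16 multiplied by 8 and |u + v|^2
      \<le> 4 divided by 8 are both at most 1/2.\<close>
    define c where "c = sqrt 8"
    have c: "c > 0" "c\<^sup>2 = 8" "c * c = 8" by (auto simp: c_def)
    define a where "a = (\<lambda>i. c * (u i - v i))"
    define b where "b = (\<lambda>i. (1 / c) * (u i + v i))"
    have id: "4 * (u i * u j - v i * v j) = (a i + b i) * (a j + b j) - (a i - b i) * (a j - b j)" for i j
    proof -
      have "a i * b j = (u i - v i) * (u j + v j)" "b i * a j = (u i + v i) * (u j - v j)"
        using c by (auto simp: a_def b_def)
      moreover have "(a i + b i) * (a j + b j) - (a i - b i) * (a j - b j) = 2 * (a i * b j + b i * a j)"
        by (simp add: algebra_simps)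
      ultimately show ?thesis by (simp only:) (simp add: algebra_simps)
    qed
    have "4 * (q u - q v) = (\<Sum>i\<in>J. \<Sum>j\<in>J. X i j * (4 * (u i * u j - v i * v j)))"
      by (simp add: q_def sum_distrib_left sum_subtractf algebra_simps)
    also have "\<dots> = q (\<lambda>i. a i + b i) - q (\<lambda>i. a i - b i)"
      by (simp only: id) (simp only: q_def sum_subtractf[symmetric] right_diff_distrib mult.assoc)
    also have "\<bar>\<dots>\<bar> \<le> lam * (\<Sum>i\<in>J. (a i + b i)\<^sup>2) + lam * (\<Sum>i\<in>J. (a i - b i)\<^sup>2)"
      using le[of "\<lambda>i. a i + b i"] le[of "\<lambda>i. a i - b i"] by linarith
    also have "\<dots> = lam * (\<Sum>i\<in>J. (a i + b i)\<^sup>2 + (a i - b i)\<^sup>2)"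
      by (simp add: sum.distrib algebra_simps)
    also have "(\<Sum>i\<in>J. (a i + b i)\<^sup>2 + (a i - b i)\<^sup>2) = 2 * (c\<^sup>2 * (\<Sum>i\<in>J. (u i - v i)\<^sup>2) + (1 / c)\<^sup>2 * (\<Sum>i\<in>J. (u i + v i)\<^sup>2))"
      unfolding ns[symmetric] a_def b_def
      by (simp add: sum.distrib[symmetric] sum_distrib_left power2_sum power2_diff algebra_simps)
    also have "lam * \<dots> \<le> lam * 2"
    proof (rule mult_left_mono)
      have "(\<Sum>i\<in>J. (u i + v i)\<^sup>2) \<le> (\<Sum>i\<in>J. 2 * (u i)\<^sup>2 + 2 * (v i)\<^sup>2)"
      proof (rule sum_mono)
        fix i
        show "(u i + v i)\<^sup>2 \<le> 2 * (u i)\<^sup>2 + 2 * (v i)\<^sup>2"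
          using zero_le_power2[of "u i - v i"] by (simp add: power2_eq_square algebra_simps)
      qed
      also have "\<dots> = 2 * (\<Sum>i\<in>J. (u i)\<^sup>2) + 2 * (\<Sum>i\<in>J. (v i)\<^sup>2)"
        by (simp add: sum.distrib sum_distrib_left)
      also have "\<dots> \<le> 4"
        using u lattice_net_norm[OF v(1) J] by (simp add: S_def)
      finally show "2 * (c\<^sup>2 * (\<Sum>i\<in>J. (u i - v i)\<^sup>2) + (1 / c)\<^sup>2 * (\<Sum>i\<in>J. (u i + v i)\<^sup>2)) \<le> 2"
        using v(2) c by (simp add: power_divide)
      have "(\<lambda>_. 0) \<in> S" by (simp add: S_def)
      then have "\<bar>q (\<lambda>_. 0)\<bar> \<le> lam"
        unfolding lam_def using bdd by (rule cSUP_upper)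
      then show "lam \<ge> 0" by linarith
    qed
    finally have "\<bar>q u - q v\<bar> \<le> lam / 2"
      by (simp only: abs_mult) simp
    then show ?thesis
      using net[OF v(1)] by linarith
  qed
  then have "lam \<le> \<tau> + lam / 2"
    unfolding lam_def by (intro cSUP_least) (auto simp: S_def intro: exI[of _ "\<lambda>_. 0"])
  then have "lam \<le> 2 * \<tau>" by simp
  then show ?thesis
    using le[of u] mult_right_mono[of lam "2 * \<tau>" "\<Sum>i\<in>J. (u i)\<^sup>2"] by (simp add: sum_nonneg)
qed

section \<open>Volume bounds from averages over sign vectors\<close>

lemma nn_integral_exp_abs:
  fixes a :: real assumes "a > 0"
  shows "(\<integral>\<^sup>+x. ennreal (exp (- a * \<bar>x - x0\<bar>)) \<partial>lborel) \<le> ennreal (2 / a)"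
proof -
  have half: "(\<integral>\<^sup>+x. ennreal (exp (- a * x)) * indicator {0..} x \<partial>lborel) = ennreal (1 / a)"
  proof -
    have "(\<integral>\<^sup>+x. ennreal (exp (- a * x)) * indicator {0..} x \<partial>lborel) = ennreal (0 - (- exp (- a * 0) / a))"
    proof (rule nn_integral_FTC_atLeast)
      show "((\<lambda>x. - exp (- a * x) / a) has_real_derivative exp (- a * x)) (at x)" for x
        using assms by (auto intro!: derivative_eq_intros)
      have "((\<lambda>x. - exp (- a * x) / a) \<longlongrightarrow> - 0 / a) at_top"
      proof (intro tendsto_intros)
        have "filterlim (\<lambda>x. - (a * x)) at_bot at_top"
          unfolding filterlim_uminus_at_bot
          using assms filterlim_tendsto_pos_mult_at_top[OF tendsto_const assms filterlim_ident] by simp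
        then show "((\<lambda>x. exp (- a * x)) \<longlongrightarrow> 0) at_top"
          using filterlim_compose[OF exp_at_bot] by fastforce
      qed (use assms in auto)
      then show "((\<lambda>x. - exp (- a * x) / a) \<longlongrightarrow> 0) at_top" by simp
    qed auto
    then show ?thesis by simp
  qed
  have "(\<integral>\<^sup>+x. ennreal (exp (- a * \<bar>x - x0\<bar>)) \<partial>lborel) =
      (\<integral>\<^sup>+x. ennreal (exp (- a * \<bar>x\<bar>)) \<partial>lborel)"
    using nn_integral_real_affine[of "\<lambda>x. ennreal (exp (- a * \<bar>x - x0\<bar>))" 1 x0] by simp
  also have "\<dots> \<le> (\<integral>\<^sup>+x. ennreal (exp (- a * x)) * indicator {0..} x +
      ennreal (exp (- a * (- x))) * indicator {0..} (- x) \<partial>lborel)"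
    by (rule nn_integral_mono) (auto simp: indicator_def)
  also have "\<dots> = ennreal (1 / a) + (\<integral>\<^sup>+x. ennreal (exp (- a * (- x))) * indicator {0..} (- x) \<partial>lborel)"
    unfolding half[symmetric] by (rule nn_integral_add) auto
  also have "(\<integral>\<^sup>+x. ennreal (exp (- a * (- x))) * indicator {0..} (- x) \<partial>lborel) = ennreal (1 / a)"
  proof -
    define \<phi> where "\<phi> = (\<lambda>x. ennreal (exp (- a * x)) * indicator {0..} x)"
    have "(\<integral>\<^sup>+x. \<phi> x \<partial>lborel) = (\<integral>\<^sup>+x. \<phi> (- x) \<partial>lborel)"
      using nn_integral_real_affine[of \<phi> "-1" 0] by (simp add: \<phi>_def)
    then show ?thesis using half by (simp only: \<phi>_def)
  qed
  also have "ennreal (1 / a) + ennreal (1 / a) = ennreal (2 / a)"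
    using assms by (simp flip: ennreal_plus)
  finally show ?thesis .
qed

text \<open>A sign vector is encoded by the set of its positive coordinates, so averages over signs
  become sums over \<open>Pow I\<close>.\<close>

definition sgn_on :: "'i set \<Rightarrow> 'i \<Rightarrow> real" where
  "sgn_on S i = (if i \<in> S then 1 else -1)"

lemma sum_Pow_insert:
  assumes "finite I" "i \<notin> I"
  shows "(\<Sum>S\<in>Pow (insert i I). h S) = (\<Sum>S\<in>Pow I. h S + h (insert i S))"
proof -
  have "(\<Sum>S\<in>Pow (insert i I). h S) = (\<Sum>S\<in>Pow I. h S) + (\<Sum>S\<in>insert i ` Pow I. h S)"
    unfolding Pow_insert using assms by (intro sum.union_disjoint) auto
  also have "(\<Sum>S\<in>insert i ` Pow I. h S) = (\<Sum>S\<in>Pow I. h (insert i S))"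
    using assms by (subst sum.reindex) (auto simp: inj_on_def insert_ident subset_iff)
  finally show ?thesis by (simp add: sum.distrib)
qed

text \<open>A substitute for Urysohn's inequality in which the mean width is an average over sign vectors
  only.  In dimension one the two linear bounds for \<open>ln f\<close> cross at height \<open>(h {} + h {i}) / 2\<close>, and
  the inequality tensorizes because the integral over one coordinate again has the assumed form.\<close>
theorem nn_integral_sign_support_bound:
  fixes a :: real
  assumes "finite I" "a > 0" "f \<in> borel_measurable (\<Pi>\<^sub>M i\<in>I. lborel)"
    and "\<And>x S. x \<in> space (\<Pi>\<^sub>M i\<in>I. (lborel :: real measure)) \<Longrightarrow> S \<subseteq> I \<Longrightarrow>
      f x \<le> ennreal (exp (h S - a * (\<Sum>i\<in>I. sgn_on S i * x i)))"
  shows "(\<integral>\<^sup>+x. f x \<partial>(\<Pi>\<^sub>M i\<in>I. lborel)) \<le>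
    ennreal ((2 / a) ^ card I * exp ((\<Sum>S\<in>Pow I. h S) / 2 ^ card I))"
  using assms(1,3,4)
proof (induction I arbitrary: f h rule: finite_induct)
  case empty
  interpret product_sigma_finite "\<lambda>_. lborel :: real measure" ..
  have "f (\<lambda>x. undefined) \<le> ennreal (exp (h {}))"
    using empty(2)[of "\<lambda>x. undefined" "{}"] by (simp add: space_PiM)
  then show ?case
    by (simp add: PiM_empty nn_integral_count_space_finite)
next
  case (insert i I)
  interpret product_sigma_finite "\<lambda>_. lborel :: real measure" ..
  have [measurable]: "f \<in> borel_measurable (\<Pi>\<^sub>M i\<in>insert i I. lborel)" by fact
  define F where "F = (\<lambda>x. \<integral>\<^sup>+t. f (x(i := t)) \<partial>lborel)"
  \<comment> \<open>The logarithm of the one-dimensional bound: mean height of the two choices of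
    sign, plus the factor 2 / a from integrating the peak.\<close>
  define H where "H = (\<lambda>S. (h S + h (insert i S)) / 2 + ln (2 / a))"
  have F_meas: "F \<in> borel_measurable (\<Pi>\<^sub>M i\<in>I. lborel)"
    unfolding F_def by measurable
  have F_le: "F x \<le> ennreal (exp (H S - a * (\<Sum>j\<in>I. sgn_on S j * x j)))"
    if x: "x \<in> space (\<Pi>\<^sub>M i\<in>I. (lborel :: real measure))" and S: "S \<subseteq> I" for x S
  proof -
    define A B c where "A = h (insert i S)" "B = h S" "c = a * (\<Sum>j\<in>I. sgn_on S j * x j)"
    \<comment> \<open>The abscissa at which the rising and the falling bound meet.\<close>
    define x0 where "x0 = (A - B) / (2 * a)"
    have "f (x(i := t)) \<le> ennreal (exp ((A + B) / 2 - c) * exp (- a * \<bar>t - x0\<bar>))" for t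
    proof -
      have x': "x(i := t) \<in> space (\<Pi>\<^sub>M i\<in>insert i I. (lborel :: real measure))"
        using x by (auto simp: space_PiM PiE_def extensional_def)
      have "i \<notin> S" using S insert(2) by auto
      have "(\<Sum>j\<in>I. sgn_on (insert i S) j * (if j = i then t else x j)) = (\<Sum>j\<in>I. sgn_on S j * x j)"
        using insert(2) by (intro sum.cong) (auto simp: sgn_on_def)
      then have "a * (\<Sum>j\<in>insert i I. sgn_on (insert i S) j * (x(i := t)) j) = a * t + c"
        using insert(1,2) by (simp add: A_B_c_def sgn_on_def[of "insert i S" i] distrib_left)
      moreover have "f (x(i := t)) \<le>
          ennreal (exp (A - a * (\<Sum>j\<in>insert i I. sgn_on (insert i S) j * (x(i := t)) j)))"
        unfolding A_B_c_def using S by (intro insert.prems(2)[OF x']) auto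
      ultimately have "f (x(i := t)) \<le> ennreal (exp (A - c - a * t))"
        by (simp only: diff_diff_eq add.commute)
      moreover have "f (x(i := t)) \<le> ennreal (exp (B - c + a * t))"
      proof -
        have "(\<Sum>j\<in>I. sgn_on S j * (if j = i then t else x j)) = (\<Sum>j\<in>I. sgn_on S j * x j)"
          using insert(2) by (intro sum.cong) auto
        then have "a * (\<Sum>j\<in>insert i I. sgn_on S j * (x(i := t)) j) = c - a * t"
          using insert(1,2) \<open>i \<notin> S\<close> by (simp add: A_B_c_def sgn_on_def[of S i] right_diff_distrib)
        moreover have "f (x(i := t)) \<le>
            ennreal (exp (B - a * (\<Sum>j\<in>insert i I. sgn_on S j * (x(i := t)) j)))"
          unfolding A_B_c_def using S by (intro insert.prems(2)[OF x']) auto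
        ultimately show ?thesis
          by (simp only: diff_diff_eq2 add_diff_eq) (simp only: diff_add_eq)
      qed
      moreover have "A - c - a * t = (A + B) / 2 - c + - a * (t - x0)" "B - c + a * t = (A + B) / 2 - c + - a * (x0 - t)"
        using assms(2) by (auto simp: x0_def field_simps)
      ultimately have "f (x(i := t)) \<le> ennreal (exp ((A + B) / 2 - c + - a * \<bar>t - x0\<bar>))"
        by (auto simp only: abs_if split: if_splits) (simp_all only: minus_diff_eq)
      then show ?thesis
        by (simp only: exp_add)
    qed
    then have "F x \<le> (\<integral>\<^sup>+t. ennreal (exp ((A + B) / 2 - c)) * ennreal (exp (- a * \<bar>t - x0\<bar>)) \<partial>lborel)"
      unfolding F_def by (intro nn_integral_mono) (simp add: ennreal_mult[symmetric])
    also have "\<dots> = ennreal (exp ((A + B) / 2 - c)) * (\<integral>\<^sup>+t. ennreal (exp (- a * \<bar>t - x0\<bar>)) \<partial>lborel)"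
      by (rule nn_integral_cmult) simp
    also have "\<dots> \<le> ennreal (exp ((A + B) / 2 - c)) * ennreal (2 / a)"
      by (intro mult_left_mono nn_integral_exp_abs assms) simp
    also have "\<dots> = ennreal (exp (H S - c))"
      using assms(2) by (simp add: H_def A_B_c_def exp_diff exp_add add.commute mult_ac flip: ennreal_mult)
    finally show ?thesis by (simp add: A_B_c_def)
  qed
  have "(\<integral>\<^sup>+x. f x \<partial>(\<Pi>\<^sub>M i\<in>insert i I. lborel)) = (\<integral>\<^sup>+x. F x \<partial>(\<Pi>\<^sub>M i\<in>I. lborel))"
    unfolding F_def using insert by (intro product_nn_integral_insert) auto
  also have "\<dots> \<le> ennreal ((2 / a) ^ card I * exp ((\<Sum>S\<in>Pow I. H S) / 2 ^ card I))"
    by (rule insert.IH[OF F_meas F_le])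
  also have "(\<Sum>S\<in>Pow I. H S) / 2 ^ card I = (\<Sum>S\<in>Pow (insert i I). h S) / 2 ^ card (insert i I) + ln (2 / a)"
    unfolding sum_Pow_insert[OF insert(1,2)] using insert(1,2)
    by (simp add: H_def sum.distrib card_Pow add_divide_distrib sum_divide_distrib[symmetric])
  also have "(2 / a) ^ card I * exp ((\<Sum>S\<in>Pow (insert i I). h S) / 2 ^ card (insert i I) + ln (2 / a)) =
     (2 / a) ^ card (insert i I) * exp ((\<Sum>S\<in>Pow (insert i I). h S) / 2 ^ card (insert i I))"
    using assms(2) insert(1,2) by (simp add: exp_add)
  finally show ?case .
qed

text \<open>The function exp (-t^2 / 2) cosh t is 1 at 0 and does not increase for t \<ge> 0,
  because sinh t \<le> t cosh t there.\<close>

lemma cosh_le_exp_square: "(exp t + exp (- t)) / 2 \<le> exp (t\<^sup>2 / 2)" for t :: real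
proof -
  have sinh_le: "sinh t \<le> t * cosh t" if "t \<ge> 0" for t :: real
  proof -
    have "0 * cosh 0 - sinh 0 \<le> t * cosh t - sinh t"
    proof (rule DERIV_nonneg_imp_nondecreasing[OF that])
      fix x :: real assume "0 \<le> x" "x \<le> t"
      show "\<exists>y. ((\<lambda>t. t * cosh t - sinh t) has_real_derivative y) (at x) \<and> y \<ge> 0"
        using \<open>0 \<le> x\<close> by (intro exI[of _ "x * sinh x"]) (auto intro!: derivative_eq_intros)
    qed
    then show ?thesis by simp
  qed
  have main: "cosh t \<le> exp (t\<^sup>2 / 2)" if "t \<ge> 0" for t :: real
  proof -
    have "exp (- (0\<^sup>2 / 2)) * cosh 0 \<ge> exp (- (t\<^sup>2 / 2)) * cosh t"
    proof (rule DERIV_nonpos_imp_nonincreasing[OF that])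
      fix x :: real assume "0 \<le> x" "x \<le> t"
      have "((\<lambda>t. exp (- (t\<^sup>2 / 2)) * cosh t) has_real_derivative exp (- (x\<^sup>2 / 2)) * (sinh x - x * cosh x)) (at x)"
        by (auto intro!: derivative_eq_intros simp: algebra_simps)
      then show "\<exists>y. ((\<lambda>t. exp (- (t\<^sup>2 / 2)) * cosh t) has_real_derivative y) (at x) \<and> y \<le> 0"
        using sinh_le[OF \<open>0 \<le> x\<close>] by (auto simp: mult_le_0_iff)
    qed
    then show ?thesis by (simp add: exp_minus field_simps)
  qed
  have "cosh t \<le> exp (t\<^sup>2 / 2)"
    using main[of t] main[of "- t"] by (cases "t \<ge> 0") auto
  then show ?thesis by (simp add: cosh_field_def)
qed

text \<open>The subgaussian bound for a sum with independent random signs: the sum over all sign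
  patterns factors into terms exp (t i) + exp (- t i).\<close>

lemma sign_mgf_le:
  assumes "finite I"
  shows "(\<Sum>S\<in>Pow I. exp (\<Sum>i\<in>I. sgn_on S i * t i)) \<le> 2 ^ card I * exp ((\<Sum>i\<in>I. (t i)\<^sup>2) / 2)"
proof -
  have "(\<Sum>S\<in>Pow I. exp (\<Sum>i\<in>I. sgn_on S i * t i)) =
      (\<Sum>S\<in>Pow I. (\<Prod>i\<in>S. exp (t i)) * (\<Prod>i\<in>I - S. exp (- t i)))"
  proof (rule sum.cong[OF refl])
    fix S assume S: "S \<in> Pow I"
    have "exp (\<Sum>i\<in>I. sgn_on S i * t i) = (\<Prod>i\<in>I. exp (sgn_on S i * t i))"
      using assms by (rule exp_sum)
    also have "\<dots> = (\<Prod>i\<in>I - S. exp (sgn_on S i * t i)) * (\<Prod>i\<in>S. exp (sgn_on S i * t i))"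
      using S assms by (intro prod.subset_diff) auto
    finally show "exp (\<Sum>i\<in>I. sgn_on S i * t i) = (\<Prod>i\<in>S. exp (t i)) * (\<Prod>i\<in>I - S. exp (- t i))"
      by (simp add: sgn_on_def mult.commute)
  qed
  also have "\<dots> = (\<Prod>i\<in>I. exp (t i) + exp (- t i))"
    using assms by (rule prod_add[symmetric])
  also have "\<dots> \<le> (\<Prod>i\<in>I. 2 * exp ((t i)\<^sup>2 / 2))"
    using cosh_le_exp_square by (intro prod_mono) (auto simp: field_simps add_nonneg_nonneg)
  also have "\<dots> = 2 ^ card I * exp ((\<Sum>i\<in>I. (t i)\<^sup>2) / 2)"
    using assms by (simp add: prod.distrib exp_sum sum_divide_distrib)
  finally show ?thesis .
qed

section \<open>Gram-Schmidt and volume\<close>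

text \<open>The laws are required only on \<open>U\<close> because \<open>bom\<close> and
  \<open>form_inner\<close> obey them only on forms: \<open>ncoef\<close> is a choice outside them,
  and additivity of the integral needs integrability.\<close>

locale semi_inner =
  fixes U :: "('a \<Rightarrow> real) set" and ip :: "('a \<Rightarrow> real) \<Rightarrow> ('a \<Rightarrow> real) \<Rightarrow> real"
  assumes sub: "real_fun.subspace U"
    and add_left: "\<And>f g h. f \<in> U \<Longrightarrow> g \<in> U \<Longrightarrow> h \<in> U \<Longrightarrow> ip (\<lambda>x. f x + g x) h = ip f h + ip g h"
    and scale_left: "\<And>c f h. f \<in> U \<Longrightarrow> h \<in> U \<Longrightarrow> ip (\<lambda>x. c * f x) h = c * ip f h"
    and commute: "\<And>f g. f \<in> U \<Longrightarrow> g \<in> U \<Longrightarrow> ip f g = ip g f"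
    and nonneg: "\<And>f. f \<in> U \<Longrightarrow> ip f f \<ge> 0"
begin

lemma mem_add: "f \<in> U \<Longrightarrow> g \<in> U \<Longrightarrow> (\<lambda>x. f x + g x) \<in> U"
  using real_fun.subspace_add[OF sub, of f g] by (simp add: plus_fun_def)

lemma mem_scale: "f \<in> U \<Longrightarrow> (\<lambda>x. c * f x) \<in> U"
  using real_fun.subspace_scale[OF sub, of f c] by simp

lemma mem_zero: "(\<lambda>x. 0) \<in> U"
  using real_fun.subspace_0[OF sub] by (simp add: zero_fun_def)

lemma mem_sum: "(\<And>i. i \<in> A \<Longrightarrow> f i \<in> U) \<Longrightarrow> (\<lambda>x. \<Sum>i\<in>A. c i * f i x) \<in> U"
proof (induction A rule: infinite_finite_induct)
  case (insert a A)
  then have "(\<lambda>x. c a * f a x) \<in> U" "(\<lambda>x. \<Sum>i\<in>A. c i * f i x) \<in> U"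
    by (auto intro!: mem_scale)
  from mem_add[OF this] show ?case
    using insert(1,2) by simp
qed (simp_all add: mem_zero)

lemma zero_left: "h \<in> U \<Longrightarrow> ip (\<lambda>x. 0) h = 0"
  using scale_left[OF mem_zero, of h 0] by simp

lemma sum_left:
  "(\<And>i. i \<in> A \<Longrightarrow> f i \<in> U) \<Longrightarrow> h \<in> U \<Longrightarrow> ip (\<lambda>x. \<Sum>i\<in>A. c i * f i x) h = (\<Sum>i\<in>A. c i * ip (f i) h)"
proof (induction A rule: infinite_finite_induct)
  case (insert a A)
  have 1: "f a \<in> U" "(\<lambda>x. c a * f a x) \<in> U" "(\<lambda>x. \<Sum>i\<in>A. c i * f i x) \<in> U"
    using insert.prems by (auto intro!: mem_scale mem_sum)
  show ?case
    using add_left[OF 1(2,3) insert.prems(2)] scale_left[OF 1(1) insert.prems(2), of "c a"]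
      insert.IH[OF insert.prems] insert(1,2) by simp
qed (simp_all add: zero_left)

lemma sum_right:
  "(\<And>i. i \<in> A \<Longrightarrow> f i \<in> U) \<Longrightarrow> h \<in> U \<Longrightarrow> ip h (\<lambda>x. \<Sum>i\<in>A. c i * f i x) = (\<Sum>i\<in>A. c i * ip h (f i))"
proof -
  assume f: "\<And>i. i \<in> A \<Longrightarrow> f i \<in> U" and h: "h \<in> U"
  have "ip h (\<lambda>x. \<Sum>i\<in>A. c i * f i x) = ip (\<lambda>x. \<Sum>i\<in>A. c i * f i x) h"
    by (rule commute[OF h mem_sum[OF f]])
  also have "\<dots> = (\<Sum>i\<in>A. c i * ip (f i) h)"
    by (rule sum_left[OF f h])
  also have "\<dots> = (\<Sum>i\<in>A. c i * ip h (f i))"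
    by (intro sum.cong refl) (simp only: commute[OF f h])
  finally show ?thesis .
qed

lemma diff_left: "f \<in> U \<Longrightarrow> g \<in> U \<Longrightarrow> h \<in> U \<Longrightarrow> ip (\<lambda>x. f x - g x) h = ip f h - ip g h"
proof -
  assume f: "f \<in> U" "g \<in> U" "h \<in> U"
  show ?thesis
    using add_left[OF f(1) mem_scale[OF f(2), of "-1"] f(3)] scale_left[OF f(2,3), of "-1"] by simp
qed

lemma mem_diff: "f \<in> U \<Longrightarrow> g \<in> U \<Longrightarrow> (\<lambda>x. f x - g x) \<in> U"
  using real_fun.subspace_diff[OF sub, of f g] by (simp add: fun_diff_def)

lemma diff_right: "f \<in> U \<Longrightarrow> g \<in> U \<Longrightarrow> h \<in> U \<Longrightarrow> ip h (\<lambda>x. f x - g x) = ip h f - ip h g"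
  using diff_left[of f g h] commute[OF mem_diff[of f g], of h] commute[of f h] commute[of g h] by simp

lemma span_subset: "B \<subseteq> U \<Longrightarrow> real_fun.span B \<subseteq> U"
  by (rule real_fun.span_minimal[OF _ sub])

end

lemma lin_in_span: "finite B \<Longrightarrow> (\<lambda>x. \<Sum>b\<in>B. c b * b x) \<in> real_fun.span B"
proof (induction B rule: finite_induct)
  case empty
  show ?case using real_fun.span_zero[of "{}"] by (simp add: zero_fun_def)
next
  case (insert b B)
  have "(\<lambda>x. \<Sum>b\<in>B. c b * b x) \<in> real_fun.span (insert b B)"
    using insert.IH real_fun.span_mono[of B "insert b B"] by auto
  moreover have "(\<lambda>x. c b * b x) \<in> real_fun.span (insert b B)"
    by (intro real_fun.span_scale real_fun.span_base) simp
  ultimately have "(\<lambda>x. c b * b x) + (\<lambda>x. \<Sum>b\<in>B. c b * b x) \<in> real_fun.span (insert b B)"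
    by (rule real_fun.span_add[rotated])
  then show ?case
    using insert(1,2) by (simp add: plus_fun_def)
qed

lemma span_insertE:
  assumes "f \<in> real_fun.span (insert b B)"
  obtains c g where "g \<in> real_fun.span B" "f = (\<lambda>x. g x + c * b x)"
proof -
  from assms obtain c where "f - (\<lambda>x. c * b x) \<in> real_fun.span B"
    by (auto simp: real_fun.span_insert)
  then show ?thesis
    by (intro that[of "f - (\<lambda>x. c * b x)" c]) (auto simp: fun_eq_iff)
qed

text \<open>Removes the off-diagonal part of a triangular substitution, which acts as a translation
  once the newly added coordinate is fixed.\<close>

lemma nn_integral_PiM_translate:
  assumes "finite I" "F \<in> borel_measurable (\<Pi>\<^sub>M i\<in>I. (lborel :: real measure))"
  shows "(\<integral>\<^sup>+x. F (\<lambda>i\<in>I. x i + v i) \<partial>(\<Pi>\<^sub>M i\<in>I. lborel)) = (\<integral>\<^sup>+x. F x \<partial>(\<Pi>\<^sub>M i\<in>I. lborel))"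
proof -
  interpret product_sigma_finite "\<lambda>_. lborel :: real measure" ..
  let ?P = "\<Pi>\<^sub>M i\<in>I. (lborel :: real measure)"
  have T[measurable]: "(\<lambda>x. \<lambda>i\<in>I. x i + v i) \<in> measurable ?P ?P"
    by (rule measurable_restrict) measurable
  have "distr ?P ?P (\<lambda>x. \<lambda>i\<in>I. x i + v i) = ?P"
  proof (rule PiM_eqI[OF assms(1)])
    fix A :: "'a \<Rightarrow> real set" assume A: "\<And>i. i \<in> I \<Longrightarrow> A i \<in> sets lborel"
    have shift: "(\<lambda>t. t + v i) -` A i \<in> sets lborel" if "i \<in> I" for i
      using measurable_sets[of "\<lambda>t. t + v i" lborel lborel "A i"] A[OF that] by simp
    have "emeasure (distr ?P ?P (\<lambda>x. \<lambda>i\<in>I. x i + v i)) (Pi\<^sub>E I A) =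
        emeasure ?P ((\<lambda>x. \<lambda>i\<in>I. x i + v i) -` Pi\<^sub>E I A \<inter> space ?P)"
      using A assms(1) by (intro emeasure_distr T sets_PiM_I_finite) auto
    also have "(\<lambda>x. \<lambda>i\<in>I. x i + v i) -` Pi\<^sub>E I A \<inter> space ?P = Pi\<^sub>E I (\<lambda>i. (\<lambda>t. t + v i) -` A i)"
      by (auto simp: space_PiM PiE_iff)
    also have "emeasure ?P \<dots> = (\<Prod>i\<in>I. emeasure lborel ((\<lambda>t. t + v i) -` A i))"
      using shift assms(1) by (intro emeasure_PiM) auto
    also have "\<dots> = (\<Prod>i\<in>I. emeasure lborel (A i))"
    proof (rule prod.cong[OF refl])
      fix i assume "i \<in> I"
      then have "emeasure (distr lborel borel ((+) (v i))) (A i) = emeasure lborel ((\<lambda>t. t + v i) -` A i)"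
        using A by (subst emeasure_distr) (auto simp: add.commute vimage_def)
      then show "emeasure lborel ((\<lambda>t. t + v i) -` A i) = emeasure lborel (A i)"
        by (simp add: lborel_distr_plus)
    qed
    finally show "emeasure (distr ?P ?P (\<lambda>x. \<lambda>i\<in>I. x i + v i)) (Pi\<^sub>E I A) = (\<Prod>i\<in>I. emeasure lborel (A i))" .
  qed simp
  then have "(\<integral>\<^sup>+x. F x \<partial>?P) = (\<integral>\<^sup>+x. F x \<partial>distr ?P ?P (\<lambda>x. \<lambda>i\<in>I. x i + v i))"
    by simp
  also have "\<dots> = (\<integral>\<^sup>+x. F (\<lambda>i\<in>I. x i + v i) \<partial>?P)"
    using assms(2) by (intro nn_integral_distr T) auto
  finally show ?thesis by simp
qed

locale two_inner = semi_inner U ip + ip2: semi_inner U ip2 for U :: "('a \<Rightarrow> real) set" and ip ip2 +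
  assumes definite: "\<And>f. f \<in> U \<Longrightarrow> ip f f = 0 \<Longrightarrow> f = (\<lambda>x. 0)"
begin

lemma bessel:
  assumes "finite A" "\<And>a. a \<in> A \<Longrightarrow> e a \<in> U"
    and on: "\<And>a a'. a \<in> A \<Longrightarrow> a' \<in> A \<Longrightarrow> ip (e a) (e a') = (if a = a' then 1 else 0)" and f: "f \<in> U"
  shows "(\<Sum>a\<in>A. (ip f (e a))\<^sup>2) \<le> ip f f"
proof -
  define p where "p = (\<lambda>x. \<Sum>a\<in>A. ip f (e a) * e a x)"
  have pU: "p \<in> U" unfolding p_def using assms(2) by (intro mem_sum)
  have fp: "ip f p = (\<Sum>a\<in>A. (ip f (e a))\<^sup>2)"
    unfolding p_def power2_eq_square using assms(2) f by (intro sum_right)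
  have "ip p p = (\<Sum>a\<in>A. ip f (e a) * ip p (e a))"
    by (subst (2) p_def) (intro sum_right assms(2) pU)
  also have "\<dots> = ip f p"
    unfolding fp
  proof (rule sum.cong[OF refl])
    fix a assume a: "a \<in> A"
    have "ip p (e a) = (\<Sum>a'\<in>A. ip f (e a') * ip (e a') (e a))"
      unfolding p_def using assms(2) a by (intro sum_left)
    also have "\<dots> = (\<Sum>a'\<in>A. if a' = a then ip f (e a') else 0)"
      by (rule sum.cong) (auto simp: on a)
    finally show "ip f (e a) * ip p (e a) = (ip f (e a))\<^sup>2"
      using assms(1) a by (simp add: power2_eq_square)
  qed
  finally have pp: "ip p p = ip f p" .
  have "0 \<le> ip (\<lambda>x. f x - p x) (\<lambda>x. f x - p x)"
    by (intro nonneg mem_diff f pU)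
  also have "\<dots> = ip f f - ip f p"
    using f pU pp commute[OF pU f] by (simp add: diff_left diff_right mem_diff)
  finally show ?thesis by (simp add: fp)
qed

text \<open>When a vector b is added, \<open>s b\<close> is the reciprocal of its
  \<open>ip\<close>-distance from the span of the earlier ones, and also the coefficient of b in
  \<open>e b\<close>; these give the two bounds on \<open>s b\<close>. The last clause is the change
  of variables from coordinates in \<open>B\<close> to coordinates in \<open>e\<close>, a triangular
  map with diagonal entries \<open>1 / s b\<close>.\<close>

definition triangular_basis where
  "triangular_basis B e s \<longleftrightarrow>
    (\<forall>b\<in>B. e b \<in> real_fun.span B \<and> s b > 0 \<and> (s b)\<^sup>2 \<le> ip2 (e b) (e b) \<and> 1 \<le> (s b)\<^sup>2 * ip b b) \<and>
    (\<forall>b\<in>B. \<forall>b'\<in>B. ip (e b) (e b') = (if b = b' then 1 else 0)) \<and>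
    (\<forall>f\<in>real_fun.span B. f = (\<lambda>x. \<Sum>b\<in>B. ip f (e b) * e b x)) \<and>
    (\<forall>F\<in>borel_measurable (\<Pi>\<^sub>M b\<in>B. lborel).
      (\<integral>\<^sup>+c. F (\<lambda>b\<in>B. ip (\<lambda>x. \<Sum>b\<in>B. c b * b x) (e b)) \<partial>(\<Pi>\<^sub>M b\<in>B. (lborel :: real measure))) =
      ennreal (\<Prod>b\<in>B. s b) * (\<integral>\<^sup>+x. F x \<partial>(\<Pi>\<^sub>M b\<in>B. lborel)))"

text \<open>Gram-Schmidt turns the \<open>ip2\<close>-orthonormal family \<open>B\<close> into an \<open>ip\<close>-orthonormal family \<open>e\<close> by a
  triangular transformation with diagonal \<open>s\<close>.\<close>
lemma gram_schmidt:
  assumes "finite B" "B \<subseteq> U" "\<And>b b'. b \<in> B \<Longrightarrow> b' \<in> B \<Longrightarrow> ip2 b b' = (if b = b' then 1 else 0)"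
  shows "\<exists>e s. triangular_basis B e s"
  using assms
proof (induction B rule: finite_induct)
  case empty
  have "f = (\<lambda>x. 0)" if "f \<in> real_fun.span {}" for f :: "'a \<Rightarrow> real"
    using that by (simp add: zero_fun_def)
  then show ?case
    by (auto simp: triangular_basis_def PiM_empty nn_integral_count_space_finite restrict_def)
next
  case (insert b0 B)
  interpret product_sigma_finite "\<lambda>_. lborel :: real measure" ..
  let ?P = "\<Pi>\<^sub>M b\<in>B. (lborel :: real measure)"
  have BU: "B \<subseteq> U" and b0U: "b0 \<in> U" using insert.prems by auto
  obtain e s where gs: "triangular_basis B e s"
    using insert.IH[OF BU] insert.prems(2) by blast
  have e: "\<And>b. b \<in> B \<Longrightarrow> e b \<in> real_fun.span B" "\<And>b. b \<in> B \<Longrightarrow> s b > 0"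
      "\<And>b. b \<in> B \<Longrightarrow> (s b)\<^sup>2 \<le> ip2 (e b) (e b)" "\<And>b. b \<in> B \<Longrightarrow> 1 \<le> (s b)\<^sup>2 * ip b b"
    and on: "\<And>b b'. b \<in> B \<Longrightarrow> b' \<in> B \<Longrightarrow> ip (e b) (e b') = (if b = b' then 1 else 0)"
    and expand: "\<And>f. f \<in> real_fun.span B \<Longrightarrow> f = (\<lambda>x. \<Sum>b\<in>B. ip f (e b) * e b x)"
    and vol: "\<And>F. F \<in> borel_measurable ?P \<Longrightarrow>
      (\<integral>\<^sup>+c. F (\<lambda>b\<in>B. ip (\<lambda>x. \<Sum>b\<in>B. c b * b x) (e b)) \<partial>?P) = ennreal (\<Prod>b\<in>B. s b) * (\<integral>\<^sup>+x. F x \<partial>?P)"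
    using gs unfolding triangular_basis_def by blast+
  have eU: "e b \<in> U" if "b \<in> B" for b
    using e(1)[OF that] span_subset[OF BU] by auto
  define p where "p = (\<lambda>x. \<Sum>b\<in>B. ip b0 (e b) * e b x)"
  define d where "d = (\<lambda>x. b0 x - p x)"
  have pU: "p \<in> U" unfolding p_def by (intro mem_sum eU)
  have dU: "d \<in> U" unfolding d_def by (intro mem_diff b0U pU)
  have p_span: "p \<in> real_fun.span B"
  proof -
    have "p = (\<Sum>b\<in>B. (\<lambda>x. ip b0 (e b) * e b x))"
      by (auto simp: p_def fun_eq_iff sum_fun_apply)
    then show ?thesis
      using e(1) by (simp add: real_fun.span_sum real_fun.span_scale)
  qed
  have p_orth: "ip p (e b) = ip b0 (e b)" if "b \<in> B" for b
  proof -
    have "ip p (e b) = (\<Sum>b'\<in>B. ip b0 (e b') * ip (e b') (e b))"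
      unfolding p_def by (rule sum_left) (use eU that in auto)
    also have "\<dots> = (\<Sum>b'\<in>B. if b' = b then ip b0 (e b') else 0)"
      by (rule sum.cong) (auto simp: on that)
    finally show ?thesis using insert(1) that by simp
  qed
  have d_orth: "ip d (e b) = 0" if "b \<in> B" for b
    unfolding d_def using that by (simp add: diff_left b0U pU eU p_orth)
  have d_span: "ip d f = 0" if f: "f \<in> real_fun.span B" for f
    by (subst expand[OF f], subst sum_right) (auto simp: eU dU d_orth)
  have ip2_b0: "ip2 b0 f = 0" if f: "f \<in> real_fun.span B" for f
  proof -
    from f obtain u where "f = (\<Sum>b\<in>B. (\<lambda>x. u b * b x))"
      using insert(1) by (auto simp: real_fun.span_finite)
    then have f': "f = (\<lambda>x. \<Sum>b\<in>B. u b * b x)"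
      by (auto simp: fun_eq_iff sum_fun_apply)
    have "ip2 b0 f = (\<Sum>b\<in>B. u b * ip2 b0 b)"
      unfolding f' using BU b0U by (intro ip2.sum_right) auto
    also have "\<dots> = 0"
      using insert(2) insert.prems(2) by (intro sum.neutral) auto
    finally show ?thesis .
  qed
  \<comment> \<open>As b0 is \<open>ip2\<close>-orthogonal to the span of \<open>B\<close>,
    subtracting p can only increase its \<open>ip2\<close>-norm. This gives d \<noteq> 0 as well as
    the bound of \<open>(s b)\<^sup>2\<close> by \<open>ip2 (e b) (e b)\<close>.\<close>
  have ip2_d: "ip2 d d = 1 + ip2 p p"
  proof -
    have "ip2 d d = ip2 b0 b0 - ip2 b0 p - (ip2 p b0 - ip2 p p)"
      unfolding d_def using b0U pU by (simp add: ip2.diff_left ip2.diff_right ip2.mem_diff)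
    moreover have "ip2 b0 p = 0" "ip2 p b0 = 0"
      using ip2_b0[OF p_span] ip2.commute[OF pU b0U] by auto
    ultimately show ?thesis using insert.prems(2) by simp
  qed
  have dd: "ip d d > 0"
  proof (rule ccontr)
    assume "\<not> ip d d > 0"
    then have "d = (\<lambda>x. 0)" using nonneg[OF dU] definite[OF dU] by simp
    then have "ip2 d d = 0" using ip2.zero_left[OF ip2.mem_zero] by simp
    then show False using ip2_d ip2.nonneg[OF pU] by simp
  qed
  define t where "t = 1 / sqrt (ip d d)"
  have t: "t > 0" "t\<^sup>2 * ip d d = 1"
    using dd by (auto simp: t_def power_divide)
  define e' where "e' = e(b0 := (\<lambda>x. t * d x))"
  define s' where "s' = s(b0 := t)"
  have e'B: "e' b = e b" "s' b = s b" if "b \<in> B" for b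
    using that insert(2) by (auto simp: e'_def s'_def)
  have e'0: "e' b0 = (\<lambda>x. t * d x)" "s' b0 = t" by (auto simp: e'_def s'_def)
  have e'U: "e' b \<in> U" if "b \<in> insert b0 B" for b
    using that by (auto simp: e'0 e'B eU mem_scale dU)
  have span_mono: "real_fun.span B \<subseteq> real_fun.span (insert b0 B)"
    by (rule real_fun.span_mono) auto
  have C1: "e' b \<in> real_fun.span (insert b0 B) \<and> s' b > 0 \<and> (s' b)\<^sup>2 \<le> ip2 (e' b) (e' b) \<and> 1 \<le> (s' b)\<^sup>2 * ip b b"
    if "b \<in> insert b0 B" for b
  proof (cases "b = b0")
    case True
    have "b0 - p \<in> real_fun.span (insert b0 B)"
      using p_span span_mono real_fun.span_base[of b0 "insert b0 B"] by (intro real_fun.span_diff) auto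
    then have "d \<in> real_fun.span (insert b0 B)"
      by (simp add: d_def fun_diff_def)
    then have 1: "(\<lambda>x. t * d x) \<in> real_fun.span (insert b0 B)"
      by (rule real_fun.span_scale)
    have 2: "ip2 (\<lambda>x. t * d x) (\<lambda>x. t * d x) = t\<^sup>2 * ip2 d d"
      using ip2.scale_left[OF dU ip2.mem_scale[OF dU]] ip2.scale_left[OF dU dU]
        ip2.commute[OF dU ip2.mem_scale[OF dU]] by (simp add: power2_eq_square)
    have "ip b0 b0 = ip d d + ip p p"
    proof -
      have 0: "ip p d = 0" using d_span[OF p_span] commute[OF pU dU] by simp
      then have "ip p b0 = ip p p"
        using diff_right[OF b0U pU pU] by (simp add: d_def)
      moreover have "ip d d = ip b0 b0 - ip b0 p - (ip p b0 - ip p p)"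
        unfolding d_def using b0U pU by (simp add: diff_left diff_right mem_diff)
      ultimately show ?thesis using commute[OF b0U pU] by simp
    qed
    then have 3: "1 \<le> t\<^sup>2 * ip b0 b0"
      using t(2) nonneg[OF pU] by (simp add: distrib_left)
    show ?thesis
      unfolding True e'0 2 using 1 3 t(1) ip2_d ip2.nonneg[OF pU] by (simp add: distrib_left)
  next
    case False
    then have "b \<in> B" using that by simp
    then show ?thesis
      using e span_mono by (auto simp: e'B)
  qed
  have de': "ip (\<lambda>x. t * d x) (e b) = 0" "ip (e b) (\<lambda>x. t * d x) = 0" if "b \<in> B" for b
    using that d_orth by (auto simp: scale_left dU eU commute[OF eU mem_scale[OF dU]])
  have ttd: "ip (\<lambda>x. t * d x) (\<lambda>x. t * d x) = 1"
    using scale_left[OF dU mem_scale[OF dU]] scale_left[OF dU dU] commute[OF dU mem_scale[OF dU]] t(2)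
    by (simp add: power2_eq_square mult.assoc)
  have C2: "ip (e' b) (e' b') = (if b = b' then 1 else 0)" if "b \<in> insert b0 B" "b' \<in> insert b0 B" for b b'
    using that insert(2) by (auto simp: e'0 e'B on de' ttd)
  have coord0: "ip b0 (\<lambda>x. t * d x) = 1 / t"
  proof -
    have "ip d b0 = ip d d"
      using d_span[OF p_span] diff_right[OF b0U pU dU] by (simp add: d_def)
    then have "ip (\<lambda>x. t * d x) b0 = t * ip d d"
      using scale_left[OF dU b0U] by simp
    also have "\<dots> = 1 / t" using t by (simp add: field_simps power2_eq_square)
    finally show ?thesis using commute[OF b0U mem_scale[OF dU]] by simp
  qed
  have coord: "ip (\<lambda>x. g x + c * b0 x) (e' b0) = c / t"
    "\<And>b. b \<in> B \<Longrightarrow> ip (\<lambda>x. g x + c * b0 x) (e' b) = ip g (e b) + c * ip b0 (e b)"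
    if g: "g \<in> real_fun.span B" for g c
  proof -
    have gU: "g \<in> U" using g span_subset[OF BU] by auto
    have "ip g (\<lambda>x. t * d x) = 0"
      using d_span[OF g] commute[OF gU mem_scale[OF dU]] by (simp add: scale_left dU gU)
    then show "ip (\<lambda>x. g x + c * b0 x) (e' b0) = c / t"
      by (simp add: e'0 add_left[OF gU mem_scale[OF b0U] mem_scale[OF dU]] scale_left[OF b0U mem_scale[OF dU]] coord0)
    show "ip (\<lambda>x. g x + c * b0 x) (e' b) = ip g (e b) + c * ip b0 (e b)" if "b \<in> B" for b
      using that by (simp add: e'B add_left[OF gU mem_scale[OF b0U] eU] scale_left[OF b0U eU])
  qed
  have C3: "f = (\<lambda>x. \<Sum>b\<in>insert b0 B. ip f (e' b) * e' b x)" if f: "f \<in> real_fun.span (insert b0 B)" for f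
  proof
    fix x
    from f obtain g c where g: "g \<in> real_fun.span B" and f': "f = (\<lambda>x. g x + c * b0 x)"
      by (rule span_insertE)
    have "(\<Sum>b\<in>B. ip f (e' b) * e' b x) = (\<Sum>b\<in>B. ip g (e b) * e b x) + c * p x"
      unfolding p_def sum_distrib_left sum.distrib[symmetric] f'
    proof (rule sum.cong[OF refl])
      fix b assume "b \<in> B"
      then show "ip (\<lambda>x. g x + c * b0 x) (e' b) * e' b x = ip g (e b) * e b x + c * (ip b0 (e b) * e b x)"
        using coord(2)[OF g, of b c] by (simp add: e'B(1) distrib_right)
    qed
    moreover have "(\<Sum>b\<in>B. ip g (e b) * e b x) = g x"
      using fun_cong[OF expand[OF g], of x] by simp
    moreover have "ip f (e' b0) * e' b0 x = c * (b0 x - p x)"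
      unfolding f' coord(1)[OF g] using t by (simp add: e'0 d_def)
    ultimately show "f x = (\<Sum>b\<in>insert b0 B. ip f (e' b) * e' b x)"
      using insert(1,2) by (simp add: f' algebra_simps)
  qed
  have C4: "(\<integral>\<^sup>+c. F (\<lambda>b\<in>insert b0 B. ip (\<lambda>x. \<Sum>b\<in>insert b0 B. c b * b x) (e' b)) \<partial>(\<Pi>\<^sub>M b\<in>insert b0 B. (lborel :: real measure))) =
      ennreal (\<Prod>b\<in>insert b0 B. s' b) * (\<integral>\<^sup>+x. F x \<partial>(\<Pi>\<^sub>M b\<in>insert b0 B. lborel))"
    if F[measurable]: "F \<in> borel_measurable (\<Pi>\<^sub>M b\<in>insert b0 B. (lborel :: real measure))" for F
  proof -
    let ?P' = "\<Pi>\<^sub>M b\<in>insert b0 B. (lborel :: real measure)"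
    interpret P: sigma_finite_measure ?P by (rule sigma_finite[OF insert(1)])
    define v where "v = (\<lambda>b. ip b0 (e b))"
    define X where "X = (\<lambda>c. \<lambda>b\<in>B. ip (\<lambda>x. \<Sum>b\<in>B. c b * b x) (e b))"
    define Y where "Y = (\<lambda>c. \<lambda>b\<in>insert b0 B. ip (\<lambda>x. \<Sum>b\<in>insert b0 B. c b * b x) (e' b))"
    have Yc: "ip (\<lambda>x. \<Sum>b\<in>insert b0 B. c b * b x) (e' b) = (\<Sum>b'\<in>insert b0 B. c b' * ip b' (e' b))"
      if "b \<in> insert b0 B" for b c
      using insert.prems(1) e'U[OF that] by (intro sum_left) auto
    have [measurable]: "Y \<in> measurable ?P' ?P'"
      unfolding Y_def by (rule measurable_restrict) (simp only: Yc, measurable)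
    \<comment> \<open>With the new coordinate r fixed, the old ones are translated by r * v, which
      keeps their integral, and the new one becomes r / t. Integrating over r last contributes the
      factor t.\<close>
    have Y: "Y (c(b0 := r)) = (\<lambda>b\<in>B. X c b + r * v b)(b0 := r / t)" for c r
    proof -
      have "(\<Sum>b\<in>B. (if b = b0 then r else c b) * b x) = (\<Sum>b\<in>B. c b * b x)" for x
        using insert(2) by (intro sum.cong) auto
      then have f: "(\<lambda>x. \<Sum>b\<in>insert b0 B. (c(b0 := r)) b * b x) = (\<lambda>x. (\<Sum>b\<in>B. c b * b x) + r * b0 x)"
        using insert(1,2) by (simp add: add.commute)
      show ?thesis
      proof (rule ext)
        fix b
        show "Y (c(b0 := r)) b = ((\<lambda>b\<in>B. X c b + r * v b)(b0 := r / t)) b"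
          unfolding Y_def f X_def v_def restrict_def
          using insert(2) coord(1)[OF lin_in_span[OF insert(1)], of c r] coord(2)[OF lin_in_span[OF insert(1)], of b c r]
          by (cases "b = b0"; cases "b \<in> B") simp_all
      qed
    qed
    have "(\<integral>\<^sup>+c. F (Y c) \<partial>?P') = (\<integral>\<^sup>+r. (\<integral>\<^sup>+c. F (Y (c(b0 := r))) \<partial>?P) \<partial>lborel)"
      using insert(1,2) by (intro product_nn_integral_insert_rev) auto
    also have "\<dots> = (\<integral>\<^sup>+r. ennreal (\<Prod>b\<in>B. s b) * (\<integral>\<^sup>+x. F (x(b0 := r / t)) \<partial>?P) \<partial>lborel)"
    proof (rule nn_integral_cong)
      fix r :: real
      have m1: "(\<lambda>x. x(b0 := r / t)) \<in> measurable ?P ?P'"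
        by measurable
      have m2: "(\<lambda>x. \<lambda>b\<in>B. x b + r * v b) \<in> measurable ?P ?P"
        by (rule measurable_restrict) measurable
      have m: "(\<lambda>x. F ((\<lambda>b\<in>B. x b + r * v b)(b0 := r / t))) \<in> borel_measurable ?P"
        using measurable_compose[OF measurable_compose[OF m2 m1] F] .
      have m': "(\<lambda>x. F (x(b0 := r / t))) \<in> borel_measurable ?P"
        using measurable_compose[OF m1 F] .
      have "(\<integral>\<^sup>+c. F (Y (c(b0 := r))) \<partial>?P) =
          (\<integral>\<^sup>+c. (\<lambda>x. F ((\<lambda>b\<in>B. x b + r * v b)(b0 := r / t))) (X c) \<partial>?P)"
        by (simp add: Y)
      also have "\<dots> = ennreal (\<Prod>b\<in>B. s b) * (\<integral>\<^sup>+x. F ((\<lambda>b\<in>B. x b + r * v b)(b0 := r / t)) \<partial>?P)"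
        unfolding X_def by (rule vol[OF m])
      also have "(\<integral>\<^sup>+x. F ((\<lambda>b\<in>B. x b + r * v b)(b0 := r / t)) \<partial>?P) = (\<integral>\<^sup>+x. F (x(b0 := r / t)) \<partial>?P)"
        using nn_integral_PiM_translate[OF insert(1) m'] by simp
      finally show "(\<integral>\<^sup>+c. F (Y (c(b0 := r))) \<partial>?P) = ennreal (\<Prod>b\<in>B. s b) * (\<integral>\<^sup>+x. F (x(b0 := r / t)) \<partial>?P)" .
    qed
    also have "\<dots> = ennreal (\<Prod>b\<in>B. s b) * (\<integral>\<^sup>+r. (\<integral>\<^sup>+x. F (x(b0 := r / t)) \<partial>?P) \<partial>lborel)"
      by (rule nn_integral_cmult) measurable
    also have "(\<integral>\<^sup>+r. (\<integral>\<^sup>+x. F (x(b0 := r / t)) \<partial>?P) \<partial>lborel) = ennreal t * (\<integral>\<^sup>+r. (\<integral>\<^sup>+x. F (x(b0 := r)) \<partial>?P) \<partial>lborel)"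
    proof -
      define G where "G = (\<lambda>r. \<integral>\<^sup>+x. F (x(b0 := r)) \<partial>?P)"
      have "G \<in> borel_measurable borel"
        unfolding G_def by measurable
      then have "(\<integral>\<^sup>+r. G (r / t) \<partial>lborel) = ennreal t * (\<integral>\<^sup>+r. G r \<partial>lborel)"
        using nn_integral_real_affine[of "\<lambda>r. G (r / t)" t 0] t(1) by simp
      then show ?thesis by (simp add: G_def)
    qed
    also have "(\<integral>\<^sup>+r. (\<integral>\<^sup>+x. F (x(b0 := r)) \<partial>?P) \<partial>lborel) = (\<integral>\<^sup>+x. F x \<partial>?P')"
      using insert(1,2) by (intro product_nn_integral_insert_rev[symmetric]) auto
    finally have "(\<integral>\<^sup>+c. F (Y c) \<partial>?P') = ennreal (\<Prod>b\<in>B. s b) * (ennreal t * (\<integral>\<^sup>+x. F x \<partial>?P'))" .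
    moreover have "(\<Prod>b\<in>insert b0 B. s' b) = (\<Prod>b\<in>B. s b) * t"
      using insert(1,2) by (simp add: e'0 e'B mult.commute)
    moreover have "(\<Prod>b\<in>B. s b) \<ge> 0"
      using e(2) by (intro prod_nonneg) (auto intro: less_imp_le)
    ultimately show ?thesis
      using t(1) by (simp add: Y_def ennreal_mult mult.assoc)
  qed
  show ?case
    unfolding triangular_basis_def
    by (rule exI[of _ e'], rule exI[of _ s'], rule conjI[OF _ conjI[OF _ conjI]];
        (rule ballI, rule C1 | (rule ballI)+, rule C2 | rule ballI, rule C3 | rule ballI, rule C4); assumption)
qed

end

section \<open>Random signs, cubes and balls\<close>

text \<open>\<open>H\<close> is the smooth maximum obtained from \<open>ln y \<le> ln Z + y / Z - 1\<close>, so its average only involves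
  the exponential moments of the sign sums.\<close>
lemma sign_sum_le:
  fixes w :: "'v \<Rightarrow> 'b \<Rightarrow> real"
  assumes "finite B" "finite V" "V \<noteq> {}" "\<And>v. v \<in> V \<Longrightarrow> (\<Sum>b\<in>B. (w v b)\<^sup>2) \<le> 1" "t > 0"
  shows "\<exists>H. (\<forall>S. \<forall>v\<in>V. \<bar>\<Sum>b\<in>B. sgn_on S b * w v b\<bar> \<le> H S) \<and>
    (\<Sum>S\<in>Pow B. H S) / 2 ^ card B \<le> (ln (2 * card V) + t\<^sup>2 / 2) / t"
proof -
  define q where "q = (\<lambda>S v. \<Sum>b\<in>B. sgn_on S b * w v b)"
  \<comment> \<open>An upper bound for the mean of \<open>E\<close> over all signs, so the
    correction \<open>E S / Z - 1\<close> has nonpositive mean.\<close>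
  define Z where "Z = 2 * card V * exp (t\<^sup>2 / 2)"
  define E where "E = (\<lambda>S. \<Sum>v\<in>V. exp (t * q S v) + exp (- t * q S v))"
  define H where "H = (\<lambda>S. (ln Z + E S / Z - 1) / t)"
  have c: "card V > 0" using assms by (simp add: card_gt_0_iff)
  then have Z: "Z > 0" by (simp add: Z_def)
  have "\<bar>q S v\<bar> \<le> H S" if v: "v \<in> V" for S v
  proof -
    have "exp (t * \<bar>q S v\<bar>) \<le> exp (t * q S v) + exp (- t * q S v)"
      by (simp add: abs_if)
    also have "\<dots> \<le> E S"
      unfolding E_def using assms(2) v by (intro member_le_sum) (auto intro: add_nonneg_nonneg)
    finally have le: "exp (t * \<bar>q S v\<bar>) / Z \<le> E S / Z"
      using Z by (simp add: divide_right_mono)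
    have "t * \<bar>q S v\<bar> - ln Z = ln (exp (t * \<bar>q S v\<bar>) / Z)"
      using Z by (simp add: ln_div)
    also have "\<dots> \<le> exp (t * \<bar>q S v\<bar>) / Z - 1"
      using Z by (intro ln_le_minus_one) simp
    finally have "t * \<bar>q S v\<bar> \<le> ln Z + E S / Z - 1" using le by linarith
    then show ?thesis
      using assms(5) by (simp add: H_def pos_le_divide_eq mult.commute)
  qed
  moreover have "(\<Sum>S\<in>Pow B. H S) / 2 ^ card B \<le> ln Z / t"
  proof -
    have mgf: "(\<Sum>S\<in>Pow B. exp (s * q S v)) \<le> 2 ^ card B * exp (t\<^sup>2 / 2)"
      if "v \<in> V" "\<bar>s\<bar> = t" for s v
    proof -
      have "(\<Sum>S\<in>Pow B. exp (s * q S v)) \<le> 2 ^ card B * exp ((\<Sum>b\<in>B. (s * w v b)\<^sup>2) / 2)"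
        using sign_mgf_le[OF assms(1), of "\<lambda>b. s * w v b"]
        by (simp add: q_def sum_distrib_left mult.left_commute)
      also have "(\<Sum>b\<in>B. (s * w v b)\<^sup>2) = t\<^sup>2 * (\<Sum>b\<in>B. (w v b)\<^sup>2)"
        by (simp add: sum_distrib_left power_mult_distrib flip: that(2))
      also have "\<dots> \<le> t\<^sup>2 * 1"
        using assms(4)[OF that(1)] by (intro mult_left_mono) auto
      finally show ?thesis by simp
    qed
    have "(\<Sum>S\<in>Pow B. E S) = (\<Sum>v\<in>V. (\<Sum>S\<in>Pow B. exp (t * q S v)) + (\<Sum>S\<in>Pow B. exp (- t * q S v)))"
      unfolding E_def by (subst sum.swap) (simp add: sum.distrib)
    also have "\<dots> \<le> (\<Sum>v\<in>V. 2 ^ card B * exp (t\<^sup>2 / 2) + 2 ^ card B * exp (t\<^sup>2 / 2))"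
      using assms(5) by (intro sum_mono add_mono mgf) auto
    also have "\<dots> = 2 ^ card B * Z"
      by (simp add: Z_def)
    finally have "(\<Sum>S\<in>Pow B. E S) / Z \<le> 2 ^ card B"
      using Z by (simp add: pos_divide_le_eq)
    moreover have "(\<Sum>S\<in>Pow B. H S) = (2 ^ card B * (ln Z - 1) + (\<Sum>S\<in>Pow B. E S) / Z) / t"
      using assms(1) unfolding H_def
      by (simp add: sum_divide_distrib[symmetric] sum.distrib sum_subtractf card_Pow algebra_simps)
    ultimately have "(\<Sum>S\<in>Pow B. H S) \<le> (2 ^ card B * (ln Z - 1) + 2 ^ card B) / t"
      using assms(5) by (simp add: divide_right_mono)
    also have "\<dots> = 2 ^ card B * (ln Z / t)"
      by (simp add: algebra_simps)
    finally show ?thesis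
      by (simp add: pos_divide_le_eq mult.commute)
  qed
  moreover have "ln Z = ln (2 * card V) + t\<^sup>2 / 2"
    using c by (simp add: Z_def ln_mult)
  ultimately show ?thesis
    unfolding q_def by metis
qed

text \<open>Averaging over x and -x turns the exponential into cosh (c x), which is at most exp ((c
  a)^2 / 2) on the interval.\<close>

lemma nn_integral_exp_interval:
  fixes a c :: real assumes "a > 0"
  shows "(\<integral>\<^sup>+x. ennreal (exp (c * x)) * indicator {-a..a} x \<partial>lborel) \<le> ennreal (2 * a * exp ((c * a)\<^sup>2 / 2))"
proof -
  define f where "f = (\<lambda>x. ennreal (exp (c * x)) * indicator {-a..a} x)"
  have m: "f \<in> borel_measurable borel" unfolding f_def by measurable
  have "(\<integral>\<^sup>+x. f x \<partial>lborel) = (\<integral>\<^sup>+x. f (- x) \<partial>lborel)"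
    using nn_integral_real_affine[of f "-1" 0] m by simp
  then have "2 * (\<integral>\<^sup>+x. f x \<partial>lborel) = (\<integral>\<^sup>+x. f x + f (- x) \<partial>lborel)"
    using m by (subst nn_integral_add) (auto simp: mult_2)
  also have "\<dots> \<le> (\<integral>\<^sup>+x. ennreal (2 * exp ((c * a)\<^sup>2 / 2)) * indicator {-a..a} x \<partial>lborel)"
  proof (rule nn_integral_mono)
    fix x :: real
    show "f x + f (- x) \<le> ennreal (2 * exp ((c * a)\<^sup>2 / 2)) * indicator {-a..a} x"
    proof (cases "x \<in> {-a..a}")
      case True
      have "exp (c * x) + exp (- (c * x)) \<le> 2 * exp ((c * x)\<^sup>2 / 2)"
        using cosh_le_exp_square[of "c * x"] by simp
      also have "(c * x)\<^sup>2 \<le> (c * a)\<^sup>2"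
        using True assms by (simp add: power_mult_distrib abs_le_square_iff[symmetric] mult_left_mono abs_le_iff)
      finally have "exp (c * x) + exp (- (c * x)) \<le> 2 * exp ((c * a)\<^sup>2 / 2)"
        by (simp add: divide_right_mono)
      then show ?thesis
        using True by (simp add: f_def indicator_def flip: ennreal_plus)
    next
      case False
      then show ?thesis by (auto simp: f_def indicator_def)
    qed
  qed
  also have "\<dots> = ennreal (2 * exp ((c * a)\<^sup>2 / 2)) * ennreal (2 * a)"
    using assms by (simp add: nn_integral_cmult_indicator)
  also have "\<dots> = 2 * ennreal (2 * a * exp ((c * a)\<^sup>2 / 2))"
    using assms by (simp add: mult_ac flip: ennreal_mult ennreal_numeral)
  finally show ?thesis
    by (simp add: f_def ennreal_mult_le_mult_iff)
qed

section \<open>Cubes and balls in coordinate space\<close>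

abbreviation PiR :: "'b set \<Rightarrow> ('b \<Rightarrow> real) measure" where
  "PiR B \<equiv> \<Pi>\<^sub>M b\<in>B. lborel"

lemma space_PiR: "space (PiR B) = B \<rightarrow>\<^sub>E UNIV"
  by (simp add: space_PiM)

lemma emeasure_box:
  assumes "finite B" "a > 0"
  shows "emeasure (PiR B) (B \<rightarrow>\<^sub>E {-a..a}) = ennreal ((2 * a) ^ card B)"
proof -
  interpret product_sigma_finite "\<lambda>_. lborel :: real measure" ..
  show ?thesis
    using assms by (subst emeasure_PiM) (auto simp: prod_ennreal ennreal_power)
qed

lemma sets_box_Collect:
  assumes "finite B" "{x \<in> space (PiR B). P x} \<in> sets (PiR B)"
  shows "{x \<in> B \<rightarrow>\<^sub>E {-a..a::real}. P x} \<in> sets (PiR B)"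
proof -
  have "{x \<in> B \<rightarrow>\<^sub>E {-a..a}. P x} = (B \<rightarrow>\<^sub>E {-a..a}) \<inter> {x \<in> space (PiR B). P x}"
    by (auto simp: space_PiR PiE_iff extensional_def)
  also have "\<dots> \<in> sets (PiR B)"
    using assms by (intro sets.Int sets_PiM_I_finite) auto
  finally show ?thesis .
qed

text \<open>Chernoff's method with rate s / a: the indicator is bounded by an exponential of the
  linear form, whose integral over the cube factors.\<close>

lemma box_tail_le:
  fixes w :: "'b \<Rightarrow> real"
  assumes "finite B" "a > 0" "(\<Sum>b\<in>B. (w b)\<^sup>2) \<le> 1" "s > 0"
  shows "emeasure (PiR B) {x \<in> B \<rightarrow>\<^sub>E {-a..a}. (\<Sum>b\<in>B. x b * w b) > \<tau>} \<le>
    ennreal ((2 * a) ^ card B * exp (s\<^sup>2 / 2 - s * \<tau> / a))"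
proof -
  interpret product_sigma_finite "\<lambda>_. lborel :: real measure" ..
  let ?A = "{x \<in> B \<rightarrow>\<^sub>E {-a..a}. (\<Sum>b\<in>B. x b * w b) > \<tau>}"
  define r where "r = s / a"
  have A: "?A \<in> sets (PiR B)"
    by (rule sets_box_Collect[OF assms(1)]) measurable
  have "emeasure (PiR B) ?A = (\<integral>\<^sup>+x. indicator ?A x \<partial>PiR B)"
    using A by simp
  also have "\<dots> \<le> (\<integral>\<^sup>+x. ennreal (exp (- r * \<tau>)) * (\<Prod>b\<in>B. ennreal (exp (r * w b * x b)) * indicator {-a..a} (x b)) \<partial>PiR B)"
  proof (rule nn_integral_mono)
    fix x assume "x \<in> space (PiR B)"
    show "indicator ?A x \<le> ennreal (exp (- r * \<tau>)) * (\<Prod>b\<in>B. ennreal (exp (r * w b * x b)) * indicator {-a..a} (x b))"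
    proof (cases "x \<in> ?A")
      case True
      then have "(\<Prod>b\<in>B. ennreal (exp (r * w b * x b)) * indicator {-a..a} (x b)) = (\<Prod>b\<in>B. ennreal (exp (r * w b * x b)))"
        by (intro prod.cong) (auto simp: indicator_def PiE_iff)
      also have "\<dots> = ennreal (exp (r * (\<Sum>b\<in>B. x b * w b)))"
        using assms(1) by (simp add: prod_ennreal exp_sum sum_distrib_left mult_ac)
      finally have "ennreal (exp (- r * \<tau>)) * (\<Prod>b\<in>B. ennreal (exp (r * w b * x b)) * indicator {-a..a} (x b)) =
          ennreal (exp (r * ((\<Sum>b\<in>B. x b * w b) - \<tau>)))"
        by (simp only: ennreal_mult'[OF exp_ge_zero, symmetric] exp_add[symmetric]) (simp add: right_diff_distrib)
      moreover have "exp (r * ((\<Sum>b\<in>B. x b * w b) - \<tau>)) \<ge> 1"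
        using True assms by (simp add: r_def)
      ultimately show ?thesis using True by simp
    qed simp
  qed
  also have "\<dots> = ennreal (exp (- r * \<tau>)) * (\<Prod>b\<in>B. \<integral>\<^sup>+x. ennreal (exp (r * w b * x)) * indicator {-a..a} x \<partial>lborel)"
  proof -
    have "(\<lambda>x. \<Prod>b\<in>B. ennreal (exp (r * w b * x b)) * indicator {-a..a} (x b)) \<in> borel_measurable (PiR B)"
      by measurable
    moreover have "(\<integral>\<^sup>+x. (\<Prod>b\<in>B. ennreal (exp (r * w b * x b)) * indicator {-a..a} (x b)) \<partial>PiR B) =
        (\<Prod>b\<in>B. \<integral>\<^sup>+x. ennreal (exp (r * w b * x)) * indicator {-a..a} x \<partial>lborel)"
      by (rule product_nn_integral_prod[OF assms(1)]) simp
    ultimately show ?thesis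
      by (simp only: nn_integral_cmult)
  qed
  also have "\<dots> \<le> ennreal (exp (- r * \<tau>)) * (\<Prod>b\<in>B. ennreal (2 * a * exp ((r * w b * a)\<^sup>2 / 2)))"
    using nn_integral_exp_interval[OF assms(2)] by (intro mult_left_mono prod_mono_ennreal) auto
  also have "\<dots> = ennreal (exp (- r * \<tau>) * (\<Prod>b\<in>B. 2 * a * exp ((r * w b * a)\<^sup>2 / 2)))"
  proof -
    have "(\<Prod>b\<in>B. ennreal (2 * a * exp ((r * w b * a)\<^sup>2 / 2))) = ennreal (\<Prod>b\<in>B. 2 * a * exp ((r * w b * a)\<^sup>2 / 2))"
      using assms(2) by (intro prod_ennreal) simp
    then show ?thesis
      by (simp only: ennreal_mult'[OF exp_ge_zero])
  qed
  also have "\<dots> \<le> ennreal ((2 * a) ^ card B * exp (s\<^sup>2 / 2 - s * \<tau> / a))"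
  proof (rule ennreal_leI)
    have "(\<Prod>b\<in>B. 2 * a * exp ((r * w b * a)\<^sup>2 / 2)) = (2 * a) ^ card B * exp (\<Sum>b\<in>B. (r * w b * a)\<^sup>2 / 2)"
      using assms(1) by (simp add: prod.distrib exp_sum)
    also have "(\<Sum>b\<in>B. (r * w b * a)\<^sup>2 / 2) = s\<^sup>2 / 2 * (\<Sum>b\<in>B. (w b)\<^sup>2)"
      using assms(2) by (simp add: r_def sum_distrib_left power_mult_distrib power_divide)
    also have "\<dots> \<le> s\<^sup>2 / 2 * 1"
      using assms(3) by (intro mult_left_mono) auto
    finally have "(\<Prod>b\<in>B. 2 * a * exp ((r * w b * a)\<^sup>2 / 2)) \<le> (2 * a) ^ card B * exp (s\<^sup>2 / 2)"
      using assms(2) by simp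
    then have "exp (- r * \<tau>) * (\<Prod>b\<in>B. 2 * a * exp ((r * w b * a)\<^sup>2 / 2)) \<le>
        exp (- r * \<tau>) * ((2 * a) ^ card B * exp (s\<^sup>2 / 2))"
      by (intro mult_left_mono) auto
    also have "\<dots> = (2 * a) ^ card B * exp (s\<^sup>2 / 2 - s * \<tau> / a)"
    proof -
      have "s\<^sup>2 / 2 - s * \<tau> / a = - r * \<tau> + s\<^sup>2 / 2" by (simp add: r_def)
      then have "exp (s\<^sup>2 / 2 - s * \<tau> / a) = exp (- r * \<tau>) * exp (s\<^sup>2 / 2)"
        by (simp only: exp_add)
      then show ?thesis by (simp only: mult.left_commute)
    qed
    finally show "exp (- r * \<tau>) * (\<Prod>b\<in>B. 2 * a * exp ((r * w b * a)\<^sup>2 / 2)) \<le> (2 * a) ^ card B * exp (s\<^sup>2 / 2 - s * \<tau> / a)" .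
  qed
  finally show ?thesis .
qed

text \<open>A union bound over 2 * \<open>card V\<close> tails, of which each takes at most the
  fraction 1 / (4 * \<open>card V\<close>) of the cube.\<close>

lemma box_good_set:
  fixes w :: "'v \<Rightarrow> 'b \<Rightarrow> real"
  assumes "finite B" "finite V" "a > 0" "s > 0" "\<And>v. v \<in> V \<Longrightarrow> (\<Sum>b\<in>B. (w v b)\<^sup>2) \<le> 1"
    and small: "4 * card V * exp (s\<^sup>2 / 2 - s * \<tau> / a) \<le> 1"
  defines "G \<equiv> {x \<in> B \<rightarrow>\<^sub>E {-a..a}. \<forall>v\<in>V. \<bar>\<Sum>b\<in>B. x b * w v b\<bar> \<le> \<tau>}"
  shows "G \<in> sets (PiR B)" "emeasure (PiR B) G \<ge> ennreal ((2 * a) ^ card B / 2)"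
proof -
  let ?box = "B \<rightarrow>\<^sub>E {-a..a}"
  define K where "K = (\<lambda>w'. {x \<in> ?box. (\<Sum>b\<in>B. x b * w' b) > \<tau>})"
  define \<epsilon> where "\<epsilon> = (2 * a) ^ card B * exp (s\<^sup>2 / 2 - s * \<tau> / a)"
  have \<epsilon>0: "\<epsilon> \<ge> 0" using assms(3) by (simp add: \<epsilon>_def)
  show G: "G \<in> sets (PiR B)"
    unfolding G_def
  proof (intro sets_box_Collect sets.sets_Collect_finite_All assms(1,2))
    show "{x \<in> space (PiR B). \<bar>\<Sum>b\<in>B. x b * w v b\<bar> \<le> \<tau>} \<in> sets (PiR B)" for v
      by measurable
  qed
  have K: "K w' \<in> sets (PiR B)" for w'
    unfolding K_def by (rule sets_box_Collect[OF assms(1)]) measurable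
  have tail: "emeasure (PiR B) (K (w v)) \<le> ennreal \<epsilon>" "emeasure (PiR B) (K (\<lambda>b. - w v b)) \<le> ennreal \<epsilon>"
    if "v \<in> V" for v
  proof -
    show "emeasure (PiR B) (K (w v)) \<le> ennreal \<epsilon>"
      unfolding K_def \<epsilon>_def by (rule box_tail_le[OF assms(1,3) assms(5)[OF that] assms(4)])
    have "(\<Sum>b\<in>B. (- w v b)\<^sup>2) \<le> 1"
      using assms(5)[OF that] by simp
    then show "emeasure (PiR B) (K (\<lambda>b. - w v b)) \<le> ennreal \<epsilon>"
      unfolding K_def \<epsilon>_def by (rule box_tail_le[OF assms(1,3) _ assms(4)])
  qed
  have U: "(\<Union>v\<in>V. K (w v) \<union> K (\<lambda>b. - w v b)) \<in> sets (PiR B)"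
    using K assms(2) by (intro sets.finite_UN sets.Un) auto
  have "?box \<subseteq> G \<union> (\<Union>v\<in>V. K (w v) \<union> K (\<lambda>b. - w v b))"
  proof
    fix x assume x: "x \<in> ?box"
    show "x \<in> G \<union> (\<Union>v\<in>V. K (w v) \<union> K (\<lambda>b. - w v b))"
    proof (cases "x \<in> G")
      case False
      then obtain v where v: "v \<in> V" "\<not> \<bar>\<Sum>b\<in>B. x b * w v b\<bar> \<le> \<tau>"
        using x unfolding G_def by blast
      then have "(\<Sum>b\<in>B. x b * w v b) > \<tau> \<or> (\<Sum>b\<in>B. x b * (- w v b)) > \<tau>"
        by (simp add: sum_negf) linarith
      then have "x \<in> K (w v) \<union> K (\<lambda>b. - w v b)"
        using x unfolding K_def by blast
      then show ?thesis using v(1) by blast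
    qed simp
  qed
  then have "emeasure (PiR B) ?box \<le> emeasure (PiR B) (G \<union> (\<Union>v\<in>V. K (w v) \<union> K (\<lambda>b. - w v b)))"
    using G U by (intro emeasure_mono) auto
  also have "\<dots> \<le> emeasure (PiR B) G + emeasure (PiR B) (\<Union>v\<in>V. K (w v) \<union> K (\<lambda>b. - w v b))"
    using G U by (intro emeasure_subadditive) auto
  also have "emeasure (PiR B) (\<Union>v\<in>V. K (w v) \<union> K (\<lambda>b. - w v b)) \<le> (\<Sum>v\<in>V. emeasure (PiR B) (K (w v) \<union> K (\<lambda>b. - w v b)))"
    using K assms(2) by (intro emeasure_subadditive_finite) auto
  also have "\<dots> \<le> (\<Sum>v\<in>V. ennreal \<epsilon> + ennreal \<epsilon>)"
  proof (rule sum_mono)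
    fix v assume "v \<in> V"
    have "emeasure (PiR B) (K (w v) \<union> K (\<lambda>b. - w v b)) \<le> emeasure (PiR B) (K (w v)) + emeasure (PiR B) (K (\<lambda>b. - w v b))"
      by (rule emeasure_subadditive[OF K K])
    also have "\<dots> \<le> ennreal \<epsilon> + ennreal \<epsilon>"
      by (rule add_mono[OF tail[OF \<open>v \<in> V\<close>]])
    finally show "emeasure (PiR B) (K (w v) \<union> K (\<lambda>b. - w v b)) \<le> ennreal \<epsilon> + ennreal \<epsilon>" .
  qed
  also have "\<dots> = ennreal (card V * (2 * \<epsilon>))"
  proof -
    have "ennreal \<epsilon> + ennreal \<epsilon> = ennreal (2 * \<epsilon>)"
      using \<epsilon>0 by (simp flip: ennreal_plus)
    then show ?thesis
      using \<epsilon>0 by (simp only: sum_constant ennreal_of_nat_eq_real_of_nat ennreal_mult' of_nat_0_le_iff)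
  qed
  also have "\<dots> \<le> ennreal ((2 * a) ^ card B / 2)"
  proof (rule ennreal_leI)
    have "(2 * a) ^ card B * (4 * card V * exp (s\<^sup>2 / 2 - s * \<tau> / a)) \<le> (2 * a) ^ card B * 1"
      using small assms(3) by (intro mult_left_mono) auto
    then show "card V * (2 * \<epsilon>) \<le> (2 * a) ^ card B / 2"
      by (simp add: \<epsilon>_def mult_ac)
  qed
  finally have le: "ennreal ((2 * a) ^ card B) \<le> emeasure (PiR B) G + ennreal ((2 * a) ^ card B / 2)"
    unfolding emeasure_box[OF assms(1,3)] by (simp add: add_left_mono)
  have c: "(2 * a) ^ card B \<ge> 0" using assms(3) by simp
  show "emeasure (PiR B) G \<ge> ennreal ((2 * a) ^ card B / 2)"
  proof (cases "emeasure (PiR B) G")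
    case (real x)
    then have "ennreal ((2 * a) ^ card B) \<le> ennreal (x + (2 * a) ^ card B / 2)"
      using le c by (subst ennreal_plus) auto
    then have "(2 * a) ^ card B \<le> x + (2 * a) ^ card B / 2"
      using real c by (subst (asm) ennreal_le_iff) auto
    then show ?thesis
      unfolding real by (intro ennreal_leI) linarith
  qed simp
qed

lemma unit_ball_sets: "finite B \<Longrightarrow> {x \<in> B \<rightarrow>\<^sub>E UNIV. (\<Sum>b\<in>B. (x b)\<^sup>2) \<le> 1} \<in> sets (PiR B)"
proof -
  assume "finite B"
  have "{x \<in> B \<rightarrow>\<^sub>E UNIV. (\<Sum>b\<in>B. (x b)\<^sup>2) \<le> 1} = {x \<in> space (PiR B). (\<Sum>b\<in>B. (x b)\<^sup>2) \<le> 1}"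
    by (simp add: space_PiR)
  also have "\<dots> \<in> sets (PiR B)"
    by measurable
  finally show ?thesis .
qed

text \<open>Sign vectors have length sqrt D, which bounds the support function of the ball in their
  directions. With a = sqrt D the constant choice h = D is admissible in
  \<open>nn_integral_sign_support_bound\<close>.\<close>

lemma emeasure_unit_ball_le:
  assumes "finite B" "B \<noteq> {}"
  shows "emeasure (PiR B) {x \<in> B \<rightarrow>\<^sub>E UNIV. (\<Sum>b\<in>B. (x b)\<^sup>2) \<le> 1} \<le>
    ennreal ((2 * exp 1 / sqrt (card B)) ^ card B)"
proof -
  let ?A = "{x \<in> B \<rightarrow>\<^sub>E UNIV. (\<Sum>b\<in>B. (x b)\<^sup>2) \<le> (1::real)}"
  define D where "D = real (card B)"
  have D: "D > 0" using assms by (simp add: D_def card_gt_0_iff)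
  have "emeasure (PiR B) ?A = (\<integral>\<^sup>+x. indicator ?A x \<partial>PiR B)"
    using unit_ball_sets[OF assms(1)] by simp
  also have "\<dots> \<le> ennreal ((2 / sqrt D) ^ card B * exp ((\<Sum>S\<in>Pow B. D) / 2 ^ card B))"
  proof (rule nn_integral_sign_support_bound)
    show "indicator ?A \<in> borel_measurable (PiR B)"
      using unit_ball_sets[OF assms(1)] by simp
    fix x S assume "x \<in> space (PiR B)"
    show "indicator ?A x \<le> ennreal (exp (D - sqrt D * (\<Sum>i\<in>B. sgn_on S i * x i)))"
    proof (cases "x \<in> ?A")
      case True
      have "(\<Sum>i\<in>B. sgn_on S i * x i)\<^sup>2 \<le> (\<Sum>i\<in>B. (sgn_on S i)\<^sup>2) * (\<Sum>i\<in>B. (x i)\<^sup>2)"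
        by (rule Cauchy_Schwarz_ineq_sum)
      also have "(\<Sum>i\<in>B. (sgn_on S i)\<^sup>2) = D"
        by (simp add: sgn_on_def D_def if_distrib[of "\<lambda>x. x\<^sup>2"] cong: if_cong)
      also have "D * (\<Sum>i\<in>B. (x i)\<^sup>2) \<le> D * 1"
        using True D by (intro mult_left_mono) auto
      finally have "\<bar>\<Sum>i\<in>B. sgn_on S i * x i\<bar> \<le> sqrt D"
        using real_le_rsqrt[of "\<bar>\<Sum>i\<in>B. sgn_on S i * x i\<bar>" D] by simp
      then have "sqrt D * (\<Sum>i\<in>B. sgn_on S i * x i) \<le> sqrt D * sqrt D"
        using D by (intro mult_left_mono) auto
      then have "exp (D - sqrt D * (\<Sum>i\<in>B. sgn_on S i * x i)) \<ge> 1"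
        using D by simp
      then show ?thesis using True by simp
    qed simp
  qed (use assms D in auto)
  also have "(\<Sum>S\<in>Pow B. D) / 2 ^ card B = D"
    using assms(1) by (simp add: card_Pow)
  also have "(2 / sqrt D) ^ card B * exp D = (2 * exp 1 / sqrt (card B)) ^ card B"
    by (simp add: D_def power_divide power_mult_distrib exp_of_nat_mult[of "card B" 1, simplified])
  finally show ?thesis .
qed

text \<open>The inscribed cube loses only a factor \<open>exp 1\<close> per dimension against the
  upper bound.\<close>

lemma emeasure_unit_ball_ge:
  assumes "finite B" "B \<noteq> {}"
  shows "emeasure (PiR B) {x \<in> B \<rightarrow>\<^sub>E UNIV. (\<Sum>b\<in>B. (x b)\<^sup>2) \<le> 1} \<ge>
    ennreal ((2 / sqrt (card B)) ^ card B)"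
proof -
  have D: "card B > 0" using assms by (simp add: card_gt_0_iff)
  let ?a = "1 / sqrt (card B)"
  have "B \<rightarrow>\<^sub>E {-?a..?a} \<subseteq> {x \<in> B \<rightarrow>\<^sub>E UNIV. (\<Sum>b\<in>B. (x b)\<^sup>2) \<le> 1}"
  proof safe
    fix x assume x: "x \<in> B \<rightarrow>\<^sub>E {-?a..?a}"
    have "(\<Sum>b\<in>B. (x b)\<^sup>2) \<le> (\<Sum>b\<in>B. ?a\<^sup>2)"
    proof (rule sum_mono)
      fix b assume "b \<in> B"
      then have "\<bar>x b\<bar> \<le> ?a" using x by (auto simp: PiE_iff abs_le_iff)
      then show "(x b)\<^sup>2 \<le> ?a\<^sup>2"
        using power_mono[of "\<bar>x b\<bar>" ?a 2] by simp
    qed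
    then show "(\<Sum>b\<in>B. (x b)\<^sup>2) \<le> 1"
      using D by (simp add: power_divide)
  qed auto
  then have "emeasure (PiR B) (B \<rightarrow>\<^sub>E {-?a..?a}) \<le> emeasure (PiR B) {x \<in> B \<rightarrow>\<^sub>E UNIV. (\<Sum>b\<in>B. (x b)\<^sup>2) \<le> 1}"
    using unit_ball_sets[OF assms(1)] by (intro emeasure_mono) auto
  then show ?thesis
    using emeasure_box[OF assms(1), of ?a] D by simp
qed

section \<open>Measurability of the section\<close>

text \<open>Plain coefficients, without multinomial weights, of the sum over j < m of squares of
  forms with coefficients \<open>p (j, \<alpha>)\<close>. Being polynomial in p, they depend
  continuously on it in the product topology.\<close>

definition sos_coefs :: "nat \<Rightarrow> nat \<Rightarrow> (nat \<times> ('n::finite \<Rightarrow> nat) \<Rightarrow> real) \<Rightarrow> ('n \<Rightarrow> nat) \<Rightarrow> real" where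
  "sos_coefs k m p = (\<lambda>\<gamma>. \<Sum>j<m. \<Sum>\<alpha>\<in>exponents k. \<Sum>\<beta>\<in>exponents k. if \<alpha> + \<beta> = \<gamma> then p (j, \<alpha>) * p (j, \<beta>) else 0)"

lemma exponents_add_self: "\<alpha> \<in> exponents k \<Longrightarrow> \<beta> \<in> exponents k \<Longrightarrow> \<alpha> + \<beta> \<in> exponents (2 * k)"
  using exponents_add[of \<alpha> k \<beta> k] by (simp add: mult_2)

lemma sos_coefs_eval:
  "(\<Sum>\<gamma>\<in>exponents (2 * k). sos_coefs k m p \<gamma> * xpow x \<gamma>) = (\<Sum>j<m. (\<Sum>\<alpha>\<in>exponents k. p (j, \<alpha>) * xpow x \<alpha>)\<^sup>2)"
proof -
  have "(\<Sum>\<gamma>\<in>exponents (2 * k). sos_coefs k m p \<gamma> * xpow x \<gamma>) =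
    (\<Sum>\<gamma>\<in>exponents (2 * k). \<Sum>j<m. \<Sum>\<alpha>\<in>exponents k. \<Sum>\<beta>\<in>exponents k.
      if \<gamma> = \<alpha> + \<beta> then p (j, \<alpha>) * p (j, \<beta>) * xpow x (\<alpha> + \<beta>) else 0)"
    unfolding sos_coefs_def sum_distrib_right by (intro sum.cong) auto
  also have "\<dots> = (\<Sum>j<m. \<Sum>\<alpha>\<in>exponents k. \<Sum>\<beta>\<in>exponents k. \<Sum>\<gamma>\<in>exponents (2 * k).
      if \<gamma> = \<alpha> + \<beta> then p (j, \<alpha>) * p (j, \<beta>) * xpow x (\<alpha> + \<beta>) else 0)"
    by (rule trans[OF sum.swap], rule sum.cong[OF refl], rule trans[OF sum.swap], rule sum.cong[OF refl], rule sum.swap)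
  also have "\<dots> = (\<Sum>j<m. \<Sum>\<alpha>\<in>exponents k. \<Sum>\<beta>\<in>exponents k. p (j, \<alpha>) * p (j, \<beta>) * xpow x (\<alpha> + \<beta>))"
    by (intro sum.cong refl) (simp add: finite_exponents exponents_add_self)
  also have "\<dots> = (\<Sum>j<m. (\<Sum>\<alpha>\<in>exponents k. p (j, \<alpha>) * xpow x \<alpha>)\<^sup>2)"
    by (simp add: power2_eq_square sum_product xpow_add mult_ac)
  finally show ?thesis .
qed

lemma sos_coefs_outside: "\<gamma> \<notin> exponents (2 * k) \<Longrightarrow> sos_coefs k m p \<gamma> = 0"
proof -
  assume "\<gamma> \<notin> exponents (2 * k)"
  then have "\<alpha> + \<beta> \<noteq> \<gamma>" if "\<alpha> \<in> exponents k" "\<beta> \<in> exponents k" for \<alpha> \<beta>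
    using exponents_add_self[OF that] by auto
  then show ?thesis
    by (simp add: sos_coefs_def)
qed

text \<open>Both the number m of squares and the coefficient bound r range over the naturals, which
  is what makes the union countable.\<close>

lemma sos_cone_iff_coefs:
  assumes f: "\<And>x. f x = (\<Sum>\<gamma>\<in>exponents (2 * k). c \<gamma> * xpow x \<gamma>)" and c: "\<And>\<gamma>. \<gamma> \<notin> exponents (2 * k) \<Longrightarrow> c \<gamma> = 0"
  shows "f \<in> sos_cone k \<longleftrightarrow> (\<exists>m r::nat. c \<in> sos_coefs k m ` (UNIV \<rightarrow>\<^sub>E {- real r..real r}))"
proof
  assume "f \<in> sos_cone k"
  then obtain m :: nat and g where g: "\<And>j. j < m \<Longrightarrow> g j \<in> forms k" "f = (\<lambda>x. \<Sum>j<m. (g j x)\<^sup>2)"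
    by (auto simp: sos_cone_def)
  \<comment> \<open>The value 0 off the finite index set makes a single bound r valid at all
    indices.\<close>
  define p where "p = (\<lambda>(j, \<alpha>). if j < m \<and> \<alpha> \<in> exponents k then multinom \<alpha> * ncoef k (g j) \<alpha> else 0)"
  have "f x = (\<Sum>\<gamma>\<in>exponents (2 * k). sos_coefs k m p \<gamma> * xpow x \<gamma>)" for x
    unfolding sos_coefs_eval g(2) by (intro sum.cong refl) (simp add: p_def form_eval[OF g(1)])
  then have "(\<Sum>\<gamma>\<in>exponents (2 * k). (c \<gamma> - sos_coefs k m p \<gamma>) * xpow x \<gamma>) = 0" for x
    by (simp add: f left_diff_distrib sum_subtractf)
  from monomials_independent[OF this] have "c \<gamma> = sos_coefs k m p \<gamma>" for \<gamma>
    using c sos_coefs_outside by (cases "\<gamma> \<in> exponents (2 * k)") auto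
  then have "c = sos_coefs k m p" by auto
  moreover have "\<exists>r::nat. \<forall>i. \<bar>p i\<bar> \<le> real r"
  proof -
    have "finite (insert 0 ((\<lambda>i. \<bar>p i\<bar>) ` ({..<m} \<times> exponents k)))"
      by (simp add: finite_exponents)
    then obtain M where M: "\<And>y. y \<in> insert 0 ((\<lambda>i. \<bar>p i\<bar>) ` ({..<m} \<times> exponents k)) \<Longrightarrow> y \<le> M"
      by (meson finite_has_maximal2 bdd_above.E bdd_above_finite)
    obtain r :: nat where "M \<le> real r" using real_arch_simple by blast
    moreover have "\<bar>p i\<bar> \<le> M" for i
    proof (cases "i \<in> {..<m} \<times> exponents k")
      case True
      then show ?thesis by (intro M insertI2 imageI)
    next
      case False
      then have "p i = 0" by (cases i) (auto simp: p_def)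
      then show ?thesis using M[of 0] by simp
    qed
    ultimately show ?thesis by (meson order_trans)
  qed
  then obtain r :: nat where "\<And>i. \<bar>p i\<bar> \<le> real r" by blast
  then have "p \<in> UNIV \<rightarrow>\<^sub>E {- real r..real r}"
    by (simp add: PiE_iff abs_le_iff minus_le_iff)
  ultimately show "\<exists>m r::nat. c \<in> sos_coefs k m ` (UNIV \<rightarrow>\<^sub>E {- real r..real r})"
    by blast
next
  assume "\<exists>m r::nat. c \<in> sos_coefs k m ` (UNIV \<rightarrow>\<^sub>E {- real r..real r})"
  then obtain m :: nat and p where p: "c = sos_coefs k m p" by auto
  have "f = (\<lambda>x. \<Sum>\<gamma>\<in>exponents (2 * k). c \<gamma> * (\<Prod>i\<in>UNIV. (x $ i) ^ \<gamma> i))"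
    by (simp add: f xpow_def fun_eq_iff)
  then have "f \<in> forms (2 * k)" unfolding forms_def by blast
  moreover have "f = (\<lambda>x. \<Sum>j<m. (\<Sum>\<alpha>\<in>exponents k. p (j, \<alpha>) * xpow x \<alpha>)\<^sup>2)"
    by (simp add: fun_eq_iff f p sos_coefs_eval)
  moreover have "(\<lambda>x. \<Sum>\<alpha>\<in>exponents k. p (j, \<alpha>) * xpow x \<alpha>) \<in> forms k" for j
    unfolding forms_def xpow_def by (intro CollectI exI[of _ "\<lambda>\<alpha>. p (j, \<alpha>)"]) simp
  ultimately show "f \<in> sos_cone k"
    unfolding sos_cone_def by (intro CollectI conjI exI[of _ m] exI[of _ "\<lambda>j x. \<Sum>\<alpha>\<in>exponents k. p (j, \<alpha>) * xpow x \<alpha>"]) auto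
qed

text \<open>The box has infinitely many coordinates, so its compactness is Tychonoff's
  theorem.\<close>

lemma compact_sos_coefs:
  "compact (sos_coefs k m ` (UNIV \<rightarrow>\<^sub>E {- real r..real r}) :: (('n::finite \<Rightarrow> nat) \<Rightarrow> real) set)"
proof (rule compact_continuous_image)
  have "compactin (product_topology (\<lambda>_. euclidean) UNIV)
      ((UNIV :: (nat \<times> ('n \<Rightarrow> nat)) set) \<rightarrow>\<^sub>E {- real r..real r})"
    by (subst compactin_PiE) (auto simp: compactin_euclidean_iff)
  then show "compact ((UNIV :: (nat \<times> ('n \<Rightarrow> nat)) set) \<rightarrow>\<^sub>E {- real r..real r})"
    by (simp add: euclidean_product_topology compactin_euclidean_iff)
  have "continuous_on UNIV (sos_coefs k m :: (nat \<times> ('n \<Rightarrow> nat) \<Rightarrow> real) \<Rightarrow> _)"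
  proof (rule continuous_on_coordinatewise_then_product)
    fix \<gamma> :: "'n \<Rightarrow> nat"
    have "continuous_on UNIV (\<lambda>p :: nat \<times> ('n \<Rightarrow> nat) \<Rightarrow> real. if \<alpha> + \<beta> = \<gamma> then p (j, \<alpha>) * p (j, \<beta>) else 0)" for \<alpha> \<beta> j
      by (cases "\<alpha> + \<beta> = \<gamma>") (auto intro!: continuous_intros)
    then show "continuous_on UNIV (\<lambda>p. sos_coefs k m p \<gamma>)"
      unfolding sos_coefs_def by (intro continuous_on_sum)
  qed
  then show "continuous_on (UNIV \<rightarrow>\<^sub>E {- real r..real r}) (sos_coefs k m :: (nat \<times> ('n \<Rightarrow> nat) \<Rightarrow> real) \<Rightarrow> _)"
    by (rule continuous_on_subset) auto
qed

text \<open>The cone of sums of squares is a countable union of continuous images of compact boxes.\<close>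
lemma sos_section_measurable:
  fixes B :: "(real ^ 'n \<Rightarrow> real) set"
  assumes "finite B" "B \<subseteq> forms (2 * k)" "r \<in> forms (2 * k)"
  shows "{c \<in> B \<rightarrow>\<^sub>E UNIV. (\<lambda>x. (\<Sum>b\<in>B. c b * b x) + r x) \<in> sos_cone k} \<in> sets (PiR B)"
proof -
  define a where "a = (\<lambda>(f :: real ^ 'n \<Rightarrow> real) \<gamma>. if \<gamma> \<in> exponents (2 * k) then multinom \<gamma> * ncoef (2 * k) f \<gamma> else 0)"
  define \<Phi> where "\<Phi> = (\<lambda>c \<gamma>. (\<Sum>b\<in>B. c b * a b \<gamma>) + a r \<gamma>)"
  define C where "C = (\<Union>m r. sos_coefs k m ` (UNIV \<rightarrow>\<^sub>E {- real r..real r}) :: (('n \<Rightarrow> nat) \<Rightarrow> real) set)"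
  have a: "f x = (\<Sum>\<gamma>\<in>exponents (2 * k). a f \<gamma> * xpow x \<gamma>)" if "f \<in> forms (2 * k)" for f x
    by (simp add: a_def form_eval[OF that])
  have "(\<lambda>x. (\<Sum>b\<in>B. c b * b x) + r x) \<in> sos_cone k \<longleftrightarrow> \<Phi> c \<in> C" for c
  proof -
    have "(\<Sum>b\<in>B. c b * b x) + r x = (\<Sum>\<gamma>\<in>exponents (2 * k). \<Phi> c \<gamma> * xpow x \<gamma>)" for x
    proof -
      have "(\<Sum>b\<in>B. c b * b x) = (\<Sum>b\<in>B. c b * (\<Sum>\<gamma>\<in>exponents (2 * k). a b \<gamma> * xpow x \<gamma>))"
        using assms(2) by (intro sum.cong refl arg_cong[of _ _ "(*) _"] a) auto
      also have "\<dots> = (\<Sum>\<gamma>\<in>exponents (2 * k). (\<Sum>b\<in>B. c b * a b \<gamma>) * xpow x \<gamma>)"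
        unfolding sum_distrib_left sum_distrib_right by (subst sum.swap) (simp only: mult.assoc)
      finally show ?thesis
        using a[OF assms(3), of x] by (simp add: \<Phi>_def distrib_right sum.distrib)
    qed
    moreover have "\<Phi> c \<gamma> = 0" if "\<gamma> \<notin> exponents (2 * k)" for \<gamma>
      using that by (simp add: \<Phi>_def a_def)
    ultimately show ?thesis
      by (subst sos_cone_iff_coefs[where c="\<Phi> c"]) (auto simp: C_def)
  qed
  then have eq: "{c \<in> B \<rightarrow>\<^sub>E UNIV. (\<lambda>x. (\<Sum>b\<in>B. c b * b x) + r x) \<in> sos_cone k} = \<Phi> -` C \<inter> space (PiR B)"
    by (auto simp: space_PiR)
  have "C \<in> sets borel"
  proof -
    have "sos_coefs k m ` (UNIV \<rightarrow>\<^sub>E {- real r..real r}) \<in> sets (borel :: (('n \<Rightarrow> nat) \<Rightarrow> real) measure)" for m r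
      by (intro borel_closed compact_imp_closed compact_sos_coefs)
    then have "(\<Union>r. sos_coefs k m ` (UNIV \<rightarrow>\<^sub>E {- real r..real r})) \<in> sets (borel :: (('n \<Rightarrow> nat) \<Rightarrow> real) measure)" for m
      by (intro sets.countable_UN) auto
    then show ?thesis
      unfolding C_def by (intro sets.countable_UN) auto
  qed
  moreover have "\<Phi> \<in> borel_measurable (PiR B)"
    unfolding \<Phi>_def by (rule measurable_coordinatewise_then_product) measurable
  ultimately show ?thesis
    unfolding eq by (rule measurable_sets[rotated])
qed

section \<open>Volume of the section of the cone of sums of squares\<close>

lemma semi_inner_bom: "semi_inner (forms m) (bom m)"
  by unfold_locales (assumption | rule subspace_forms bom_add_left bom_scale_left bom_commute bom_nonneg)+

lemma exponents_nonempty: "exponents m \<noteq> {}"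
proof -
  have "(\<lambda>j. if j = undefined then m else 0) \<in> exponents m"
    by (simp add: exponents_def)
  then show ?thesis by blast
qed

text \<open>The scaling makes \<open>v \<mapsto> net_form k v\<close> an isometry from Euclidean space to the Bombieri norm.\<close>
definition net_form :: "nat \<Rightarrow> (('n \<Rightarrow> nat) \<Rightarrow> real) \<Rightarrow> real ^ 'n \<Rightarrow> real" where
  "net_form k v = form_of k (\<lambda>\<alpha>. v \<alpha> / sqrt (multinom \<alpha>))"

lemma net_form_in_forms: "net_form k v \<in> forms k"
  by (simp add: net_form_def form_of_in_forms)

lemma bom_net_form: "bom k (net_form k v) (net_form k v) = (\<Sum>\<alpha>\<in>exponents k. (v \<alpha>)\<^sup>2)"
  unfolding bom_def
proof (rule sum.cong[OF refl])
  fix \<alpha> :: "'a \<Rightarrow> nat" assume \<alpha>: "\<alpha> \<in> exponents k"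
  have "multinom \<alpha> = sqrt (multinom \<alpha>) * sqrt (multinom \<alpha>)"
    using multinom_pos[of \<alpha>] by simp
  then show "multinom \<alpha> * ncoef k (net_form k v) \<alpha> * ncoef k (net_form k v) \<alpha> = (v \<alpha>)\<^sup>2"
    using multinom_pos[of \<alpha>] by (simp add: net_form_def ncoef_form_of[OF \<alpha>] power2_eq_square)
qed

text \<open>In the coordinates sqrt (\<open>multinom \<alpha>\<close>) *
  \<open>ncoef k g \<alpha>\<close> the Bombieri norm is Euclidean, so the catalecticant is a
  quadratic form to which \<open>quadratic_form_le_net\<close> applies.\<close>

lemma bom_square_le_net:
  fixes \<phi> :: "real ^ 'n \<Rightarrow> real"
  assumes g: "g \<in> forms k"
    and net: "\<And>v. v \<in> lattice_net (exponents k) \<Longrightarrow> \<bar>bom (2 * k) \<phi> (\<lambda>x. (net_form k v x)\<^sup>2)\<bar> \<le> \<tau>"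
  shows "\<bar>bom (2 * k) \<phi> (\<lambda>x. (g x)\<^sup>2)\<bar> \<le> 2 * \<tau> * bom k g g"
proof -
  define X where "X = (\<lambda>\<alpha> \<beta>. sqrt (multinom \<alpha>) * sqrt (multinom \<beta>) * ncoef (2 * k) \<phi> (\<alpha> + \<beta>))"
  define q where "q = (\<lambda>u. \<Sum>\<alpha>\<in>exponents k. \<Sum>\<beta>\<in>exponents k. X \<alpha> \<beta> * u \<alpha> * u \<beta>)"
  have s: "multinom \<alpha> = sqrt (multinom \<alpha>) * sqrt (multinom \<alpha>)" for \<alpha> :: "'n \<Rightarrow> nat"
    using multinom_pos[of \<alpha>] by simp
  have q: "bom (2 * k) \<phi> (\<lambda>x. (f x)\<^sup>2) = q (\<lambda>\<alpha>. sqrt (multinom \<alpha>) * ncoef k f \<alpha>)" if "f \<in> forms k" for f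
    unfolding bom_square[OF that] q_def
  proof (intro sum.cong refl)
    fix \<alpha> \<beta> :: "'n \<Rightarrow> nat"
    show "multinom \<alpha> * multinom \<beta> * ncoef (2 * k) \<phi> (\<alpha> + \<beta>) * ncoef k f \<alpha> * ncoef k f \<beta> =
      X \<alpha> \<beta> * (sqrt (multinom \<alpha>) * ncoef k f \<alpha>) * (sqrt (multinom \<beta>) * ncoef k f \<beta>)"
      unfolding X_def by (subst (1) s[of \<alpha>], subst (1) s[of \<beta>]) (simp only: mult.assoc mult.left_commute)
  qed
  have qnet: "\<bar>q v\<bar> \<le> \<tau>" if v: "v \<in> lattice_net (exponents k)" for v
  proof -
    have "q (\<lambda>\<alpha>. sqrt (multinom \<alpha>) * ncoef k (net_form k v) \<alpha>) = q v"
      unfolding q_def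
    proof (intro sum.cong refl)
      fix \<alpha> \<beta> :: "'n \<Rightarrow> nat" assume "\<alpha> \<in> exponents k" "\<beta> \<in> exponents k"
      then show "X \<alpha> \<beta> * (sqrt (multinom \<alpha>) * ncoef k (net_form k v) \<alpha>) * (sqrt (multinom \<beta>) * ncoef k (net_form k v) \<beta>) =
          X \<alpha> \<beta> * v \<alpha> * v \<beta>"
        by (simp add: net_form_def ncoef_form_of)
    qed
    then show ?thesis
      using net[OF v] q[OF net_form_in_forms] by simp
  qed
  have "\<bar>q (\<lambda>\<alpha>. sqrt (multinom \<alpha>) * ncoef k g \<alpha>)\<bar> \<le> 2 * \<tau> * (\<Sum>\<alpha>\<in>exponents k. (sqrt (multinom \<alpha>) * ncoef k g \<alpha>)\<^sup>2)"
    unfolding q_def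
    by (rule quadratic_form_le_net[OF finite_exponents exponents_nonempty]) (rule qnet[unfolded q_def])
  also have "(\<Sum>\<alpha>\<in>exponents k. (sqrt (multinom \<alpha>) * ncoef k g \<alpha>)\<^sup>2) = bom k g g"
    by (simp add: bom_def power_mult_distrib less_imp_le[OF multinom_pos]) (simp add: power2_eq_square mult.assoc)
  finally show ?thesis by (simp only: q[OF g])
qed

lemma lattice_net_exponents:
  "finite (lattice_net (exponents k))" "lattice_net (exponents k) \<noteq> {}"
proof -
  show "finite (lattice_net (exponents k))"
    by (rule finite_lattice_net[OF finite_exponents])
  show "lattice_net (exponents k) \<noteq> {}"
    by (rule lattice_net_approx[OF finite_exponents exponents_nonempty, of "\<lambda>_. 0"]) auto
qed

text \<open>The constant 14 comes from 3 * 2^16 \<le> (5/2)^14 and 5/2 \<le>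
  \<open>exp 1\<close>.\<close>

lemma ln_card_lattice_net:
  "ln (card (lattice_net (exponents k :: ('n::finite \<Rightarrow> nat) set))) \<le> 14 * card (exponents k :: ('n \<Rightarrow> nat) set)"
proof -
  let ?J = "exponents k :: ('n \<Rightarrow> nat) set"
  have "(3 * 2 ^ 16 :: real) \<le> (5 / 2) ^ 14" by (simp add: power_divide)
  also have "(5 / 2 :: real) ^ 14 \<le> exp 1 ^ 14"
    using exp_lower_Taylor_quadratic[of 1] by (intro power_mono) auto
  also have "\<dots> = exp 14"
    by (simp flip: exp_of_nat_mult)
  finally have "(3 * 2 ^ 16 :: real) ^ card ?J \<le> exp 14 ^ card ?J"
    by (intro power_mono) auto
  also have "exp 14 ^ card ?J = exp (real (card ?J) * 14)"
    by (rule exp_of_nat_mult[symmetric])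
  finally have "card (lattice_net ?J) \<le> exp (14 * real (card ?J))"
    using card_lattice_net[of ?J, OF finite_exponents] by (simp only: mult.commute)
  moreover have "card (lattice_net ?J) > 0"
    by (simp add: card_gt_0_iff lattice_net_exponents)
  ultimately have "ln (card (lattice_net ?J)) \<le> ln (exp (14 * real (card ?J)))"
    by (subst ln_le_cancel_iff) auto
  then show "ln (card (lattice_net ?J)) \<le> 14 * card ?J"
    by simp
qed

section \<open>Coordinates on M\<close>

locale sos_volume = sphere_prob \<sigma> for \<sigma> :: "(real ^ 'n) measure" +
  fixes k :: nat and B :: "(real ^ 'n \<Rightarrow> real) set"
  assumes k1: "k \<ge> 1" and onb: "orthonormal_basis \<sigma> (M_forms \<sigma> k) B"
begin

definition "N = card (exponents k :: ('n \<Rightarrow> nat) set)"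
text \<open>Compares squared norms, see \<open>bom_le\<close>. It is the product of n + 2 i over i <
  m divided by m!, hence at least the number of monomials of degree m.\<close>

definition "\<Lambda> = (\<lambda>m. 1 / (fact m * kap CARD('n) m))"
definition "lin = (\<lambda>c x. \<Sum>b\<in>B. c b * b x)"

lemma \<Lambda>_pos: "\<Lambda> m > 0"
  using kap_pos by (simp add: \<Lambda>_def)

lemma bom_le: "g \<in> forms m \<Longrightarrow> bom m g g \<le> \<Lambda> m * (\<integral>x. (g x)\<^sup>2 \<partial>\<sigma>)"
  using bom_le_integral[of g m] kap_pos[of m] by (simp add: \<Lambda>_def field_simps)

lemma finB: "finite B" and spanB: "real_fun.span B = M_forms \<sigma> k"
  and onB: "\<And>b b'. b \<in> B \<Longrightarrow> b' \<in> B \<Longrightarrow> form_inner \<sigma> b b' = (if b = b' then 1 else 0)"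
  using onb by (auto simp: orthonormal_basis_def)

lemma M_sub: "M_forms \<sigma> k \<subseteq> forms (2 * k)"
  by (auto simp: M_forms_def)

lemma BM: "b \<in> B \<Longrightarrow> b \<in> M_forms \<sigma> k"
  using real_fun.span_base[of b B] spanB by simp

lemma BU: "B \<subseteq> forms (2 * k)"
  using BM M_sub by auto

lemma lin_M: "lin c \<in> M_forms \<sigma> k"
  unfolding lin_def using lin_in_span[OF finB, of c] spanB by simp

lemma integrable_form: "f \<in> forms m \<Longrightarrow> integrable \<sigma> f"
  by (rule integrable_\<sigma>[OF continuous_form])

lemma integrable_form_mult: "f \<in> forms m \<Longrightarrow> g \<in> forms m' \<Longrightarrow> integrable \<sigma> (\<lambda>x. f x * g x)"
  by (intro integrable_\<sigma> continuous_on_mult continuous_form)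

sublocale two_inner "forms (2 * k)" "bom (2 * k)" "form_inner \<sigma>"
proof -
  interpret semi_inner "forms (2 * k)" "bom (2 * k)" by (rule semi_inner_bom)
  show "two_inner (forms (2 * k)) (bom (2 * k)) (form_inner \<sigma>)"
  proof unfold_locales
    show "form_inner \<sigma> (\<lambda>x. f x + g x) h = form_inner \<sigma> f h + form_inner \<sigma> g h"
      if "f \<in> forms (2 * k)" "g \<in> forms (2 * k)" "h \<in> forms (2 * k)" for f g h
      using integrable_form_mult[OF that(1,3)] integrable_form_mult[OF that(2,3)]
      by (simp add: form_inner_def distrib_right)
    show "f = (\<lambda>x. 0)" if "f \<in> forms (2 * k)" "bom (2 * k) f f = 0" for f :: "real ^ 'n \<Rightarrow> real"
      using bom_eq_0D that by blast
    show "form_inner \<sigma> (\<lambda>x. c * f x) h = c * form_inner \<sigma> f h" for c f h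
      by (simp add: form_inner_def mult.assoc)
    show "form_inner \<sigma> f g = form_inner \<sigma> g f" for f g
      by (simp add: form_inner_def mult.commute)
    show "form_inner \<sigma> f f \<ge> 0" for f
      by (simp add: form_inner_def)
  qed (rule subspace_forms)
qed

lemma r_pow_sphere: "x \<in> space \<sigma> \<Longrightarrow> r_pow m x = 1"
  by (simp add: r_pow_eq space_\<sigma> norm_eq_sqrt_inner)

lemma integral_r_pow: "(\<integral>x. r_pow m x \<partial>\<sigma>) = 1"
proof -
  have "(\<integral>x. r_pow m x \<partial>\<sigma>) = (\<integral>x. 1 \<partial>\<sigma>)"
    by (rule Bochner_Integration.integral_cong) (simp_all add: r_pow_sphere)
  then show ?thesis by (simp add: measure_\<sigma>)
qed

lemma M_iff: "f \<in> M_forms \<sigma> k \<longleftrightarrow> f \<in> forms (2 * k) \<and> bom (2 * k) f (r_pow k) = 0"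
  using integral_form[of f k] ckap_pos[of k] by (auto simp: M_forms_def)

lemma indep: "\<not> real_fun.dependent B"
proof (rule real_fun.independent_if_scalars_zero[OF finB])
  fix u b assume 0: "(\<Sum>b\<in>B. (\<lambda>x. u b * b x)) = 0" and b: "b \<in> B"
  have "(\<lambda>x. \<Sum>b\<in>B. u b * b x) = (\<lambda>x. 0)"
    using fun_cong[OF 0] by (simp add: sum_fun_apply)
  then have "0 = form_inner \<sigma> (\<lambda>x. \<Sum>b\<in>B. u b * b x) b"
    by (simp add: form_inner_def)
  also have "\<dots> = (\<Sum>b'\<in>B. u b' * form_inner \<sigma> b' b)"
    using BU b by (intro ip2.sum_left) auto
  also have "\<dots> = (\<Sum>b'\<in>B. if b' = b then u b' else 0)"
    by (rule sum.cong) (auto simp: onB b)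
  also have "\<dots> = u b" using b finB by simp
  finally show "u b = 0" by simp
qed

lemma dim_eq: "real_fun.dim (M_forms \<sigma> k) = card B"
  using real_fun.dim_eq_card[of B "M_forms \<sigma> k"] indep spanB real_fun.span_span[of B] by metis

text \<open>Subtracting its integral times \<open>r_pow k\<close> moves a form into M, so
  \<open>r_pow k\<close> and \<open>B\<close> span all the independent monomials.\<close>

lemma card_exponents_le: "card (exponents (2 * k) :: ('n \<Rightarrow> nat) set) \<le> card B + 1"
proof -
  define mono where "mono = (\<lambda>\<gamma> (x :: real ^ 'n). xpow x \<gamma>)"
  let ?E = "exponents (2 * k) :: ('n \<Rightarrow> nat) set"
  have coef0: "u \<gamma> = 0" if "(\<Sum>\<gamma>\<in>?E. (\<lambda>x. u \<gamma> * mono \<gamma> x)) = 0" "\<gamma> \<in> ?E" for u \<gamma>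
    using monomials_independent[OF _ that(2), of u] fun_cong[OF that(1)]
    by (simp add: sum_fun_apply mono_def)
  have inj: "inj_on mono ?E"
  proof (rule inj_onI, rule ccontr)
    fix \<gamma> \<delta> assume *: "\<gamma> \<in> ?E" "\<delta> \<in> ?E" "mono \<gamma> = mono \<delta>" "\<gamma> \<noteq> \<delta>"
    define u where "u = (\<lambda>\<epsilon>. if \<epsilon> = \<gamma> then 1 else if \<epsilon> = \<delta> then - 1 else (0::real))"
    have "(\<Sum>\<epsilon>\<in>?E. (\<lambda>x. u \<epsilon> * mono \<epsilon> x)) = (\<Sum>\<epsilon>\<in>{\<gamma>, \<delta>}. (\<lambda>x. u \<epsilon> * mono \<epsilon> x))"
      by (rule sum.mono_neutral_right) (use * in \<open>auto simp: finite_exponents u_def zero_fun_def\<close>)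
    also have "\<dots> = 0"
      using *(3,4) by (auto simp: u_def fun_eq_iff)
    finally have "u \<gamma> = 0" using coef0 *(1) by blast
    then show False by (simp add: u_def)
  qed
  have "\<not> real_fun.dependent (mono ` ?E)"
  proof (rule real_fun.independent_if_scalars_zero)
    fix u f assume 0: "(\<Sum>f\<in>mono ` ?E. (\<lambda>x. u f * f x)) = 0" and "f \<in> mono ` ?E"
    then obtain \<gamma> where \<gamma>: "\<gamma> \<in> ?E" "f = mono \<gamma>" by blast
    have "(\<Sum>\<gamma>\<in>?E. (\<lambda>x. u (mono \<gamma>) * mono \<gamma> x)) = 0"
      using 0 by (simp add: sum.reindex[OF inj])
    from coef0[OF this \<gamma>(1)] show "u f = 0" by (simp add: \<gamma>)
  qed (simp add: finite_exponents)
  moreover have "mono ` ?E \<subseteq> real_fun.span (insert (r_pow k) B)"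
  proof
    fix f assume "f \<in> mono ` ?E"
    then obtain \<gamma> where \<gamma>: "\<gamma> \<in> ?E" "f = mono \<gamma>" by blast
    have "f = form_of (2 * k) (\<lambda>\<alpha>. if \<alpha> = \<gamma> then 1 / multinom \<gamma> else 0)"
    proof
      fix x
      have "form_of (2 * k) (\<lambda>\<alpha>. if \<alpha> = \<gamma> then 1 / multinom \<gamma> else 0) x = (\<Sum>\<alpha>\<in>?E. if \<alpha> = \<gamma> then xpow x \<gamma> else 0)"
        unfolding form_of_def by (rule sum.cong) auto
      then show "f x = form_of (2 * k) (\<lambda>\<alpha>. if \<alpha> = \<gamma> then 1 / multinom \<gamma> else 0) x"
        using \<gamma> by (simp add: mono_def finite_exponents)
    qed
    then have fU: "f \<in> forms (2 * k)" using form_of_in_forms by simp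
    define c where "c = (\<integral>x. f x \<partial>\<sigma>)"
    have "(\<lambda>x. f x - c * r_pow k x) \<in> M_forms \<sigma> k"
      unfolding M_forms_def using fU integrable_form[OF fU] integrable_form[OF r_pow_in_forms[of k]]
      by (auto simp: c_def integral_r_pow intro!: mem_diff mem_scale r_pow_in_forms)
    then have "f - (\<lambda>x. c * r_pow k x) \<in> real_fun.span B"
      by (simp add: spanB fun_diff_def)
    then show "f \<in> real_fun.span (insert (r_pow k) B)"
      by (auto simp: real_fun.span_insert)
  qed
  ultimately have "card (mono ` ?E) \<le> card (insert (r_pow k) B)"
    using real_fun.independent_span_bound[of "insert (r_pow k) B" "mono ` ?E"] finB by blast
  also have "\<dots> \<le> card B + 1"
    using finB by (simp add: card_insert_if)
  finally show ?thesis
    by (simp add: card_image[OF inj])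
qed

lemma sos_set_eq: "{c \<in> B \<rightarrow>\<^sub>E UNIV. (\<lambda>x. \<Sum>b\<in>B. c b * b x) \<in> sos_section \<sigma> k} =
    {c \<in> B \<rightarrow>\<^sub>E UNIV. (\<lambda>x. lin c x + r_pow k x) \<in> sos_cone k}"
  using lin_M by (auto simp: sos_section_def lin_def)

lemma sos_set_measurable: "{c \<in> B \<rightarrow>\<^sub>E UNIV. (\<lambda>x. lin c x + r_pow k x) \<in> sos_cone k} \<in> sets (PiR B)"
  unfolding lin_def by (rule sos_section_measurable[OF finB BU r_pow_in_forms])

lemma vol_sos: "vol B (sos_section \<sigma> k) = measure (PiR B) {c \<in> B \<rightarrow>\<^sub>E UNIV. (\<lambda>x. lin c x + r_pow k x) \<in> sos_cone k}"
  unfolding vol_def sos_set_eq by (rule measure_completion[OF sos_set_measurable])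

lemma vol_ball: "vol B (M_unit_ball \<sigma> k) = measure (PiR B) {c \<in> B \<rightarrow>\<^sub>E UNIV. (\<Sum>b\<in>B. (c b)\<^sup>2) \<le> 1}"
proof -
  have "form_inner \<sigma> (lin c) (lin c) = (\<Sum>b\<in>B. (c b)\<^sup>2)" for c
  proof -
    have U: "lin c \<in> forms (2 * k)" using lin_M M_sub by blast
    have 1: "form_inner \<sigma> b (lin c) = c b" if b: "b \<in> B" for b
    proof -
      have "form_inner \<sigma> b (lin c) = (\<Sum>b'\<in>B. c b' * form_inner \<sigma> b b')"
        unfolding lin_def using BU b by (intro ip2.sum_right) auto
      also have "\<dots> = (\<Sum>b'\<in>B. if b = b' then c b' else 0)"
        by (rule sum.cong) (auto simp: onB b)
      finally show ?thesis using b finB by simp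
    qed
    have "form_inner \<sigma> (lin c) (lin c) = (\<Sum>b\<in>B. c b * form_inner \<sigma> b (lin c))"
      by (subst (1) lin_def) (use BU U in \<open>intro ip2.sum_left; auto\<close>)
    then show ?thesis by (simp add: 1 power2_eq_square)
  qed
  then have "{c \<in> B \<rightarrow>\<^sub>E UNIV. (\<lambda>x. \<Sum>b\<in>B. c b * b x) \<in> M_unit_ball \<sigma> k} = {c \<in> B \<rightarrow>\<^sub>E UNIV. (\<Sum>b\<in>B. (c b)\<^sup>2) \<le> 1}"
    using lin_M by (auto simp: M_unit_ball_def lin_def)
  then show ?thesis
    unfolding vol_def by (simp add: measure_completion[OF unit_ball_sets[OF finB]])
qed

end

context sos_volume
begin

lemma N_pos: "N \<ge> 1"
  unfolding N_def using exponents_nonempty[of k] finite_exponents[of k]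
  by (metis One_nat_def Suc_leI card_gt_0_iff)

text \<open>For n \<ge> 2 there are at least 2k + 1 \<ge> 3 monomials. Hence \<open>card B\<close>
  is at least 2, and the extra 1 in \<open>card_exponents_le\<close> is absorbed by the factor
  3/2.\<close>

lemma two_le_card: "2 \<le> card B" "real (card (exponents (2 * k) :: ('n \<Rightarrow> nat) set)) \<le> 3 / 2 * card B"
proof -
  let ?c = "card (exponents (2 * k) :: ('n \<Rightarrow> nat) set)"
  have "fact (2 * k) * real (2 * k + 1) = (\<Prod>i<2 * k. real (Suc i)) * real (2 * k + 1)"
    by (simp add: fact_prod_Suc atLeast0LessThan)
  also have "\<dots> = (\<Prod>i<Suc (2 * k). real (Suc i))"
    by simp
  also have "\<dots> = (\<Prod>i<2 * k. real (2 + i))"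
    by (subst prod.lessThan_Suc_shift) simp
  also have "\<dots> \<le> (\<Prod>i<2 * k. real (CARD('n) + i))"
    using n2 by (intro prod_mono) auto
  also have "\<dots> = real ?c * fact (2 * k)"
    by (rule card_exponents[symmetric])
  finally have "real (2 * k + 1) \<le> real ?c"
    by (simp add: mult.commute)
  then have "3 \<le> ?c" using k1 by linarith
  then show "2 \<le> card B" "real ?c \<le> 3 / 2 * card B"
    using card_exponents_le by linarith+
qed

lemma B_ne: "B \<noteq> {}"
  using two_le_card(1) by auto

section \<open>The Bombieri-orthonormal basis and the two inclusions\<close>

definition "basis = (SOME es. triangular_basis B (fst es) (snd es))"
definition "e = fst basis"
definition "s = snd basis"
definition "X = (\<lambda>c. \<lambda>b\<in>B. bom (2 * k) (lin c) (e b))"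

lemma basis: "triangular_basis B e s"
proof -
  obtain e' s' where "triangular_basis B e' s'"
    using gram_schmidt[OF finB BU onB] by blast
  then have "triangular_basis B (fst (e', s')) (snd (e', s'))" by simp
  then show ?thesis
    unfolding e_def s_def basis_def by (rule someI)
qed

lemma eM: "b \<in> B \<Longrightarrow> e b \<in> M_forms \<sigma> k"
  and s_pos: "b \<in> B \<Longrightarrow> s b > 0"
  and s_le: "b \<in> B \<Longrightarrow> (s b)\<^sup>2 \<le> form_inner \<sigma> (e b) (e b)"
  and s_ge: "b \<in> B \<Longrightarrow> 1 \<le> (s b)\<^sup>2 * bom (2 * k) b b"
  and e_on: "b \<in> B \<Longrightarrow> b' \<in> B \<Longrightarrow> bom (2 * k) (e b) (e b') = (if b = b' then 1 else 0)"
  and e_expand: "f \<in> M_forms \<sigma> k \<Longrightarrow> f = (\<lambda>x. \<Sum>b\<in>B. bom (2 * k) f (e b) * e b x)"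
  using basis spanB unfolding triangular_basis_def by blast+

lemma X_integral: "F \<in> borel_measurable (PiR B) \<Longrightarrow>
    (\<integral>\<^sup>+c. F (X c) \<partial>PiR B) = ennreal (\<Prod>b\<in>B. s b) * (\<integral>\<^sup>+x. F x \<partial>PiR B)"
  using basis unfolding triangular_basis_def X_def lin_def by blast

lemma eU: "b \<in> B \<Longrightarrow> e b \<in> forms (2 * k)"
  using eM M_sub by auto

lemma prod_s_pos: "(\<Prod>b\<in>B. s b) > 0"
  by (intro prod_pos s_pos)

lemma bessel_e: "f \<in> forms (2 * k) \<Longrightarrow> (\<Sum>b\<in>B. (bom (2 * k) f (e b))\<^sup>2) \<le> bom (2 * k) f f"
  by (rule bessel[OF finB eU e_on])

text \<open>By Bessel's inequality and the reproducing property, \<open>\<Sum>b (e b x)\<^sup>2 \<le> 1\<close> on the sphere.\<close>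
lemma sum_s_le: "(\<Sum>b\<in>B. (s b)\<^sup>2) \<le> 1"
proof -
  have pt: "(\<Sum>b\<in>B. (e b x)\<^sup>2) \<le> 1" if x: "x \<in> space \<sigma>" for x
  proof -
    let ?K = "\<lambda>y. (y \<bullet> x) ^ (2 * k)"
    have K: "?K \<in> forms (2 * k)" by (simp add: power_form form_of_in_forms)
    have "e b x = bom (2 * k) ?K (e b)" if "b \<in> B" for b
      using bom_reproducing[OF eU[OF that], of x] by (simp add: bom_commute)
    then have "(\<Sum>b\<in>B. (e b x)\<^sup>2) = (\<Sum>b\<in>B. (bom (2 * k) ?K (e b))\<^sup>2)" by simp
    also have "\<dots> \<le> bom (2 * k) ?K ?K" by (rule bessel_e[OF K])
    also have "\<dots> = 1"
      using x by (simp add: bom_reproducing[OF K] space_\<sigma> norm_eq_sqrt_inner)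
    finally show ?thesis .
  qed
  have int: "integrable \<sigma> (\<lambda>x. (e b x)\<^sup>2)" if "b \<in> B" for b
    using integrable_form_mult[OF eU[OF that] eU[OF that]] by (simp add: power2_eq_square)
  have "(\<Sum>b\<in>B. (s b)\<^sup>2) \<le> (\<Sum>b\<in>B. \<integral>x. (e b x)\<^sup>2 \<partial>\<sigma>)"
    using s_le by (intro sum_mono) (simp add: form_inner_def power2_eq_square)
  also have "\<dots> = (\<integral>x. (\<Sum>b\<in>B. (e b x)\<^sup>2) \<partial>\<sigma>)"
    by (rule Bochner_Integration.integral_sum[symmetric]) (rule int)
  also have "\<dots> \<le> (\<integral>x. 1 \<partial>\<sigma>)"
    by (rule integral_mono[OF Bochner_Integration.integrable_sum[OF int] integrable_\<sigma>[OF continuous_on_const] pt])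
  also have "\<dots> = 1" by (simp add: measure_\<sigma>)
  finally show ?thesis .
qed

lemma prod_s_le: "(\<Prod>b\<in>B. s b) \<le> (1 / sqrt (card B)) ^ card B"
proof -
  define D where "D = real (card B)"
  have D: "D > 0" using two_le_card(1) by (simp add: D_def)
  define P where "P = (\<Prod>b\<in>B. (s b)\<^sup>2)"
  have P: "P > 0" unfolding P_def by (intro prod_pos zero_less_power s_pos)
  have "P powr (1 / D) \<le> (\<Sum>b\<in>B. (s b)\<^sup>2 / D)"
    unfolding P_def D_def by (rule arith_geom_mean[OF finB B_ne]) simp
  also have "\<dots> \<le> 1 / D"
    using sum_s_le D by (simp add: sum_divide_distrib[symmetric] divide_right_mono)
  finally have "(P powr (1 / D)) powr D \<le> (1 / D) powr D"
    using D by (intro powr_mono2) auto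
  moreover have "(1 / D) powr D = (1 / D) ^ card B"
    using powr_realpow[of "1 / D" "card B"] D by (simp add: D_def)
  ultimately have "P \<le> (1 / D) ^ card B"
    using P D by (simp add: powr_powr)
  moreover have "P = (\<Prod>b\<in>B. s b)\<^sup>2"
    by (simp add: P_def prod_power_distrib)
  moreover have "((1 / sqrt D) ^ card B)\<^sup>2 = (1 / D) ^ card B"
    using D by (simp add: power_divide power_mult[symmetric] mult.commute[of _ 2] power_mult)
  ultimately have "(\<Prod>b\<in>B. s b)\<^sup>2 \<le> ((1 / sqrt D) ^ card B)\<^sup>2" by simp
  then show ?thesis
    unfolding D_def[symmetric] by (rule power2_le_imp_le) (use D in simp)
qed

text \<open>Holds factor by factor: b has L2 norm 1, so its squared Bombieri norm is at most
  \<open>\<Lambda> (2 * k)\<close>, and \<open>s_ge\<close> applies.\<close>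

lemma prod_s_ge: "(1 / sqrt (\<Lambda> (2 * k))) ^ card B \<le> (\<Prod>b\<in>B. s b)"
proof -
  have "1 / sqrt (\<Lambda> (2 * k)) \<le> s b" if b: "b \<in> B" for b
  proof -
    have "bom (2 * k) b b \<le> \<Lambda> (2 * k) * form_inner \<sigma> b b"
      using bom_le[of b "2 * k"] BU b by (auto simp: form_inner_def power2_eq_square)
    then have "bom (2 * k) b b \<le> \<Lambda> (2 * k)"
      using onB[OF b b] by simp
    then have "1 \<le> (s b)\<^sup>2 * \<Lambda> (2 * k)"
      using s_ge[OF b] mult_left_mono[of "bom (2 * k) b b" "\<Lambda> (2 * k)" "(s b)\<^sup>2"] by simp
    then have "1 / \<Lambda> (2 * k) \<le> (s b)\<^sup>2"
      using \<Lambda>_pos[of "2 * k"] by (simp add: pos_divide_le_eq)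
    then have "sqrt (1 / \<Lambda> (2 * k)) \<le> s b"
      by (intro real_le_lsqrt less_imp_le[OF s_pos] b)
    then show ?thesis by (simp add: real_sqrt_divide)
  qed
  then have "(\<Prod>b\<in>B. 1 / sqrt (\<Lambda> (2 * k))) \<le> (\<Prod>b\<in>B. s b)"
    using \<Lambda>_pos[of "2 * k"] by (intro prod_mono) auto
  then show ?thesis by simp
qed

definition "wt = (\<lambda>v b. bom (2 * k) (e b) (\<lambda>x. (net_form k v x)\<^sup>2))"

text \<open>Net vectors lie in the unit ball, so squares of their forms have Bombieri norm at most
  1, and Bessel's inequality bounds the coordinates. This is the hypothesis of both the random sign
  bound and the cube bound.\<close>

lemma wt_le: "v \<in> lattice_net (exponents k) \<Longrightarrow> (\<Sum>b\<in>B. (wt v b)\<^sup>2) \<le> 1"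
proof -
  assume v: "v \<in> lattice_net (exponents k)"
  let ?f = "\<lambda>x. (net_form k v x)\<^sup>2"
  have f: "?f \<in> forms (2 * k)"
    by (rule square_in_forms[OF net_form_in_forms])
  have "(\<Sum>b\<in>B. (wt v b)\<^sup>2) = (\<Sum>b\<in>B. (bom (2 * k) ?f (e b))\<^sup>2)"
    unfolding wt_def by (simp only: bom_commute)
  also have "\<dots> \<le> bom (2 * k) ?f ?f" by (rule bessel_e[OF f])
  also have "\<dots> \<le> (bom k (net_form k v) (net_form k v))\<^sup>2"
    by (rule bom_square_le[OF net_form_in_forms])
  also have "\<dots> \<le> 1\<^sup>2"
    using lattice_net_norm[OF v finite_exponents exponents_nonempty]
    by (intro power_mono) (auto simp: bom_net_form sum_nonneg)
  finally show ?thesis by simp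
qed

lemma bom_sum_wt:
  "bom (2 * k) (\<lambda>x. \<Sum>b\<in>B. c b * e b x) (\<lambda>x. (net_form k v x)\<^sup>2) = (\<Sum>b\<in>B. c b * wt v b)"
  unfolding wt_def by (intro sum_left eU square_in_forms net_form_in_forms)

text \<open>Pairing with the signed sum \<phi> does not see \<open>r_pow k\<close>, so it may be
  computed on the squares of the \<open>g j\<close>. Each contributes at most 2 H times the squared
  Bombieri norm of \<open>g j\<close>, hence at most 2 H \<open>\<Lambda> k\<close> times its
  squared L2 norm, and these sum to the integral of \<open>lin c + r_pow k\<close>, which is
  1.\<close>

lemma sos_upper_set:
  "\<exists>h. (\<forall>c. (\<lambda>x. lin c x + r_pow k x) \<in> sos_cone k \<longrightarrow>
      (\<forall>S. (\<Sum>b\<in>B. sgn_on S b * X c b) \<le> h S)) \<and>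
    (\<Sum>S\<in>Pow B. h S) / 2 ^ card B \<le> 12 * sqrt N * \<Lambda> k"
proof -
  let ?V = "lattice_net (exponents k) :: (('n \<Rightarrow> nat) \<Rightarrow> real) set"
  \<comment> \<open>Near the optimum for sign_sum_le: the numerator is at most 15 N + 25 N / 2 \<le>
    30 N, so the quotient is at most 6 sqrt N. The net then doubles it to 12 sqrt N.\<close>
  define t where "t = 5 * sqrt N"
  have t: "t > 0" using N_pos by (simp add: t_def)
  obtain H where H: "\<And>S v. v \<in> ?V \<Longrightarrow> \<bar>\<Sum>b\<in>B. sgn_on S b * wt v b\<bar> \<le> H S"
    and avg: "(\<Sum>S\<in>Pow B. H S) / 2 ^ card B \<le> (ln (2 * card ?V) + t\<^sup>2 / 2) / t"
  proof -
    have "\<exists>H. (\<forall>S. \<forall>v\<in>?V. \<bar>\<Sum>b\<in>B. sgn_on S b * wt v b\<bar> \<le> H S) \<and>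
        (\<Sum>S\<in>Pow B. H S) / 2 ^ card B \<le> (ln (2 * card ?V) + t\<^sup>2 / 2) / t"
      by (rule sign_sum_le[OF finB lattice_net_exponents _ t]) (rule wt_le)
    then show ?thesis using that by blast
  qed
  define h where "h = (\<lambda>S. 2 * \<Lambda> k * H S)"
  have "(\<Sum>b\<in>B. sgn_on S b * X c b) \<le> h S"
    if c: "(\<lambda>x. lin c x + r_pow k x) \<in> sos_cone k" for c S
  proof -
    obtain m :: nat and g where g: "\<And>j. j < m \<Longrightarrow> g j \<in> forms k"
        "(\<lambda>x. lin c x + r_pow k x) = (\<lambda>x. \<Sum>j<m. (g j x)\<^sup>2)"
      using c by (auto simp: sos_cone_def)
    define \<phi> where "\<phi> = (\<lambda>x. \<Sum>b\<in>B. sgn_on S b * e b x)"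
    have \<phi>U: "\<phi> \<in> forms (2 * k)" unfolding \<phi>_def by (intro mem_sum eU)
    have linU: "lin c \<in> forms (2 * k)" using lin_M M_sub by auto
    have rU: "(r_pow k :: real ^ 'n \<Rightarrow> real) \<in> forms (2 * k)" by (rule r_pow_in_forms)
    have r0: "bom (2 * k) (r_pow k) \<phi> = 0"
    proof -
      have "bom (2 * k) \<phi> (r_pow k) = (\<Sum>b\<in>B. sgn_on S b * bom (2 * k) (e b) (r_pow k))"
        unfolding \<phi>_def by (intro sum_left eU rU)
      also have "\<dots> = 0"
        using eM by (intro sum.neutral) (auto simp: M_iff)
      finally show ?thesis by (simp add: bom_commute)
    qed
    have "(\<Sum>b\<in>B. sgn_on S b * X c b) = (\<Sum>b\<in>B. sgn_on S b * bom (2 * k) (lin c) (e b))"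
      by (simp add: X_def)
    also have "\<dots> = bom (2 * k) (lin c) \<phi>"
      unfolding \<phi>_def by (intro sum_right[symmetric] eU linU)
    also have "\<dots> = bom (2 * k) (\<lambda>x. lin c x + r_pow k x) \<phi>"
      by (simp add: add_left[OF linU rU \<phi>U] r0)
    also have "\<dots> = bom (2 * k) (\<lambda>x. \<Sum>j<m. 1 * (g j x)\<^sup>2) \<phi>"
      by (simp add: g(2))
    also have "\<dots> = (\<Sum>j<m. 1 * bom (2 * k) (\<lambda>x. (g j x)\<^sup>2) \<phi>)"
      using g(1) by (intro sum_left \<phi>U square_in_forms) auto
    also have "\<dots> \<le> (\<Sum>j<m. h S * (\<integral>x. (g j x)\<^sup>2 \<partial>\<sigma>))"
    proof (rule sum_mono)
      fix j assume "j \<in> {..<m}"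
      then have gj: "g j \<in> forms k" using g(1) by simp
      have "?V \<noteq> {}" by (rule lattice_net_exponents(2))
      then obtain v0 where "v0 \<in> ?V" by blast
      then have "H S \<ge> 0" using H[of v0 S] by linarith
      have "\<bar>bom (2 * k) \<phi> (\<lambda>x. (g j x)\<^sup>2)\<bar> \<le> 2 * H S * bom k (g j) (g j)"
      proof (rule bom_square_le_net[OF gj])
        fix v assume "v \<in> ?V"
        then show "\<bar>bom (2 * k) \<phi> (\<lambda>x. (net_form k v x)\<^sup>2)\<bar> \<le> H S"
          unfolding \<phi>_def bom_sum_wt by (rule H)
      qed
      also have "\<dots> \<le> 2 * H S * (\<Lambda> k * (\<integral>x. (g j x)\<^sup>2 \<partial>\<sigma>))"
        using \<open>H S \<ge> 0\<close> by (intro mult_left_mono bom_le gj) auto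
      finally show "1 * bom (2 * k) (\<lambda>x. (g j x)\<^sup>2) \<phi> \<le> h S * (\<integral>x. (g j x)\<^sup>2 \<partial>\<sigma>)"
        by (simp add: h_def bom_commute[of _ _ \<phi>] mult_ac)
    qed
    also have "\<dots> = h S * (\<integral>x. lin c x + r_pow k x \<partial>\<sigma>)"
    proof -
      have "(\<integral>x. lin c x + r_pow k x \<partial>\<sigma>) = (\<integral>x. (\<Sum>j<m. (g j x)\<^sup>2) \<partial>\<sigma>)"
        using fun_cong[OF g(2)] by simp
      also have "\<dots> = (\<Sum>j<m. \<integral>x. (g j x)\<^sup>2 \<partial>\<sigma>)"
        using g(1) square_in_forms by (intro Bochner_Integration.integral_sum integrable_form[of _ "2 * k"]) auto
      finally show ?thesis by (simp add: sum_distrib_left)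
    qed
    also have "(\<integral>x. lin c x + r_pow k x \<partial>\<sigma>) = 1"
      using lin_M[of c] integrable_form[OF linU] integrable_form[OF rU] integral_r_pow[of k]
      by (simp add: M_forms_def)
    finally show ?thesis by simp
  qed
  moreover have "(\<Sum>S\<in>Pow B. h S) / 2 ^ card B \<le> 12 * sqrt N * \<Lambda> k"
  proof -
    have cV: "card ?V > 0" by (simp add: card_gt_0_iff lattice_net_exponents)
    have "ln (2 * card ?V) = ln 2 + ln (card ?V)"
      using cV by (simp add: ln_mult)
    also have "\<dots> \<le> 1 * N + 14 * N"
      using ln_card_lattice_net[where ?'n='n and k=k] ln_2_less_1 N_pos by (simp add: N_def)
    finally have "ln (2 * card ?V) + t\<^sup>2 / 2 \<le> 30 * (sqrt N)\<^sup>2"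
      by (simp add: t_def power_mult_distrib)
    then have "(ln (2 * card ?V) + t\<^sup>2 / 2) / t \<le> 30 * (sqrt N)\<^sup>2 / t"
      using t by (simp add: divide_right_mono)
    also have "\<dots> = 6 * sqrt N"
    proof -
      have "30 * r\<^sup>2 / (5 * r) = 6 * r" if "r > 0" for r :: real
        using that by (simp add: power2_eq_square)
      moreover have "sqrt N > 0" using N_pos by simp
      ultimately show ?thesis
        unfolding t_def by blast
    qed
    finally have "(\<Sum>S\<in>Pow B. H S) / 2 ^ card B \<le> 6 * sqrt N"
      using avg by linarith
    then have "2 * \<Lambda> k * ((\<Sum>S\<in>Pow B. H S) / 2 ^ card B) \<le> 2 * \<Lambda> k * (6 * sqrt N)"
      using \<Lambda>_pos[of k] by (intro mult_left_mono) auto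
    then show ?thesis
      unfolding h_def sum_distrib_left[symmetric] by (simp add: mult_ac)
  qed
  ultimately show ?thesis by blast
qed

abbreviation "sos_set \<equiv> {c \<in> B \<rightarrow>\<^sub>E UNIV. (\<lambda>x. lin c x + r_pow k x) \<in> sos_cone k}"
abbreviation "ball_set \<equiv> {c \<in> B \<rightarrow>\<^sub>E UNIV. (\<Sum>b\<in>B. (c b)\<^sup>2) \<le> (1::real)}"

definition "W = 12 * sqrt N * \<Lambda> k"

lemma W_pos: "W > 0"
  using N_pos \<Lambda>_pos[of k] by (simp add: W_def)

lemma emeasure_sos_le:
  "emeasure (PiR B) sos_set \<le> ennreal ((\<Prod>b\<in>B. s b) * (2 * W * exp 1 / card B) ^ card B)"
proof -
  define D where "D = real (card B)"
  have D: "D > 0" using two_le_card(1) by (simp add: D_def)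
  obtain h where h: "\<And>c S. (\<lambda>x. lin c x + r_pow k x) \<in> sos_cone k \<Longrightarrow> (\<Sum>b\<in>B. sgn_on S b * X c b) \<le> h S"
    and avg: "(\<Sum>S\<in>Pow B. h S) / 2 ^ card B \<le> W"
    using sos_upper_set unfolding W_def by blast
  \<comment> \<open>The polytope cut out by the half-spaces of all sign vectors; it contains the
    image of the section under \<open>X\<close>.\<close>
  define A where "A = {x \<in> space (PiR B). \<forall>S\<in>Pow B. (\<Sum>b\<in>B. sgn_on S b * x b) \<le> h S}"
  have A: "A \<in> sets (PiR B)"
    unfolding A_def
  proof (intro sets.sets_Collect_finite_All)
    show "{x \<in> space (PiR B). (\<Sum>b\<in>B. sgn_on S b * x b) \<le> h S} \<in> sets (PiR B)" for S
      by measurable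
  qed (simp add: finB)
  \<comment> \<open>Makes the mean exponent a * W equal to D, so the exponential costs only
    \<open>exp 1\<close> per dimension.\<close>
  define a where "a = D / W"
  have a: "a > 0" using D W_pos by (simp add: a_def)
  have "emeasure (PiR B) sos_set = (\<integral>\<^sup>+c. indicator sos_set c \<partial>PiR B)"
    using sos_set_measurable by simp
  also have "\<dots> \<le> (\<integral>\<^sup>+c. indicator A (X c) \<partial>PiR B)"
  proof (rule nn_integral_mono)
    fix c
    show "indicator sos_set c \<le> (indicator A (X c) :: ennreal)"
    proof (cases "c \<in> sos_set")
      case True
      have "X c \<in> space (PiR B)" by (simp add: X_def space_PiR)
      then have "indicator A (X c) = (1 :: ennreal)" using h True by (simp add: A_def)
      then show ?thesis by (simp add: indicator_def)
    next
      case False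
      then have "indicator sos_set c = (0 :: ennreal)" by (rule indicator_simps(2))
      then show ?thesis by (simp only: zero_le)
    qed
  qed
  also have "\<dots> = ennreal (\<Prod>b\<in>B. s b) * (\<integral>\<^sup>+x. indicator A x \<partial>PiR B)"
    using A by (intro X_integral) simp
  also have "(\<integral>\<^sup>+x. indicator A x \<partial>PiR B) \<le> ennreal ((2 / a) ^ card B * exp ((\<Sum>S\<in>Pow B. a * h S) / 2 ^ card B))"
  proof (rule nn_integral_sign_support_bound[OF finB a])
    show "indicator A \<in> borel_measurable (PiR B)" using A by simp
    fix x S assume S: "S \<subseteq> B"
    show "indicator A x \<le> ennreal (exp (a * h S - a * (\<Sum>i\<in>B. sgn_on S i * x i)))"
    proof (cases "x \<in> A")
      case True
      then have "a * (\<Sum>i\<in>B. sgn_on S i * x i) \<le> a * h S"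
        using S a by (intro mult_left_mono) (auto simp: A_def)
      then show ?thesis using True by simp
    qed simp
  qed
  also have "(2 / a) ^ card B * exp ((\<Sum>S\<in>Pow B. a * h S) / 2 ^ card B) \<le> (2 / a) ^ card B * exp D"
  proof -
    have "(\<Sum>S\<in>Pow B. a * h S) / 2 ^ card B = a * ((\<Sum>S\<in>Pow B. h S) / 2 ^ card B)"
      by (simp add: sum_distrib_left)
    also have "\<dots> \<le> a * W"
      using avg a by (intro mult_left_mono) auto
    also have "\<dots> = D" using W_pos by (simp add: a_def)
    finally show ?thesis using a by (intro mult_left_mono) auto
  qed
  also have "(2 / a) ^ card B * exp D = (2 * W * exp 1 / card B) ^ card B"
    using exp_of_nat_mult[of "card B" "1::real"] by (simp add: a_def D_def power_divide power_mult_distrib)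
  finally show ?thesis
    using prod_s_pos by (simp add: ennreal_mult' mult_left_mono ennreal_leI)
qed

text \<open>\<theta> bounds the catalecticant of \<open>r_pow k\<close> from below relative to the
  squared Bombieri norm. It therefore suffices that the catalecticant of \<open>lin c\<close> is at
  most \<theta> in absolute value. The half-side a is chosen so that this happens on half of the
  cube.\<close>

lemma emeasure_sos_ge:
  defines "\<theta> \<equiv> (fact k)\<^sup>2 * 2 ^ k / fact (2 * k) :: real"
  defines "a \<equiv> \<theta> / (12 * sqrt N)"
  shows "ennreal ((\<Prod>b\<in>B. s b) * ((2 * a) ^ card B / 2)) \<le> emeasure (PiR B) sos_set"
proof -
  let ?V = "lattice_net (exponents k) :: (('n \<Rightarrow> nat) \<Rightarrow> real) set"
  have \<theta>: "\<theta> > 0" by (simp add: \<theta>_def)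
  have a: "a > 0" using \<theta> N_pos by (simp add: a_def)
  define t where "t = 5 * sqrt N"
  have t: "t > 0" using N_pos by (simp add: t_def)
  \<comment> \<open>The threshold is \<theta> / 2 because passing from the net to all forms doubles
    the bound.\<close>
  define G where "G = {x \<in> B \<rightarrow>\<^sub>E {-a..a}. \<forall>v\<in>?V. \<bar>\<Sum>b\<in>B. x b * wt v b\<bar> \<le> \<theta> / 2}"
  have small: "4 * card ?V * exp (t\<^sup>2 / 2 - t * (\<theta> / 2) / a) \<le> 1"
  proof -
    have cV: "card ?V > 0" by (simp add: card_gt_0_iff lattice_net_exponents)
    have "\<theta> / a = 12 * sqrt N"
      using \<theta> N_pos by (simp add: a_def)
    then have "t * (\<theta> / 2) / a = t * (12 * sqrt N) / 2"
      by (metis times_divide_eq_left times_divide_eq_right)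
    also have "\<dots> = 30 * N"
      using N_pos by (simp add: t_def)
    \<comment> \<open>The exponent is 25 N / 2 - 30 N, which beats ln (4 * \<open>card ?V\<close>)
      \<le> 16 N.\<close>
    finally have e: "t\<^sup>2 / 2 - t * (\<theta> / 2) / a = - (17.5 * N)"
      by (simp add: t_def power_mult_distrib)
    have "ln (4 * card ?V) = 2 * ln 2 + ln (card ?V)"
      using cV ln_realpow[of 2 2] by (simp add: ln_mult)
    also have "\<dots> \<le> 2 * N + 14 * N"
      using ln_card_lattice_net[where ?'n='n and k=k] ln_2_less_1 N_pos by (simp add: N_def)
    finally have "ln (4 * card ?V) + - (17.5 * N) \<le> 0" by simp
    then have "exp (ln (4 * card ?V) + - (17.5 * N)) \<le> 1" by simp
    then show ?thesis
      unfolding e using cV by (simp only: exp_add) simp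
  qed
  have wt: "\<And>v. v \<in> ?V \<Longrightarrow> (\<Sum>b\<in>B. (wt v b)\<^sup>2) \<le> 1" by (rule wt_le)
  have G: "G \<in> sets (PiR B)" "ennreal ((2 * a) ^ card B / 2) \<le> emeasure (PiR B) G"
    unfolding G_def
    by (rule box_good_set[where w=wt, OF finB lattice_net_exponents(1) a t wt small]; assumption)+
  have incl: "c \<in> sos_set" if c: "c \<in> space (PiR B)" and G: "X c \<in> G" for c
  proof -
    have linU: "lin c \<in> forms (2 * k)" using lin_M M_sub by auto
    have rU: "(r_pow k :: real ^ 'n \<Rightarrow> real) \<in> forms (2 * k)" by (rule r_pow_in_forms)
    have expand: "lin c = (\<lambda>x. \<Sum>b\<in>B. X c b * e b x)"
      using e_expand[OF lin_M[of c]] by (simp add: X_def)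
    have "(\<lambda>x. lin c x + r_pow k x) \<in> sos_cone k"
    proof (rule sos_if_catalecticant_psd)
      show "(\<lambda>x. lin c x + r_pow k x) \<in> forms (2 * k)" by (rule mem_add[OF linU rU])
      fix g :: "real ^ 'n \<Rightarrow> real" assume g: "g \<in> forms k"
      have g2: "(\<lambda>x. (g x)\<^sup>2) \<in> forms (2 * k)" by (rule square_in_forms[OF g])
      have "\<bar>bom (2 * k) (lin c) (\<lambda>x. (g x)\<^sup>2)\<bar> \<le> 2 * (\<theta> / 2) * bom k g g"
      proof (rule bom_square_le_net[OF g])
        fix v assume "v \<in> ?V"
        then show "\<bar>bom (2 * k) (lin c) (\<lambda>x. (net_form k v x)\<^sup>2)\<bar> \<le> \<theta> / 2"
          using G unfolding expand bom_sum_wt G_def by blast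
      qed
      \<comment> \<open>The value of \<theta> is dictated by \<theta> * \<open>\<Lambda> k\<close> *
        \<open>ckap CARD('n) k\<close> = 1.\<close>
      moreover have "\<theta> * bom k g g \<le> bom (2 * k) (r_pow k) (\<lambda>x. (g x)\<^sup>2)"
      proof -
        have "\<theta> * bom k g g \<le> \<theta> * (\<Lambda> k * (\<integral>x. (g x)\<^sup>2 \<partial>\<sigma>))"
          using \<theta> by (intro mult_left_mono bom_le g) auto
        also have "\<dots> = \<theta> * (\<Lambda> k * (ckap CARD('n) k * bom (2 * k) (r_pow k) (\<lambda>x. (g x)\<^sup>2)))"
          using integral_form[OF g2] by (simp add: bom_commute)
        also have "\<dots> = bom (2 * k) (r_pow k) (\<lambda>x. (g x)\<^sup>2)"
          using kap_pos[of k] by (simp add: \<theta>_def \<Lambda>_def ckap_def power2_eq_square)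
        finally show ?thesis .
      qed
      ultimately show "0 \<le> bom (2 * k) (\<lambda>x. lin c x + r_pow k x) (\<lambda>x. (g x)\<^sup>2)"
        by (simp add: add_left[OF linU rU g2])
    qed
    then show ?thesis using c by (simp add: space_PiR)
  qed
  have "ennreal ((\<Prod>b\<in>B. s b) * ((2 * a) ^ card B / 2)) = ennreal (\<Prod>b\<in>B. s b) * ennreal ((2 * a) ^ card B / 2)"
    by (rule ennreal_mult'[OF less_imp_le[OF prod_s_pos]])
  also have "\<dots> \<le> ennreal (\<Prod>b\<in>B. s b) * (\<integral>\<^sup>+x. indicator G x \<partial>PiR B)"
    using G by (intro mult_left_mono) auto
  also have "\<dots> = (\<integral>\<^sup>+c. indicator G (X c) \<partial>PiR B)"
    using G(1) by (intro X_integral[symmetric]) simp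
  also have "\<dots> \<le> (\<integral>\<^sup>+c. indicator sos_set c \<partial>PiR B)"
  proof (rule nn_integral_mono)
    fix c assume c: "c \<in> space (PiR B)"
    show "indicator G (X c) \<le> (indicator sos_set c :: ennreal)"
      using incl[OF c] by (cases "X c \<in> G") (simp_all add: indicator_def)
  qed
  also have "\<dots> = emeasure (PiR B) sos_set"
    using sos_set_measurable by simp
  finally show ?thesis .
qed

end

section \<open>Volume ratios and explicit constants\<close>

lemma prod_lessThan_add: "(\<Prod>i<m + l. f i) = (\<Prod>i<m. f i) * (\<Prod>i<l. f (m + i))"
  for f :: "nat \<Rightarrow> real"
  by (induction l) (simp_all add: mult.assoc)

lemma power_powr_inverse:
  fixes y :: real assumes "y > 0" "D > 0" shows "(y ^ D) powr (1 / real D) = y"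
proof -
  have "(y ^ D) powr (1 / real D) = (y powr real D) powr (1 / real D)"
    using powr_realpow[OF assms(1), of D] by simp
  also have "\<dots> = y powr 1"
    using assms by (simp only: powr_powr) simp
  finally show ?thesis using assms by simp
qed

context sos_volume
begin

abbreviation "mS \<equiv> measure (PiR B) sos_set"
abbreviation "mB \<equiv> measure (PiR B) ball_set"

lemma mB_le: "mB \<le> (2 * exp 1 / sqrt (card B)) ^ card B"
  unfolding measure_def by (rule enn2real_leI[OF _ emeasure_unit_ball_le[OF finB B_ne]]) simp

lemma mB_ge: "(2 / sqrt (card B)) ^ card B \<le> mB"
proof -
  have "emeasure (PiR B) ball_set \<noteq> \<infinity>"
    using emeasure_unit_ball_le[OF finB B_ne] by (auto simp: top_unique)
  then have "emeasure (PiR B) ball_set = ennreal mB"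
    by (intro emeasure_eq_ennreal_measure) simp
  then show ?thesis
    using emeasure_unit_ball_ge[OF finB B_ne] by (simp add: ennreal_le_iff)
qed

lemma mB_pos: "mB > 0"
proof -
  have "(2 / sqrt (card B)) ^ card B > 0"
    using two_le_card(1) by (intro zero_less_power divide_pos_pos) auto
  then show ?thesis using mB_ge by linarith
qed

text \<open>The factor (1 / sqrt D)^D from \<open>prod_s_le\<close> cancels against the cube inside
  the ball.\<close>

lemma ratio_le: "(mS / mB) powr (1 / card B) \<le> W * exp 1 / card B"
proof -
  define D where "D = card B"
  have D: "D > 0" using two_le_card(1) by (simp add: D_def)
  let ?y = "W * exp 1 / real D"
  have y: "?y > 0" using W_pos D by simp
  have "mS \<le> (\<Prod>b\<in>B. s b) * (2 * W * exp 1 / real D) ^ D"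
    unfolding measure_def D_def using prod_s_pos W_pos
    by (intro enn2real_leI[OF _ emeasure_sos_le]) auto
  also have "\<dots> \<le> (1 / sqrt (real D)) ^ D * (2 * W * exp 1 / real D) ^ D"
    using prod_s_le W_pos by (intro mult_right_mono) (auto simp: D_def)
  also have "\<dots> = ?y ^ D * (2 / sqrt (real D)) ^ D"
  proof -
    have "1 / sqrt (real D) * (2 * W * exp 1 / real D) = ?y * (2 / sqrt (real D))" by (simp add: mult_ac)
    then show ?thesis by (simp only: power_mult_distrib[symmetric])
  qed
  also have "\<dots> \<le> ?y ^ D * mB"
    using mB_ge y by (intro mult_left_mono) (auto simp: D_def)
  finally have "mS / mB \<le> ?y ^ D"
    using mB_pos by (simp add: pos_divide_le_eq)
  then have "(mS / mB) powr (1 / real D) \<le> (?y ^ D) powr (1 / real D)"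
    using mB_pos by (intro powr_mono2) auto
  also have "(?y ^ D) powr (1 / real D) = ?y"
    using y D by (rule power_powr_inverse)
  finally show ?thesis by (simp add: D_def)
qed

definition "\<theta> = ((fact k)\<^sup>2 * 2 ^ k / fact (2 * k) :: real)"

lemma ratio_ge:
  "1 / sqrt (\<Lambda> (2 * k)) * (\<theta> / (12 * sqrt N)) * sqrt (card B) / exp 1 / sqrt 2 \<le> (mS / mB) powr (1 / card B)"
proof -
  define D where "D = card B"
  have D: "D \<ge> 2" using two_le_card(1) by (simp add: D_def)
  define a where "a = \<theta> / (12 * sqrt N)"
  define L where "L = 1 / sqrt (\<Lambda> (2 * k))"
  have a: "a > 0" using N_pos by (simp add: a_def \<theta>_def)
  have L: "L > 0" using \<Lambda>_pos[of "2 * k"] by (simp add: L_def)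
  define y where "y = L * a * sqrt (real D) / exp 1"
  have y: "y > 0" using a L D by (simp add: y_def)
  have fin: "emeasure (PiR B) sos_set \<noteq> \<infinity>"
    using emeasure_sos_le by (auto simp: top_unique)
  then have "emeasure (PiR B) sos_set = ennreal mS"
    by (intro emeasure_eq_ennreal_measure) simp
  then have "ennreal ((\<Prod>b\<in>B. s b) * ((2 * a) ^ D / 2)) \<le> ennreal mS"
    using emeasure_sos_ge by (simp only: a_def \<theta>_def D_def)
  then have mS: "(\<Prod>b\<in>B. s b) * ((2 * a) ^ D / 2) \<le> mS"
    by (simp add: ennreal_le_iff)
  have "y ^ D / 2 * mB \<le> y ^ D / 2 * (2 * exp 1 / sqrt (real D)) ^ D"
    using mB_le y by (intro mult_left_mono) (auto simp: D_def)
  also have "\<dots> = (y * (2 * exp 1 / sqrt (real D))) ^ D / 2"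
    by (simp only: power_mult_distrib times_divide_eq_left)
  also have "y * (2 * exp 1 / sqrt (real D)) = L * (2 * a)"
    using D by (simp add: y_def)
  also have "(L * (2 * a)) ^ D / 2 = L ^ D * ((2 * a) ^ D / 2)"
    by (simp add: power_mult_distrib)
  also have "\<dots> \<le> (\<Prod>b\<in>B. s b) * ((2 * a) ^ D / 2)"
    using prod_s_ge a by (intro mult_right_mono) (auto simp: L_def D_def)
  finally have "y ^ D / 2 \<le> mS / mB"
    using mS mB_pos by (simp add: pos_le_divide_eq)
  then have "(y ^ D / 2) powr (1 / real D) \<le> (mS / mB) powr (1 / real D)"
    using y by (intro powr_mono2) auto
  moreover have "(y ^ D / 2) powr (1 / real D) = y * (1 / 2) powr (1 / real D)"
  proof -
    have "(y ^ D * (1 / 2)) powr (1 / real D) = (y ^ D) powr (1 / real D) * (1 / 2) powr (1 / real D)"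
      using y by (intro powr_mult)
    also have "(y ^ D) powr (1 / real D) = y"
      using y D by (intro power_powr_inverse) auto
    finally show ?thesis by simp
  qed
  \<comment> \<open>Keeping only half of the cube costs at most 1 / sqrt 2 after the D-th root,
    because D \<ge> 2.\<close>
  moreover have "(1 / 2 :: real) powr (1 / 2) \<le> (1 / 2) powr (1 / real D)"
    using D by (intro powr_mono') (auto simp: field_simps)
  moreover have "(1 / 2 :: real) powr (1 / 2) = 1 / sqrt 2"
    by (simp add: powr_half_sqrt real_sqrt_divide)
  ultimately have "y * (1 / sqrt 2) \<le> (mS / mB) powr (1 / real D)"
    using y mult_left_mono[of "1 / sqrt 2" "(1 / 2) powr (1 / real D)" y] by linarith
  then show ?thesis by (simp add: y_def L_def a_def D_def)
qed

text \<open>P Q and P2 Q2 are the numerators of the dimension and of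
  \<open>\<Lambda> (2 * k)\<close>, cut at index k. The bound P2 \<le> Q lets the dimension absorb
  \<open>\<Lambda> k\<close>, while the bound on Q2 is the source of (n/2 + 2k)^k in the
  theorem.\<close>

lemma counts:
  defines "n \<equiv> real CARD('n)"
  defines "P \<equiv> (\<Prod>i<k. n + real i)" and "P2 \<equiv> (\<Prod>i<k. n + 2 * real i)"
    and "Q \<equiv> (\<Prod>i<k. n + real k + real i)" and "Q2 \<equiv> (\<Prod>i<k. n + 2 * real k + 2 * real i)"
  shows "real N * fact k = P" "\<Lambda> k = P2 / fact k" "\<Lambda> (2 * k) = P2 * Q2 / fact (2 * k)"
    and "P * Q / fact (2 * k) \<le> 3 / 2 * card B"
    and "n ^ k \<le> P" "0 < P2" "P2 \<le> Q" "Q2 \<le> (n + 4 * real k) ^ k"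
proof -
  have n: "n > 0" using n2 by (simp add: n_def)
  show "real N * fact k = P"
    unfolding N_def P_def n_def by (subst card_exponents) simp
  show "\<Lambda> k = P2 / fact k"
    unfolding \<Lambda>_def kap_def P2_def n_def by simp
  have  "(\<Prod>i<k + k. n + 2 * real i) = P2 * Q2"
    unfolding prod_lessThan_add P2_def Q2_def of_nat_add by (simp only: distrib_left add.assoc)
  then show "\<Lambda> (2 * k) = P2 * Q2 / fact (2 * k)"
    unfolding \<Lambda>_def kap_def n_def mult_2[of k] by simp
  have "(\<Prod>i<k + k. n + real i) = P * Q"
    unfolding prod_lessThan_add P_def Q_def of_nat_add by (simp only: add.assoc)
  then have "real (card (exponents (2 * k) :: ('n \<Rightarrow> nat) set)) * fact (2 * k) = P * Q"
    unfolding n_def mult_2[of k] by (subst card_exponents) simp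
  then have "P * Q / fact (2 * k) = real (card (exponents (2 * k) :: ('n \<Rightarrow> nat) set))"
    by (simp add: divide_eq_eq)
  then show "P * Q / fact (2 * k) \<le> 3 / 2 * card B"
    using two_le_card(2) by simp
  have "(\<Prod>i<k. n) \<le> P" unfolding P_def using n by (intro prod_mono) auto
  then show "n ^ k \<le> P" by simp
  show "0 < P2" unfolding P2_def using n by (intro prod_pos) (auto intro: add_pos_nonneg)
  show "P2 \<le> Q" unfolding P2_def Q_def using n by (intro prod_mono) auto
  have "Q2 \<le> (\<Prod>i<k. n + 4 * real k)" unfolding Q2_def using n by (intro prod_mono) auto
  then show "Q2 \<le> (n + 4 * real k) ^ k" by simp
qed

lemma powr_half_power: "x > 0 \<Longrightarrow> (x powr (real m / 2))\<^sup>2 = x ^ m" for x :: real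
  by (simp add: powr_realpow power2_eq_square flip: powr_add)

text \<open>Because n^(k/2) \<le> sqrt N * k!, multiplying W by n^(k/2) replaces sqrt N by at most N
  * k!, the numerator P. Then P * P2 \<le> P * Q is controlled by the dimension.\<close>

lemma upper_constant:
  "W * exp 1 / card B \<le> 4 ^ (2 * k) * fact (2 * k) * sqrt 24 / fact k * real CARD('n) powr (- (real k / 2))"
proof -
  define n where "n = real CARD('n)"
  define P where "P = (\<Prod>i<k. n + real i)"
  define P2 where "P2 = (\<Prod>i<k. n + 2 * real i)"
  define Q where "Q = (\<Prod>i<k. n + real k + real i)"
  define A where "A = sqrt N"
  define R where "R = n powr (real k / 2)"
  define D where "D = real (card B)"
  note c = counts[folded n_def, folded P_def P2_def Q_def]
  have n: "n > 0" using n2 by (simp add: n_def)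
  have A: "A > 0" "A\<^sup>2 = N" using N_pos by (auto simp: A_def)
  have R: "R > 0" "R\<^sup>2 = n ^ k" using n by (auto simp: R_def powr_half_power)
  have D: "D > 0" using two_le_card(1) by (simp add: D_def)
  have P: "P = A\<^sup>2 * fact k" using c(1) A by simp
  have f1: "(fact k :: real) \<ge> 1" by (rule fact_ge_1)
  have "R\<^sup>2 \<le> P" using c(5) R by simp
  also have "\<dots> \<le> P * fact k"
    using mult_left_mono[OF f1, of P] P by simp
  also have "\<dots> = (A * fact k)\<^sup>2" unfolding P by (simp add: power2_eq_square)
  finally have RA: "R \<le> A * fact k"
    by (rule power2_le_imp_le) (use A in simp)
  have "A\<^sup>2 * fact k * P2 \<le> P * Q"
    unfolding P using c(7) A by (intro mult_left_mono) auto
  also have "\<dots> \<le> 3 / 2 * D * fact (2 * k)"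
    using c(4) by (simp add: D_def pos_divide_le_eq)
  finally have DP: "A\<^sup>2 * fact k * P2 \<le> 3 / 2 * D * fact (2 * k)" .
  have "W * R * fact k = 12 * A * P2 * R"
    by (simp add: W_def A_def c(2))
  also have "\<dots> \<le> 12 * A * P2 * (A * fact k)"
    using RA A c(6) by (intro mult_left_mono) auto
  also have "\<dots> = 12 * (A\<^sup>2 * fact k * P2)"
    by (simp add: power2_eq_square)
  also have "\<dots> \<le> 12 * (3 / 2 * D * fact (2 * k))"
    using DP by (intro mult_left_mono) auto
  finally have "W * R * fact k \<le> 18 * D * fact (2 * k)" by simp
  then have "(W * R * fact k) * exp 1 \<le> (18 * D * fact (2 * k)) * 3"
    by (rule mult_mono) (use exp_le D in auto)
  \<comment> \<open>With \<open>exp 1\<close> \<le> 3 the constant so far is 18 * 3 = 54, which fits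
    under 64.\<close>
  also have "\<dots> \<le> (16 ^ k * 4) * D * fact (2 * k)"
  proof -
    have "(16::real) ^ 1 \<le> 16 ^ k" using k1 by (intro power_increasing) auto
    then have "54 \<le> (16::real) ^ k * 4" by simp
    then have "54 * (D * fact (2 * k)) \<le> 16 ^ k * 4 * (D * fact (2 * k))"
      using D by (intro mult_right_mono) auto
    then show ?thesis by simp
  qed
  also have "\<dots> \<le> (16 ^ k * sqrt 24) * D * fact (2 * k)"
    using D real_le_rsqrt[of 4 24] by (intro mult_right_mono mult_left_mono) auto
  also have "(16::real) ^ k = 4 ^ (2 * k)"
    by (simp add: power_mult)
  finally have "W * exp 1 * R * fact k \<le> 4 ^ (2 * k) * fact (2 * k) * sqrt 24 * D"
    by (simp only: mult.assoc mult.left_commute mult.commute)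
  then have "W * exp 1 / D \<le> 4 ^ (2 * k) * fact (2 * k) * sqrt 24 / fact k * (1 / R)"
    using D R by (simp add: divide_simps mult_ac)
  then show ?thesis
    by (simp add: R_def D_def n_def powr_minus_divide)
qed

text \<open>Once the common factor \<theta> is split off, both sides are square roots. The
  comparison of their squares reduces to L * N \<le> 3/2 * D * M.\<close>

lemma lower_constant:
  "(fact k)\<^sup>2 / (4 ^ (2 * k) * fact (2 * k) * sqrt 24) *
      (real CARD('n) powr (real k / 2) / (real CARD('n) / 2 + 2 * real k) ^ k)
    \<le> 1 / sqrt (\<Lambda> (2 * k)) * (\<theta> / (12 * sqrt N)) * sqrt (card B) / exp 1 / sqrt 2"
proof -
  define n where "n = real CARD('n)"
  define P where "P = (\<Prod>i<k. n + real i)"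
  define P2 where "P2 = (\<Prod>i<k. n + 2 * real i)"
  define Q where "Q = (\<Prod>i<k. n + real k + real i)"
  define Q2 where "Q2 = (\<Prod>i<k. n + 2 * real k + 2 * real i)"
  define M where "M = (n + 4 * real k) ^ k"
  define R where "R = n powr (real k / 2)"
  define D where "D = real (card B)"
  define L where "L = \<Lambda> (2 * k)"
  note c = counts[folded n_def, folded P_def P2_def Q_def Q2_def]
  have n: "n > 0" using n2 by (simp add: n_def)
  have R: "R > 0" "R\<^sup>2 = n ^ k" using n by (auto simp: R_def powr_half_power)
  have D: "D > 0" using two_le_card(1) by (simp add: D_def)
  have L: "L > 0" using \<Lambda>_pos by (simp add: L_def)
  have N: "real N \<ge> 1" using N_pos by simp
  have M: "M > 0" "n ^ k \<le> M" using n by (auto simp: M_def intro: power_mono)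
  have P: "P \<ge> real N" "P > 0"
    using c(1) N fact_ge_1[of k, where 'a=real] mult_left_mono[of 1 "fact k" "real N"] by auto
  have "L * N * fact (2 * k) = P2 * Q2 * N"
    by (simp add: L_def c(3))
  also have "\<dots> \<le> Q * M * P"
    using c(6,7,8) P(1) M N n unfolding M_def[symmetric]
    by (intro mult_mono) (auto simp: Q2_def intro!: prod_nonneg mult_nonneg_nonneg)
  also have "\<dots> \<le> 3 / 2 * D * fact (2 * k) * M"
    using c(4) M by (simp add: D_def pos_divide_le_eq mult_ac)
  finally have LN: "L * N \<le> 3 / 2 * D * M"
    by (simp add: mult_ac)
  define Z where "Z = sqrt D / (sqrt L * 12 * sqrt N * exp 1 * sqrt 2)"
  define T where "T = R / (16 ^ k * sqrt 24 * M)"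
  have Z: "Z \<ge> 0" using D L by (simp add: Z_def)
  have "T\<^sup>2 = n ^ k / ((16 ^ k)\<^sup>2 * 24 * M\<^sup>2)"
    using R by (simp add: T_def power_divide power_mult_distrib)
  also have "\<dots> \<le> M / (16\<^sup>2 * 24 * M\<^sup>2)"
  proof (rule frac_le)
    have "(16::real) ^ 1 \<le> 16 ^ k" using k1 by (intro power_increasing) auto
    then have "(16::real)\<^sup>2 \<le> (16 ^ k)\<^sup>2" by (intro power_mono) auto
    then show "16\<^sup>2 * 24 * M\<^sup>2 \<le> (16 ^ k)\<^sup>2 * 24 * M\<^sup>2"
      by (intro mult_right_mono) auto
  qed (use M in auto)
  also have "\<dots> = 1 / (6144 * M)"
    using M by (simp add: power2_eq_square)
  \<comment> \<open>Here 144 * 9 * 2 * 3/2 = 3888 meets 16^2 * 24 = 6144; the 9 replaces the square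
    of \<open>exp 1\<close>.\<close>
  also have "\<dots> \<le> D / (L * 144 * N * 9 * 2)"
  proof -
    have "L * 144 * N * 9 * 2 \<le> 3888 * (D * M)"
      using LN by simp
    also have "\<dots> \<le> 6144 * (D * M)"
      using D M by (intro mult_right_mono) auto
    finally show ?thesis
      using L N M D by (simp add: divide_simps mult_ac)
  qed
  also have "\<dots> \<le> D / (L * 144 * N * (exp 1)\<^sup>2 * 2)"
  proof -
    have "(exp 1 :: real)\<^sup>2 \<le> 3\<^sup>2" using exp_le by (intro power_mono) auto
    then have "L * 144 * N * (exp 1)\<^sup>2 * 2 \<le> L * 144 * N * 9 * 2"
      using L by (intro mult_right_mono mult_left_mono) auto
    then show ?thesis
      using D L N by (intro divide_left_mono) auto
  qed
  also have "\<dots> = Z\<^sup>2"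
    using D L by (simp add: Z_def power_divide power_mult_distrib)
  finally have TZ: "T \<le> Z" by (rule power2_le_imp_le[OF _ Z])
  \<comment> \<open>The power 2^k released here is the one contained in \<theta>.\<close>
  have "(n / 2 + 2 * real k) ^ k = M / 2 ^ k"
    unfolding M_def power_divide[symmetric] by (rule arg_cong[of _ _ "\<lambda>x. x ^ k"]) simp
  then have "(fact k)\<^sup>2 / (4 ^ (2 * k) * fact (2 * k) * sqrt 24) * (R / (n / 2 + 2 * real k) ^ k) = \<theta> * T"
    using M unfolding \<theta>_def T_def by (simp add: power_mult) (simp add: mult_ac)
  also have "\<dots> \<le> \<theta> * Z"
    using TZ by (intro mult_left_mono) (auto simp: \<theta>_def)
  also have "\<dots> = 1 / sqrt L * (\<theta> / (12 * sqrt N)) * sqrt D / exp 1 / sqrt 2"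
    by (simp add: Z_def)
  finally show ?thesis by (simp only: R_def n_def L_def D_def)
qed

end

theorem theorem7p1:
  fixes \<sigma> :: "(real ^ 'n) measure"
    and B :: "(real ^ 'n \<Rightarrow> real) set"
    and n k D :: nat
  defines "n \<equiv> CARD('n)"
    and "D \<equiv> real_fun.dim (M_forms \<sigma> k)"
  assumes "n \<ge> 2" and "k \<ge> 1"
    and "rotation_invariant_prob \<sigma>"
    and "orthonormal_basis \<sigma> (M_forms \<sigma> k) B"
  shows "(fact k)\<^sup>2 / (4 ^ (2 * k) * fact (2 * k) * sqrt 24)
             * (real n powr (real k / 2) / (real n / 2 + 2 * real k) ^ k)
           \<le> (vol B (sos_section \<sigma> k) / vol B (M_unit_ball \<sigma> k)) powr (1 / real D)
       \<and> (vol B (sos_section \<sigma> k) / vol B (M_unit_ball \<sigma> k)) powr (1 / real D)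
           \<le> 4 ^ (2 * k) * fact (2 * k) * sqrt 24 / fact k * real n powr (- (real k / 2))"
proof -
  interpret sos_volume \<sigma> k B
    using assms by unfold_locales (simp_all add: n_def)
  show ?thesis
    unfolding vol_sos vol_ball n_def D_def dim_eq
    using order_trans[OF lower_constant ratio_ge] order_trans[OF ratio_le upper_constant] by blast
qed

end
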